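(* Let $k$ be an algebraically closed field of characteristic zero and let $q\in k$ be non-zero and not a root of unity. Let $\tau$ be the involutive Hopf algebra automorphism of $\mathcal{O}_q(SL_2)$ given by $\tau(a)=a$, $\tau(b)=-b$, $\tau(c)=-c$, $\tau(d)=d$. For every $\ell\in\frac12\mathbb{N}_0$, the $\tau$-twisted Frobenius--Schur indicator of the simple right $\mathcal{O}_q(SL_2)$-comodule $X_\ell$ is $$\nu^\tau(X_\ell)=+1.$$
   Context: $\mathbb{N}_0=\{0,1,2,\dots\}$. $\mathcal{O}_q(SL_2)$ is the Hopf algebra generated as an algebra by $a,b,c,d$ with relations $ab=qba$, $ac=qca$, $bd=qdb$, $cd=qdc$, $bc=cb$, $ad-qbc=1=da-q^{-1}bc$; comultiplication $\Delta(a)=a\otimes a+b\otimes c$, $\Delta(b)=a\otimes b+b\otimes d$, $\Delta(c)=c\otimes a+d\otimes c$, $\Delta(d)=c\otimes b+d\otimes d$; counit $\varepsilon(a)=\varepsilon(d)=1$, $\varepsilon(b)=\varepsilon(c)=0$; antipode $S(a)=d$, $S(b)=-q^{-1}b$, $S(c)=-qc$, $S(d)=a$. Let $\gamma:\mathcal{O}_q(SL_2)\to k$ be the algebra map with $\gamma(a)=q^{-1}$, $\gamma(b)=\gamma(c)=0$, $\gamma(d)=q$; then $S^2(x)=\gamma(x_{(1)})\,x_{(2)}\,\gamma(S(x_{(3)}))$ for all $x$, and $\gamma\circ\tau=\gamma$. For $\ell\in\frac12\mathbb{N}_0$ let $I_\ell=\{-\ell,-\ell+1,\dots,\ell\}$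 and $X_\ell=\mathrm{span}_k\{a^{\ell-i}b^{\ell+i}\mid i\in I_\ell\}\subset\mathcal{O}_q(SL_2)$, a right coideal, hence a right $\mathcal{O}_q(SL_2)$-comodule via $\Delta$; each $X_\ell$ is simple. The $\tau$-twisted Frobenius--Schur indicator of a finite-dimensional right comodule $V$ over $C=\mathcal{O}_q(SL_2)$, with coaction $v\mapsto v_{(0)}\otimes v_{(1)}$, is defined as follows. Let $V^\sharp$ be the dual space $V^\vee$ with the right coaction given by $\langle f_{(0)},v\rangle f_{(1)}=\langle f,v_{(0)}\rangle S(\tau(v_{(1)}))$, and let $j_V:V\to V^{\sharp\sharp}$ be the comodule isomorphism $\langle j_V(v),f\rangle=\langle f,v_{(0)}\rangle\gamma(v_{(1)})$. Then $\nu^\tau(V)\in k$ is the trace of the linear map $\mathrm{Hom}_C(V,V^\sharp)\to\mathrm{Hom}_C(V,V^\sharp)$, $f\mapsto f^\vee\circ j_V$, where $f^\vee$ is the transpose of $f$. *)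

theory Defs
  imports "Jordan_Normal_Form.VS_Connect" "HOL-Library.Poly_Mapping" "HOL-Algebra.QuotRing"
begin

text \<open>
  Vector spaces and algebras over a field \<^typ>\<open>'k::field\<close> are records of type
  \<^typ>\<open>('k, 'v) module\<close>, with scalars \<^term>\<open>class_ring\<close>. For a vector space that carries no
  multiplication the fields \<^const>\<open>mult\<close> and \<^const>\<open>one\<close> are irrelevant. Linear maps are
  represented by functions that are \<^const>\<open>extensional\<close> on the carrier.
\<close>

section \<open>Linear algebra\<close>

definition base_alg :: "('k::field, 'k) module" where
  "base_alg = \<lparr>carrier = UNIV, mult = (*), one = 1, zero = 0, add = (+), smult = (*)\<rparr>"

definition hom_space ::
  "('k::field, 'v, 'm) module_scheme \<Rightarrow> ('k, 'w, 'n) module_scheme \<Rightarrow> ('k, 'v \<Rightarrow> 'w) module" where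
  "hom_space V W = \<lparr>carrier = LinearCombinations.module_hom class_ring V W \<inter> extensional (carrier V),
     mult = undefined, one = undefined,
     zero = (\<lambda>v\<in>carrier V. \<zero>\<^bsub>W\<^esub>),
     add = (\<lambda>f g. \<lambda>v\<in>carrier V. f v \<oplus>\<^bsub>W\<^esub> g v),
     smult = (\<lambda>s f. \<lambda>v\<in>carrier V. s \<odot>\<^bsub>W\<^esub> f v)\<rparr>"

definition dual_space :: "('k::field, 'v, 'm) module_scheme \<Rightarrow> ('k, 'v \<Rightarrow> 'k) module" where
  "dual_space V = hom_space V base_alg"

definition transpose_map ::
  "('k::field, 'v, 'm) module_scheme \<Rightarrow> ('k, 'w, 'n) module_scheme \<Rightarrow> ('v \<Rightarrow> 'w) \<Rightarrow>
    ('w \<Rightarrow> 'k) \<Rightarrow> 'v \<Rightarrow> 'k" where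
  "transpose_map V W f = (\<lambda>\<phi>\<in>carrier (dual_space W). \<lambda>v\<in>carrier V. \<phi> (f v))"

text \<open>The trace of an endomorphism \<open>T\<close> of a finite-dimensional space, computed in any basis
  (it does not depend on the choice); \<open>c b\<close> is the \<open>b\<close>-coordinate of \<open>T b\<close>.\<close>

definition lin_trace :: "('k::field, 'v, 'm) module_scheme \<Rightarrow> ('v \<Rightarrow> 'v) \<Rightarrow> 'k" where
  "lin_trace V T =
     (let B = (SOME B. finite B \<and> vectorspace.basis class_ring V B)
      in \<Sum>b\<in>B. (THE c. c \<in> B \<rightarrow>\<^sub>E UNIV \<and> LinearCombinations.module.lincomb V c B = T b) b)"

section \<open>Monoid algebras, quotients and tensor products\<close>

definition monoid_alg :: "('g, 'm) monoid_scheme \<Rightarrow> ('k::field, 'g \<Rightarrow>\<^sub>0 'k) module" where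
  "monoid_alg G = \<lparr>carrier = {p. Poly_Mapping.keys p \<subseteq> carrier G},
     mult = (\<lambda>p r. \<Sum>x\<in>Poly_Mapping.keys p. \<Sum>y\<in>Poly_Mapping.keys r.
        Poly_Mapping.single (x \<otimes>\<^bsub>G\<^esub> y) (Poly_Mapping.lookup p x * Poly_Mapping.lookup r y)),
     one = Poly_Mapping.single \<one>\<^bsub>G\<^esub> 1,
     zero = 0,
     add = (+),
     smult = (\<lambda>s. Poly_Mapping.map ((*) s))\<rparr>"

text \<open>The linear extension of \<open>\<phi>\<close> from basis elements to formal linear combinations.\<close>

definition lin_ext ::
  "('k::field, 'b, 'm) module_scheme \<Rightarrow> ('g \<Rightarrow> 'b) \<Rightarrow> ('g \<Rightarrow>\<^sub>0 'k) \<Rightarrow> 'b" where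
  "lin_ext M \<phi> p =
     (\<Oplus>\<^bsub>M\<^esub>x\<in>Poly_Mapping.keys p. Poly_Mapping.lookup p x \<odot>\<^bsub>M\<^esub> \<phi> x)"

definition quot_alg :: "('k::field, 'b, 'm) module_scheme \<Rightarrow> 'b set \<Rightarrow> ('k, 'b set) module" where
  "quot_alg A I = \<lparr>carrier = carrier (A Quot I), mult = mult (A Quot I), one = one (A Quot I),
     zero = zero (A Quot I), add = add (A Quot I),
     smult = (\<lambda>s X. \<Union>x\<in>X. I +>\<^bsub>A\<^esub> (s \<odot>\<^bsub>A\<^esub> x))\<rparr>"

text \<open>
  \<open>V \<otimes> W\<close> is the free vector space on \<open>V \<times> W\<close> modulo the bilinearity relations. The free vector
  space is written as \<^term>\<open>monoid_alg (V \<times>\<times> W)\<close>, so that for algebras \<open>V\<close> and \<open>W\<close> the quotient is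
  the tensor product algebra with \<open>(v \<otimes> w) (v' \<otimes> w') = v v' \<otimes> w w'\<close>.
\<close>

definition bilin_rels ::
  "('k::field, 'v, 'm) module_scheme \<Rightarrow> ('k, 'w, 'n) module_scheme \<Rightarrow> ('v \<times> 'w \<Rightarrow>\<^sub>0 'k) set" where
  "bilin_rels V W =
     (let m = Poly_Mapping.single in
      {m (v \<oplus>\<^bsub>V\<^esub> v', w) 1 - m (v, w) 1 - m (v', w) 1 | v v' w.
         v \<in> carrier V \<and> v' \<in> carrier V \<and> w \<in> carrier W}
    \<union> {m (v, w \<oplus>\<^bsub>W\<^esub> w') 1 - m (v, w) 1 - m (v, w') 1 | v w w'.
         v \<in> carrier V \<and> w \<in> carrier W \<and> w' \<in> carrier W}
    \<union> {m (s \<odot>\<^bsub>V\<^esub> v, w) 1 - m (v, w) s | s v w. v \<in> carrier V \<and> w \<in> carrier W}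
    \<union> {m (v, s \<odot>\<^bsub>W\<^esub> w) 1 - m (v, w) s | s v w. v \<in> carrier V \<and> w \<in> carrier W})"

definition tensor_null ::
  "('k::field, 'v, 'm) module_scheme \<Rightarrow> ('k, 'w, 'n) module_scheme \<Rightarrow> ('v \<times> 'w \<Rightarrow>\<^sub>0 'k) set" where
  "tensor_null V W = LinearCombinations.module.span class_ring (monoid_alg (V \<times>\<times> W)) (bilin_rels V W)"

definition tensor ::
  "('k::field, 'v, 'm) module_scheme \<Rightarrow> ('k, 'w, 'n) module_scheme \<Rightarrow>
    ('k, ('v \<times> 'w \<Rightarrow>\<^sub>0 'k) set) module" where
  "tensor V W = quot_alg (monoid_alg (V \<times>\<times> W)) (tensor_null V W)"

definition pure_tensor ::
  "('k::field, 'v, 'm) module_scheme \<Rightarrow> ('k, 'w, 'n) module_scheme \<Rightarrow> 'v \<Rightarrow> 'w \<Rightarrow>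
    ('v \<times> 'w \<Rightarrow>\<^sub>0 'k) set" where
  "pure_tensor V W v w =
     tensor_null V W +>\<^bsub>monoid_alg (V \<times>\<times> W) :: ('k, 'v \<times> 'w \<Rightarrow>\<^sub>0 'k) module\<^esub> Poly_Mapping.single (v, w) 1"

text \<open>The linear map out of a tensor product into \<open>M\<close> that is induced by a bilinear map \<open>\<beta>\<close>: the
  extension of \<open>\<beta>\<close> is constant on each coset. In Sweedler notation, \<open>tensor_lift M \<beta>\<close> sends
  \<open>v\<^sub>(\<^sub>0\<^sub>) \<otimes> v\<^sub>(\<^sub>1\<^sub>)\<close> to \<open>\<beta> v\<^sub>(\<^sub>0\<^sub>) v\<^sub>(\<^sub>1\<^sub>)\<close>.\<close>

definition tensor_lift ::
  "('k::field, 'b, 'm) module_scheme \<Rightarrow> ('v \<Rightarrow> 'w \<Rightarrow> 'b) \<Rightarrow> ('v \<times> 'w \<Rightarrow>\<^sub>0 'k) set \<Rightarrow> 'b" where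
  "tensor_lift M \<beta> t = the_elem (lin_ext M (\<lambda>(v, w). \<beta> v w) ` t)"

section \<open>Right comodules and the twisted Frobenius--Schur indicator\<close>

record (overloaded) ('k::zero, 'v, 'c) comodule = "('k, 'v) module" +
  coact :: "'v \<Rightarrow> ('v \<times> 'c \<Rightarrow>\<^sub>0 'k) set"

definition comod_hom ::
  "('k::field, 'c) module \<Rightarrow> ('k, 'v, 'c) comodule \<Rightarrow> ('k, 'w, 'c) comodule \<Rightarrow> ('v \<Rightarrow> 'w) set" where
  "comod_hom C V W = {f \<in> carrier (hom_space V W). \<forall>v\<in>carrier V.
     coact W (f v) = tensor_lift (tensor W C) (\<lambda>x c. pure_tensor W C (f x) c) (coact V v)}"

text \<open>\<open>V\<^sup>\<sharp>\<close>: the coaction on \<open>f\<close> is the element \<open>f\<^sub>(\<^sub>0\<^sub>) \<otimes> f\<^sub>(\<^sub>1\<^sub>)\<close> of \<open>V\<^sup>\<or> \<otimes> C\<close> with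
  \<open>\<langle>f\<^sub>(\<^sub>0\<^sub>), v\<rangle> f\<^sub>(\<^sub>1\<^sub>) = \<langle>f, v\<^sub>(\<^sub>0\<^sub>)\<rangle> S (\<tau> v\<^sub>(\<^sub>1\<^sub>))\<close> for all \<open>v\<close>; it exists and is unique for
  finite-dimensional \<open>V\<close>.\<close>

definition sharp ::
  "('k::field, 'c) module \<Rightarrow> ('c \<Rightarrow> 'c) \<Rightarrow> ('c \<Rightarrow> 'c) \<Rightarrow> ('k, 'v, 'c) comodule \<Rightarrow>
    ('k, 'v \<Rightarrow> 'k, 'c) comodule" where
  "sharp C S \<tau> V = module.extend (dual_space V) (comodule.fields (\<lambda>f.
     THE t. t \<in> carrier (tensor (dual_space V) C) \<and>
       (\<forall>v\<in>carrier V. tensor_lift C (\<lambda>g c. g v \<odot>\<^bsub>C\<^esub> c) t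
                    = tensor_lift C (\<lambda>x c. f x \<odot>\<^bsub>C\<^esub> S (\<tau> c)) (coact V v))))"

definition j_map ::
  "('k::field, 'c) module \<Rightarrow> ('c \<Rightarrow> 'c) \<Rightarrow> ('c \<Rightarrow> 'c) \<Rightarrow> ('c \<Rightarrow> 'k) \<Rightarrow> ('k, 'v, 'c) comodule \<Rightarrow>
    'v \<Rightarrow> ('v \<Rightarrow> 'k) \<Rightarrow> 'k" where
  "j_map C S \<tau> \<gamma> V = (\<lambda>v\<in>carrier V. \<lambda>f\<in>carrier (sharp C S \<tau> V).
     tensor_lift base_alg (\<lambda>x c. f x * \<gamma> c) (coact V v))"

definition twisted_indicator ::
  "('k::field, 'c) module \<Rightarrow> ('c \<Rightarrow> 'c) \<Rightarrow> ('c \<Rightarrow> 'c) \<Rightarrow> ('c \<Rightarrow> 'k) \<Rightarrow> ('k, 'v, 'c) comodule \<Rightarrow> 'k" where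
  "twisted_indicator C S \<tau> \<gamma> V =
     (let W = sharp C S \<tau> V in
      lin_trace ((hom_space V W)\<lparr>carrier := comod_hom C V W\<rparr>)
        (\<lambda>f. compose (carrier V) (transpose_map V W f) (j_map C S \<tau> \<gamma> V)))"

section \<open>The quantized coordinate algebra of \<open>SL\<^sub>2\<close>\<close>

datatype gen = Ga | Gb | Gc | Gd

type_synonym 'k free = "gen list \<Rightarrow>\<^sub>0 'k"

definition free_alg :: "('k::field, 'k free) module" where
  "free_alg = monoid_alg \<lparr>carrier = UNIV, mult = (@), one = []\<rparr>"

definition sl2_rels :: "'k::field \<Rightarrow> 'k free set" where
  "sl2_rels q = (let m = Poly_Mapping.single in
     {m [Ga, Gb] 1 - m [Gb, Ga] q,
      m [Ga, Gc] 1 - m [Gc, Ga] q,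
      m [Gb, Gd] 1 - m [Gd, Gb] q,
      m [Gc, Gd] 1 - m [Gd, Gc] q,
      m [Gb, Gc] 1 - m [Gc, Gb] 1,
      m [Ga, Gd] 1 - m [Gb, Gc] q - m [] 1,
      m [Gd, Ga] 1 - m [Gb, Gc] (inverse q) - m [] 1})"

definition sl2_ideal :: "'k::field \<Rightarrow> 'k free set" where
  "sl2_ideal q = Idl\<^bsub>free_alg\<^esub> (sl2_rels q)"

definition Oq :: "'k::field \<Rightarrow> ('k, 'k free set) module" where
  "Oq q = quot_alg free_alg (sl2_ideal q)"

definition qgen :: "'k::field \<Rightarrow> gen \<Rightarrow> 'k free set" where
  "qgen q g = sl2_ideal q +>\<^bsub>free_alg :: ('k, 'k free) module\<^esub> Poly_Mapping.single [g] 1"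

text \<open>The algebra map from a quotient of the free algebra to \<open>A\<close> with given values on the
  generators; meaningful when the values satisfy the defining relations.\<close>

definition alg_map ::
  "('k::field, 'b, 'm) module_scheme \<Rightarrow> (gen \<Rightarrow> 'b) \<Rightarrow> 'k free set \<Rightarrow> 'b" where
  "alg_map A h X = the_elem (lin_ext A (\<lambda>w. foldr (\<lambda>g y. h g \<otimes>\<^bsub>A\<^esub> y) w \<one>\<^bsub>A\<^esub>) ` X)"

definition opposite :: "('k::field, 'b) module \<Rightarrow> ('k, 'b) module" where
  "opposite A = A\<lparr>mult := (\<lambda>x y. y \<otimes>\<^bsub>A\<^esub> x)\<rparr>"

definition comult :: "'k::field \<Rightarrow> 'k free set \<Rightarrow> ('k free set \<times> 'k free set \<Rightarrow>\<^sub>0 'k) set" where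
  "comult q =
     (let C = Oq q; CC = tensor C C; x = qgen q; t = pure_tensor C C in
      alg_map CC (case_gen
        (t (x Ga) (x Ga) \<oplus>\<^bsub>CC\<^esub> t (x Gb) (x Gc))
        (t (x Ga) (x Gb) \<oplus>\<^bsub>CC\<^esub> t (x Gb) (x Gd))
        (t (x Gc) (x Ga) \<oplus>\<^bsub>CC\<^esub> t (x Gd) (x Gc))
        (t (x Gc) (x Gb) \<oplus>\<^bsub>CC\<^esub> t (x Gd) (x Gd))))"

text \<open>The antipode reverses products.\<close>

definition antipode :: "'k::field \<Rightarrow> 'k free set \<Rightarrow> 'k free set" where
  "antipode q = alg_map (opposite (Oq q)) (case_gen
     (qgen q Gd)
     ((- inverse q) \<odot>\<^bsub>Oq q\<^esub> qgen q Gb)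
     ((- q) \<odot>\<^bsub>Oq q\<^esub> qgen q Gc)
     (qgen q Ga))"

definition tau :: "'k::field \<Rightarrow> 'k free set \<Rightarrow> 'k free set" where
  "tau q = alg_map (Oq q) (case_gen
     (qgen q Ga)
     ((- 1) \<odot>\<^bsub>Oq q\<^esub> qgen q Gb)
     ((- 1) \<odot>\<^bsub>Oq q\<^esub> qgen q Gc)
     (qgen q Gd))"

definition gam :: "'k::field \<Rightarrow> 'k free set \<Rightarrow> 'k" where
  "gam q = alg_map base_alg (case_gen (inverse q) 0 0 q)"

text \<open>A right coideal \<open>X\<close> of \<open>Oq q\<close> as a right comodule: the coaction of \<open>x\<close> is the element of
  \<open>X \<otimes> Oq q\<close> whose image in \<open>Oq q \<otimes> Oq q\<close> is \<open>\<Delta>(x)\<close>.\<close>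

definition coideal_comodule ::
  "'k::field \<Rightarrow> 'k free set set \<Rightarrow> ('k, 'k free set, 'k free set) comodule" where
  "coideal_comodule q X =
     (let C = Oq q; XM = C\<lparr>carrier := X\<rparr> in
      module.extend XM (comodule.fields (\<lambda>x.
        THE t. t \<in> carrier (tensor XM C) \<and>
               tensor_lift (tensor C C) (pure_tensor C C) t = comult q x)))"

definition index_set :: "rat \<Rightarrow> rat set" where
  "index_set l = {i. \<exists>m::nat. i = - l + of_nat m \<and> i \<le> l}"

text \<open>For \<open>l\<close> a half-integer and \<open>i \<in> index_set l\<close> the exponents \<open>l - i\<close> and \<open>l + i\<close> are natural
  numbers, so the floors below only change their type.\<close>

definition X_space :: "'k::field \<Rightarrow> rat \<Rightarrow> 'k free set set" where
  "X_space q l = LinearCombinations.module.span class_ring (Oq q)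
     {(qgen q Ga [^]\<^bsub>Oq q\<^esub> nat \<lfloor>l - i\<rfloor>) \<otimes>\<^bsub>Oq q\<^esub> (qgen q Gb [^]\<^bsub>Oq q\<^esub> nat \<lfloor>l + i\<rfloor>)
      | i. i \<in> index_set l}"

definition X_comodule :: "'k::field \<Rightarrow> rat \<Rightarrow> ('k, 'k free set, 'k free set) comodule" where
  "X_comodule q l = coideal_comodule q (X_space q l)"

end

theory Submission
  imports Defs
begin

text \<open>
  Put \<open>n = 2 l\<close>, \<open>e j = a^(n-j) b^j\<close> and \<open>\<Delta> (e j) = \<Sum>i. e i \<otimes> t i j\<close>. A linear map from \<open>X\<close> to its
  twisted dual is a matrix \<open>B\<close>; it is colinear iff
  \<open>(\<Sum>k. B i k S(\<tau>(t k j))) = (\<Sum>k. B k j t k i)\<close> for all \<open>i\<close>, \<open>j\<close>. By the \<open>q\<close>-binomial theorem,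
  \<open>M i j = binom(n,j) t i j\<close> are the coefficients of the \<open>n\<close>-th power of a single element; splitting off
  the first or the last factor of this power shows \<open>S(\<tau>(M i j)) = q^(i-j) M (n-j) (n-i)\<close>. Hence the
  antidiagonal matrix with entry \<open>\<beta> i = q^i / binom(n,i)\<close> at \<open>(i, n-i)\<close> is colinear. Conversely, applying
  \<open>\<gamma>\<close> to the equations shows that a colinear \<open>B\<close> is antidiagonal, and the equations involving
  \<open>t 0 i = e i \<noteq> 0\<close> show that it is a multiple of \<open>\<beta>\<close>. Since \<open>\<gamma>(t i j)\<close> is \<open>q^(2i-n)\<close> for \<open>i = j\<close>
  and \<open>0\<close> otherwise, the operator whose trace is taken sends \<open>\<beta> i\<close> to \<open>q^(2i-n) \<beta> (n-i) = \<beta> i\<close>, by the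
  symmetry of the binomials: it is the identity of a line.
\<close>

section \<open>Vector spaces and linear maps\<close>

text \<open>\<open>Oq q\<close>, tensor products and coactions are given as quotients and by
  definite descriptions, so at the outset no element is known to be nonzero. One representation, in
  which \<open>c\<close> acts as zero, supplies what is needed: functionals \<open>coord j\<close>
  on all of \<open>Oq q\<close> that are dual to the \<open>e j\<close>. They yield the basis of
  \<open>X\<close>, the fact that \<open>e j\<close> is nonzero, and the injectivity of the map from
  \<open>X \<otimes> Oq q\<close> to \<open>Oq q \<otimes> Oq q\<close> that pins down the coaction.

  The weights \<beta> are forced. For an antidiagonal form the colinearity equation, combined with
  the formula for S(\<tau>(t k j)), compares \<beta> i q^(-i) binom(n,i) with the same expression at
  n-j in place of i; so this expression is constant.

  The twist decides the sign. On b and c it cancels the minus signs of the antipode. With the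
  antipode alone the factor q^(i-j) would become (-q)^(i-j), the weights would acquire (-1)^i, and
  the reflection of i to n-i would produce (-1)^n.

  That q is not a root of unity enters twice: the binomials are nonzero, so that t can be defined by
  division, and the powers q^(2i-n) are pairwise distinct, so that \<gamma> separates the basis
  vectors.\<close>

abbreviation linmap ::
  "('k::field, 'v, 'm) module_scheme \<Rightarrow> ('k, 'w, 'n) module_scheme \<Rightarrow> ('v \<Rightarrow> 'w) set" where
  "linmap V W \<equiv> LinearCombinations.module_hom class_ring V W"

text \<open>Restates the module axioms over \<open>class_ring\<close> with the plain operations of
  the field, so that \<open>class_ring\<close> disappears from later calculations.\<close>

locale vspace =
  fixes V :: "('k::field, 'v, 'm) module_scheme" (structure)
  assumes is_module: "module class_ring V"

sublocale vspace \<subseteq> abelian_group V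
  by (rule module.axioms(2)[OF is_module])

context vspace
begin

lemma smult_closed [simp, intro]: "x \<in> carrier V \<Longrightarrow> s \<odot> x \<in> carrier V"
  using module.smult_closed[OF is_module, of s x] by simp

lemma smult_l_distr: "x \<in> carrier V \<Longrightarrow> (s + t) \<odot> x = s \<odot> x \<oplus> t \<odot> x"
  using module.smult_l_distr[OF is_module, of s t x] by simp

lemma smult_r_distr: "x \<in> carrier V \<Longrightarrow> y \<in> carrier V \<Longrightarrow> s \<odot> (x \<oplus> y) = s \<odot> x \<oplus> s \<odot> y"
  using module.smult_r_distr[OF is_module, of s x y] by simp

lemma smult_smult: "x \<in> carrier V \<Longrightarrow> s \<odot> (t \<odot> x) = (s * t) \<odot> x"
  using module.smult_assoc1[OF is_module, of s t x] by simp

lemma one_smult [simp]: "x \<in> carrier V \<Longrightarrow> 1 \<odot> x = x"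
  using module.smult_one[OF is_module, of x] by simp

lemma zero_smult [simp]: "x \<in> carrier V \<Longrightarrow> 0 \<odot> x = \<zero>"
  using module.smult_l_null[OF is_module, of x] by simp

lemma smult_zero [simp]: "s \<odot> \<zero> = \<zero>"
  using module.smult_r_null[OF is_module, of s] by simp

lemma minus_one_smult:
  assumes "x \<in> carrier V" shows "(- 1) \<odot> x = \<ominus> x"
proof -
  have "(- 1) \<odot> x \<oplus> x = ((- 1) + 1) \<odot> x"
    using assms by (subst smult_l_distr) simp_all
  then have "(- 1) \<odot> x \<oplus> x = \<zero>" using assms by simp
  then show ?thesis using assms by (metis minus_equality smult_closed)
qed

lemma smult_cancel:
  assumes "s \<noteq> 0" "s \<odot> x = s \<odot> y" "x \<in> carrier V" "y \<in> carrier V"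
  shows "x = y"
proof -
  have "inverse s \<odot> (s \<odot> x) = inverse s \<odot> (s \<odot> y)" using assms by simp
  then show ?thesis using assms(1,3,4) by (simp add: smult_smult)
qed

lemma smult_eq_cancel_right:
  assumes "s \<odot> x = t \<odot> x" "x \<in> carrier V" "x \<noteq> \<zero>"
  shows "s = t"
proof (rule ccontr)
  assume "s \<noteq> t"
  have "(s - t) \<odot> x = s \<odot> x \<oplus> (- t) \<odot> x"
    using smult_l_distr[OF assms(2), of s "- t"] by simp
  also have "\<dots> = (t + - t) \<odot> x"
    unfolding assms(1) using assms(2) by (rule smult_l_distr[symmetric])
  also have "\<dots> = \<zero>" using assms(2) by simp
  finally have "(s - t) \<odot> x = (s - t) \<odot> \<zero>" by simp
  with \<open>s \<noteq> t\<close> have "x = \<zero>" using assms(2)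
    by (metis right_minus_eq smult_cancel zero_closed)
  with assms show False by simp
qed

lemma finsum_smult:
  assumes "f \<in> A \<rightarrow> carrier V"
  shows "s \<odot> finsum V f A = finsum V (\<lambda>i. s \<odot> f i) A"
  using assms
proof (induction A rule: infinite_finite_induct)
  case (insert a A)
  then have "finsum V f A \<in> carrier V" by (intro finsum_closed) auto
  with insert have "s \<odot> finsum V f (insert a A) = s \<odot> f a \<oplus> s \<odot> finsum V f A"
    by (subst finsum_insert) (auto simp: smult_r_distr)
  also have "\<dots> = finsum V (\<lambda>i. s \<odot> f i) (insert a A)"
    using insert by (subst finsum_insert) auto
  finally show ?case .
qed auto

lemma submoduleI:
  assumes "N \<subseteq> carrier V" "\<zero> \<in> N" "\<And>x y. x \<in> N \<Longrightarrow> y \<in> N \<Longrightarrow> x \<oplus> y \<in> N"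
    "\<And>s x. x \<in> N \<Longrightarrow> s \<odot> x \<in> N"
  shows "submodule class_ring N V"
  using assms is_module by (auto simp: submodule_def)

lemma submodule_vspace:
  "submodule class_ring N V \<Longrightarrow> vspace (V\<lparr>carrier := N\<rparr>)"
  using module.submodule_is_module[OF is_module] by (simp add: vspace_def)

lemma submodule_additive_subgroup:
  assumes "submodule class_ring N V"
  shows "abelian_subgroup N V"
proof -
  have inv: "\<ominus> x \<in> N" if "x \<in> N" for x
    using submodule.smult_closed[OF assms, of "- 1" x] submodule.subset[OF assms] that
    by (auto simp: minus_one_smult)
  have "additive_subgroup N V"
    using submodule.subset[OF assms] submodule.m_closed[OF assms] submodule.zero_closed[OF assms]
    by (intro additive_subgroup.intro add.subgroupI)
      (auto simp flip: a_inv_def intro: inv)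
  then show ?thesis by (intro abelian_subgroupI3) (auto intro: abelian_group_axioms)
qed

end

lemma vspaceI:
  fixes V :: "('k::field, 'v, 'm) module_scheme" (structure)
  assumes "abelian_group V" "\<And>s x. x \<in> carrier V \<Longrightarrow> s \<odot> x \<in> carrier V"
    "\<And>s t x. x \<in> carrier V \<Longrightarrow> (s + t) \<odot> x = s \<odot> x \<oplus> t \<odot> x"
    "\<And>s x y. x \<in> carrier V \<Longrightarrow> y \<in> carrier V \<Longrightarrow> s \<odot> (x \<oplus> y) = s \<odot> x \<oplus> s \<odot> y"
    "\<And>s t x. x \<in> carrier V \<Longrightarrow> (s * t) \<odot> x = s \<odot> (t \<odot> x)"
    "\<And>x. x \<in> carrier V \<Longrightarrow> 1 \<odot> x = x"
  shows "vspace V"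
  unfolding vspace_def
proof (rule moduleI)
  show "cring (class_ring :: 'k ring)"
    using class_field[where 'a='k] by (simp add: fieldE(1))
qed (use assms in auto)

lemma linmapI:
  assumes "\<And>x. x \<in> carrier V \<Longrightarrow> f x \<in> carrier W"
    "\<And>x y. x \<in> carrier V \<Longrightarrow> y \<in> carrier V \<Longrightarrow> f (x \<oplus>\<^bsub>V\<^esub> y) = f x \<oplus>\<^bsub>W\<^esub> f y"
    "\<And>s x. x \<in> carrier V \<Longrightarrow> f (s \<odot>\<^bsub>V\<^esub> x) = s \<odot>\<^bsub>W\<^esub> f x"
  shows "f \<in> linmap V W"
  using assms by (auto simp: LinearCombinations.module_hom_def)

lemma linmap_closed: "f \<in> linmap V W \<Longrightarrow> x \<in> carrier V \<Longrightarrow> f x \<in> carrier W"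
  by (auto simp: LinearCombinations.module_hom_def)

lemma linmap_add:
  "f \<in> linmap V W \<Longrightarrow> x \<in> carrier V \<Longrightarrow> y \<in> carrier V \<Longrightarrow> f (x \<oplus>\<^bsub>V\<^esub> y) = f x \<oplus>\<^bsub>W\<^esub> f y"
  by (auto simp: LinearCombinations.module_hom_def)

lemma linmap_smult:
  "f \<in> linmap V W \<Longrightarrow> x \<in> carrier V \<Longrightarrow> f (s \<odot>\<^bsub>V\<^esub> x) = s \<odot>\<^bsub>W\<^esub> f x"
  by (auto simp: LinearCombinations.module_hom_def)

lemma linmap_cong:
  assumes "f \<in> linmap V W" "vspace V" "\<And>x. x \<in> carrier V \<Longrightarrow> f x = g x"
  shows "g \<in> linmap V W"
proof -
  interpret V: vspace V by fact
  show ?thesis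
    using assms linmap_closed[OF assms(1)] linmap_add[OF assms(1)] linmap_smult[OF assms(1)]
    by (intro linmapI) (force simp flip: assms(3))+
qed

lemma linmap_comp:
  "f \<in> linmap U V \<Longrightarrow> g \<in> linmap V W \<Longrightarrow> (\<lambda>x. g (f x)) \<in> linmap U W"
  by (auto simp: LinearCombinations.module_hom_def Pi_iff)

lemma linmap_zero:
  assumes "f \<in> linmap V W" "vspace V" "vspace W"
  shows "f \<zero>\<^bsub>V\<^esub> = \<zero>\<^bsub>W\<^esub>"
proof -
  interpret V: vspace V by fact
  interpret W: vspace W by fact
  have "f (0 \<odot>\<^bsub>V\<^esub> \<zero>\<^bsub>V\<^esub>) = 0 \<odot>\<^bsub>W\<^esub> f \<zero>\<^bsub>V\<^esub>" using assms by (intro linmap_smult) auto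
  then show ?thesis using linmap_closed[OF assms(1)] by simp
qed

lemma linmap_minus:
  assumes "f \<in> linmap V W" "vspace V" "vspace W" "x \<in> carrier V" "y \<in> carrier V"
  shows "f (x \<ominus>\<^bsub>V\<^esub> y) = f x \<ominus>\<^bsub>W\<^esub> f y"
proof -
  interpret V: vspace V by fact
  interpret W: vspace W by fact
  have "f (\<ominus>\<^bsub>V\<^esub> y) = f ((- 1) \<odot>\<^bsub>V\<^esub> y)" using assms(5) by (simp only: V.minus_one_smult)
  also have "\<dots> = \<ominus>\<^bsub>W\<^esub> f y"
    using linmap_closed[OF assms(1,5)]
    by (simp only: linmap_smult[OF assms(1,5)] W.minus_one_smult)
  finally show ?thesis
    using assms by (simp add: a_minus_def linmap_add[OF assms(1)])
qed

lemma linmap_finsum: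
  assumes "f \<in> linmap V W" "vspace V" "vspace W" "g \<in> A \<rightarrow> carrier V"
  shows "f (finsum V g A) = finsum W (\<lambda>i. f (g i)) A"
proof -
  interpret V: vspace V by fact
  interpret W: vspace W by fact
  note f = linmap_closed[OF assms(1)]
  show ?thesis using assms(4)
  proof (induction A rule: infinite_finite_induct)
    case (insert a A)
    have "f (finsum V g (insert a A)) = f (g a) \<oplus>\<^bsub>W\<^esub> f (finsum V g A)"
      using insert V.finsum_closed[of g A]
      by (subst V.finsum_insert) (auto simp: linmap_add[OF assms(1)])
    also have "\<dots> = finsum W (\<lambda>i. f (g i)) (insert a A)"
      using insert f by (subst W.finsum_insert) (auto simp: Pi_iff)
    finally show ?case .
  qed (auto simp: linmap_zero[OF assms(1-3)])
qed

text \<open>Turns agreement on generators into agreement on a span: a submodule that contains the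
  generators contains their span.\<close>

lemma linmap_eq_submodule:
  assumes "f \<in> linmap V W" "g \<in> linmap V W" "vspace V" "vspace W"
  shows "submodule class_ring {x \<in> carrier V. f x = g x} V"
proof -
  interpret V: vspace V by fact
  show ?thesis
    using linmap_zero[OF assms(1,3,4)] linmap_zero[OF assms(2,3,4)] linmap_add[OF assms(1)]
      linmap_add[OF assms(2)] linmap_smult[OF assms(1)] linmap_smult[OF assms(2)]
    by (intro V.submoduleI) auto
qed

text \<open>Serves to show that a linear operation preserves a span: it is enough that it sends the
  spanning elements into the span.\<close>

lemma linmap_vimage_submodule:
  assumes "f \<in> linmap V W" "vspace V" "vspace W" "submodule class_ring N W"
  shows "submodule class_ring {x \<in> carrier V. f x \<in> N} V"
proof -
  interpret V: vspace V by fact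
  show ?thesis
    using linmap_zero[OF assms(1-3)] linmap_add[OF assms(1)] linmap_smult[OF assms(1)]
      submodule.zero_closed[OF assms(4)] submodule.m_closed[OF assms(4)]
      submodule.smult_closed[OF assms(4)]
    by (intro V.submoduleI) auto
qed

lemma const_zero_linmap: "vspace W \<Longrightarrow> (\<lambda>_. \<zero>\<^bsub>W\<^esub>) \<in> linmap V W"
proof -
  assume "vspace W"
  then interpret W: vspace W .
  show ?thesis by (intro linmapI) auto
qed

lemma linmap_pointwise_add:
  assumes "f \<in> linmap V W" "g \<in> linmap V W" "vspace W"
  shows "(\<lambda>v. f v \<oplus>\<^bsub>W\<^esub> g v) \<in> linmap V W"
proof -
  interpret W: vspace W by fact
  show ?thesis
    using linmap_closed[OF assms(1)] linmap_closed[OF assms(2)]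
    by (intro linmapI)
      (auto simp: linmap_add[OF assms(1)] linmap_add[OF assms(2)] linmap_smult[OF assms(1)]
        linmap_smult[OF assms(2)] W.smult_r_distr W.a_ac)
qed

lemma linmap_pointwise_smult:
  assumes "f \<in> linmap V W" "vspace W"
  shows "(\<lambda>v. s \<odot>\<^bsub>W\<^esub> f v) \<in> linmap V W"
proof -
  interpret W: vspace W by fact
  show ?thesis
    using linmap_closed[OF assms(1)]
    by (intro linmapI)
      (auto simp: linmap_add[OF assms(1)] linmap_smult[OF assms(1)] W.smult_r_distr W.smult_smult mult.commute)
qed

lemma linmap_pointwise_sum:
  assumes "\<And>i. i \<in> I \<Longrightarrow> f i \<in> linmap V W" "vspace W"
  shows "(\<lambda>v. \<Oplus>\<^bsub>W\<^esub>i\<in>I. f i v) \<in> linmap V W"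
proof -
  interpret W: vspace W by fact
  have cl: "f i x \<in> carrier W" if "i \<in> I" "x \<in> carrier V" for i x
    using linmap_closed[OF assms(1)[OF that(1)] that(2)] .
  show ?thesis
  proof (rule linmapI)
    fix x y assume xy: "x \<in> carrier V" "y \<in> carrier V"
    have "(\<Oplus>\<^bsub>W\<^esub>i\<in>I. f i (x \<oplus>\<^bsub>V\<^esub> y)) = (\<Oplus>\<^bsub>W\<^esub>i\<in>I. f i x \<oplus>\<^bsub>W\<^esub> f i y)"
      using xy cl by (intro W.finsum_cong') (auto simp: linmap_add[OF assms(1)])
    also have "\<dots> = (\<Oplus>\<^bsub>W\<^esub>i\<in>I. f i x) \<oplus>\<^bsub>W\<^esub> (\<Oplus>\<^bsub>W\<^esub>i\<in>I. f i y)"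
      using xy cl by (intro W.finsum_addf) auto
    finally show "(\<Oplus>\<^bsub>W\<^esub>i\<in>I. f i (x \<oplus>\<^bsub>V\<^esub> y)) = \<dots>" .
  next
    fix s x assume x: "x \<in> carrier V"
    have "(\<Oplus>\<^bsub>W\<^esub>i\<in>I. f i (s \<odot>\<^bsub>V\<^esub> x)) = (\<Oplus>\<^bsub>W\<^esub>i\<in>I. s \<odot>\<^bsub>W\<^esub> f i x)"
      using x cl by (intro W.finsum_cong') (auto simp: linmap_smult[OF assms(1)])
    also have "\<dots> = s \<odot>\<^bsub>W\<^esub> (\<Oplus>\<^bsub>W\<^esub>i\<in>I. f i x)"
      using x cl by (intro W.finsum_smult[symmetric]) auto
    finally show "(\<Oplus>\<^bsub>W\<^esub>i\<in>I. f i (s \<odot>\<^bsub>V\<^esub> x)) = \<dots>" .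
  qed (use cl in \<open>auto intro!: W.finsum_closed\<close>)
qed

lemma linmap_span_eq:
  assumes "f \<in> linmap V W" "g \<in> linmap V W" "vspace V" "vspace W" "S \<subseteq> carrier V"
    "\<And>x. x \<in> S \<Longrightarrow> f x = g x" "x \<in> LinearCombinations.module.span class_ring V S"
  shows "f x = g x"
proof -
  interpret V: vspace V by fact
  have "LinearCombinations.module.span class_ring V S \<subseteq> {x \<in> carrier V. f x = g x}"
    using assms by (intro module.span_is_subset V.is_module linmap_eq_submodule) auto
  with assms show ?thesis by auto
qed

section \<open>The ground field as an algebra over itself\<close>

lemma base_alg_simps [simp]:
  "carrier base_alg = UNIV" "x \<otimes>\<^bsub>base_alg\<^esub> y = x * y" "\<one>\<^bsub>base_alg\<^esub> = 1" "\<zero>\<^bsub>base_alg\<^esub> = 0"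
  "x \<oplus>\<^bsub>base_alg\<^esub> y = x + y" "s \<odot>\<^bsub>base_alg\<^esub> x = s * x"
  by (auto simp: base_alg_def)

lemma vspace_base_alg: "vspace (base_alg :: ('k::field, 'k) module)"
proof (rule vspaceI)
  show "abelian_group (base_alg :: ('k::field, 'k) module)"
  proof (rule abelian_groupI)
    fix x :: 'k
    show "\<exists>y\<in>carrier base_alg. y \<oplus>\<^bsub>base_alg\<^esub> x = \<zero>\<^bsub>base_alg\<^esub>"
      by (rule bexI[of _ "- x"]) auto
  qed auto
qed (auto simp: algebra_simps)

lemma finsum_base_alg [simp]: "finsum (base_alg :: ('k::field, 'k) module) f A = sum f A"
proof -
  interpret vspace "base_alg :: ('k::field, 'k) module" by (rule vspace_base_alg)
  show ?thesis
    by (induction A rule: infinite_finite_induct) (auto simp: finsum_insert)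
qed

section \<open>Algebras\<close>

locale kalg = vspace A + ring A for A :: "('k::field, 'b, 'm) module_scheme" (structure) +
  assumes smult_mult_l: "\<lbrakk>x \<in> carrier A; y \<in> carrier A\<rbrakk> \<Longrightarrow> (s \<odot> x) \<otimes> y = s \<odot> (x \<otimes> y)"
    and smult_mult_r: "\<lbrakk>x \<in> carrier A; y \<in> carrier A\<rbrakk> \<Longrightarrow> x \<otimes> (s \<odot> y) = s \<odot> (x \<otimes> y)"

lemma kalgI:
  fixes A :: "('k::field, 'b, 'm) module_scheme" (structure)
  assumes "vspace A" "\<And>x y. x \<in> carrier A \<Longrightarrow> y \<in> carrier A \<Longrightarrow> x \<otimes> y \<in> carrier A"
    "\<one> \<in> carrier A"
    "\<And>x y z. x \<in> carrier A \<Longrightarrow> y \<in> carrier A \<Longrightarrow> z \<in> carrier A \<Longrightarrow> (x \<otimes> y) \<otimes> z = x \<otimes> (y \<otimes> z)"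
    "\<And>x. x \<in> carrier A \<Longrightarrow> \<one> \<otimes> x = x" "\<And>x. x \<in> carrier A \<Longrightarrow> x \<otimes> \<one> = x"
    "\<And>x y z. x \<in> carrier A \<Longrightarrow> y \<in> carrier A \<Longrightarrow> z \<in> carrier A \<Longrightarrow> (x \<oplus> y) \<otimes> z = x \<otimes> z \<oplus> y \<otimes> z"
    "\<And>x y z. x \<in> carrier A \<Longrightarrow> y \<in> carrier A \<Longrightarrow> z \<in> carrier A \<Longrightarrow> z \<otimes> (x \<oplus> y) = z \<otimes> x \<oplus> z \<otimes> y"
    "\<And>s x y. x \<in> carrier A \<Longrightarrow> y \<in> carrier A \<Longrightarrow> (s \<odot> x) \<otimes> y = s \<odot> (x \<otimes> y)"
    "\<And>s x y. x \<in> carrier A \<Longrightarrow> y \<in> carrier A \<Longrightarrow> x \<otimes> (s \<odot> y) = s \<odot> (x \<otimes> y)"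
  shows "kalg A"
proof -
  interpret vspace A by fact
  have "ring A"
    using assms by (intro ringI monoidI) (auto intro: abelian_group_axioms)
  then show ?thesis
    using assms by (intro kalg.intro kalg_axioms.intro) auto
qed

lemma kalg_base_alg: "kalg (base_alg :: ('k::field, 'k) module)"
  by (rule kalgI) (auto simp: algebra_simps vspace_base_alg)

definition alg_hom ::
  "('k::field, 'a, 'm) module_scheme \<Rightarrow> ('k, 'b, 'n) module_scheme \<Rightarrow> ('a \<Rightarrow> 'b) set" where
  "alg_hom A B = {f \<in> linmap A B. f \<one>\<^bsub>A\<^esub> = \<one>\<^bsub>B\<^esub> \<and>
     (\<forall>x\<in>carrier A. \<forall>y\<in>carrier A. f (x \<otimes>\<^bsub>A\<^esub> y) = f x \<otimes>\<^bsub>B\<^esub> f y)}"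

text \<open>Lets a map kill a generated ideal by a check on the generators alone, since the kernel
  is a two-sided ideal.\<close>

lemma alg_hom_kernel_ideal:
  assumes "f \<in> alg_hom A B" "kalg A" "kalg B"
  shows "ideal {x \<in> carrier A. f x = \<zero>\<^bsub>B\<^esub>} A"
proof -
  interpret A: kalg A by fact
  interpret B: kalg B by fact
  have "ring_hom_ring A B f"
    using assms
    by (intro ring_hom_ringI A.ring_axioms B.ring_axioms)
      (auto simp: alg_hom_def linmap_add dest: linmap_closed)
  from ring_hom_ring.kernel_is_ideal[OF this] show ?thesis
    by (simp add: a_kernel_def')
qed

section \<open>Quotients\<close>

lemma quot_alg_simps [simp]:
  "\<zero>\<^bsub>quot_alg A I\<^esub> = I" "X \<oplus>\<^bsub>quot_alg A I\<^esub> Y = X <+>\<^bsub>A\<^esub> Y" "\<one>\<^bsub>quot_alg A I\<^esub> = I +>\<^bsub>A\<^esub> \<one>\<^bsub>A\<^esub>"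
  by (simp_all add: quot_alg_def FactRing_def)

text \<open>Only the additive and scalar structure of \<open>quot_alg\<close> is treated here,
  because tensor products of mere vector spaces are quotients of this kind. The multiplication
  enters with \<open>alg_quot\<close>.\<close>

locale vquot = vspace A for A :: "('k::field, 'b, 'm) module_scheme" (structure) +
  fixes I
  assumes sub: "submodule class_ring I A"

sublocale vquot \<subseteq> sg: abelian_subgroup I A
  by (rule submodule_additive_subgroup[OF sub])

context vquot
begin

lemma carrier_quot: "carrier (quot_alg A I) = (\<lambda>x. I +> x) ` carrier A"
  by (auto simp: quot_alg_def FactRing_def A_RCOSETS_def')

lemma coset_in_quot [simp, intro]: "x \<in> carrier A \<Longrightarrow> I +> x \<in> carrier (quot_alg A I)"
  by (auto simp: carrier_quot)

lemma quotE:
  assumes "X \<in> carrier (quot_alg A I)"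
  obtains x where "x \<in> carrier A" "X = I +> x"
  using assms by (auto simp: carrier_quot)

lemma quot_add:
  "x \<in> carrier A \<Longrightarrow> y \<in> carrier A \<Longrightarrow> (I +> x) <+> (I +> y) = I +> (x \<oplus> y)"
  by (rule sg.a_rcos_sum)

lemma coset_rep: "y \<in> I +> x \<Longrightarrow> x \<in> carrier A \<Longrightarrow> \<exists>n\<in>I. y = n \<oplus> x"
  by (auto simp: a_r_coset_def')

lemma coset_eq: "y \<in> I +> x \<Longrightarrow> x \<in> carrier A \<Longrightarrow> I +> x = I +> y"
  by (rule a_repr_independence[OF _ _ sg.a_subgroup])

lemma coset_eqI:
  assumes "x \<in> carrier A" "y \<in> carrier A" "x \<ominus> y \<in> I"
  shows "I +> x = I +> y"
proof -
  have "x \<in> I +> y" using assms by (simp add: sg.a_rcos_module a_minus_def)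
  then show ?thesis using assms(2) by (rule coset_eq[symmetric])
qed

text \<open>The scalar action is defined as a union over all representatives. Since \<open>I\<close>
  is closed under scalars, each representative contributes the same coset, and there is at least one
  representative.\<close>

lemma quot_smult:
  assumes "x \<in> carrier A"
  shows "s \<odot>\<^bsub>quot_alg A I\<^esub> (I +> x) = I +> (s \<odot> x)"
proof -
  have "I +> (s \<odot> y) = I +> (s \<odot> x)" if y: "y \<in> I +> x" for y
  proof -
    obtain n where n: "n \<in> I" "y = n \<oplus> x" using coset_rep[OF y assms] by auto
    have "s \<odot> n \<in> I" using submodule.smult_closed[OF sub] n by simp
    then have "s \<odot> y \<in> I +> (s \<odot> x)"
      using n assms by (auto simp: a_r_coset_def' smult_r_distr)
    then show ?thesis using assms by (intro coset_eq[symmetric]) auto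
  qed
  moreover have "x \<in> I +> x" using assms by (rule sg.a_rcos_self)
  then have "I +> x \<noteq> {}" by auto
  ultimately have "(\<Union>y\<in>I +> x. I +> (s \<odot> y)) = I +> (s \<odot> x)"
    by (rule SUP_eq_const[rotated])
  then show ?thesis by (simp add: quot_alg_def)
qed

lemma coset_zero: "I +> \<zero> = I"
  by (rule sg.a_rcos_const) (rule submodule.zero_closed[OF sub])

lemma abelian_group_quot: "abelian_group (quot_alg A I)"
proof (rule abelian_groupI)
  fix X Y Z
  assume "X \<in> carrier (quot_alg A I)" "Y \<in> carrier (quot_alg A I)" "Z \<in> carrier (quot_alg A I)"
  then obtain x y z where *: "x \<in> carrier A" "X = I +> x" "y \<in> carrier A" "Y = I +> y"
    "z \<in> carrier A" "Z = I +> z" by (metis quotE)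
  show "X \<oplus>\<^bsub>quot_alg A I\<^esub> Y \<in> carrier (quot_alg A I)"
    unfolding *(2,4) quot_alg_simps using * by (subst quot_add) auto
  show "X \<oplus>\<^bsub>quot_alg A I\<^esub> Y \<oplus>\<^bsub>quot_alg A I\<^esub> Z = X \<oplus>\<^bsub>quot_alg A I\<^esub> (Y \<oplus>\<^bsub>quot_alg A I\<^esub> Z)"
    unfolding *(2,4,6) quot_alg_simps using *(1,3,5) by (simp only: quot_add add.m_closed add.m_assoc)
  show "X \<oplus>\<^bsub>quot_alg A I\<^esub> Y = Y \<oplus>\<^bsub>quot_alg A I\<^esub> X"
    unfolding *(2,4) quot_alg_simps using *(1,3) by (simp only: quot_add a_comm)
next
  show "\<zero>\<^bsub>quot_alg A I\<^esub> \<in> carrier (quot_alg A I)"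
    using coset_in_quot[OF zero_closed] by (simp add: coset_zero)
next
  fix X assume "X \<in> carrier (quot_alg A I)"
  then obtain x where x: "x \<in> carrier A" "X = I +> x" by (rule quotE)
  then have "(I +> \<zero>) <+> (I +> x) = I +> x" by (subst quot_add) auto
  then show "\<zero>\<^bsub>quot_alg A I\<^esub> \<oplus>\<^bsub>quot_alg A I\<^esub> X = X"
    using x by (simp add: coset_zero)
  have "(I +> \<ominus> x) <+> (I +> x) = I +> \<zero>" using x by (subst quot_add) (auto simp: l_neg)
  then show "\<exists>Y\<in>carrier (quot_alg A I). Y \<oplus>\<^bsub>quot_alg A I\<^esub> X = \<zero>\<^bsub>quot_alg A I\<^esub>"
    using x by (intro bexI[of _ "I +> \<ominus> x"]) (simp_all add: coset_zero)
qed

lemma vspace_quot: "vspace (quot_alg A I)"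
  by (rule vspaceI[OF abelian_group_quot]; elim quotE)
    (simp_all add: quot_add quot_smult smult_l_distr smult_r_distr smult_smult)

lemma coset_linmap: "(\<lambda>x. I +> x) \<in> linmap A (quot_alg A I)"
  by (rule linmapI) (simp_all add: quot_add quot_smult)

text \<open>Adding an element of \<open>I\<close> does not change the value of \<open>f\<close>, so
  the image of a coset is a singleton and \<open>the_elem\<close> returns its element.\<close>

lemma quot_lift:
  assumes "f \<in> linmap A M" "vspace M" "\<And>x. x \<in> I \<Longrightarrow> f x = \<zero>\<^bsub>M\<^esub>" "x \<in> carrier A"
  shows "the_elem (f ` (I +> x)) = f x"
proof -
  interpret M: vspace M by fact
  have "f y = f x" if y: "y \<in> I +> x" for y
  proof -
    obtain n where n: "n \<in> I" "y = n \<oplus> x" using coset_rep[OF y assms(4)] by auto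
    then have "f y = f n \<oplus>\<^bsub>M\<^esub> f x"
      using assms(4) sg.a_Hcarr[OF n(1)] by (simp add: linmap_add[OF assms(1)])
    then show ?thesis using assms(3)[OF n(1)] linmap_closed[OF assms(1,4)] by simp
  qed
  moreover have "x \<in> I +> x" using assms by (intro sg.a_rcos_self)
  ultimately have "f ` (I +> x) = {f x}" by blast
  then show ?thesis by simp
qed

lemma quot_lift_linmap:
  assumes "f \<in> linmap A M" "vspace M" "\<And>x. x \<in> I \<Longrightarrow> f x = \<zero>\<^bsub>M\<^esub>"
  shows "(\<lambda>X. the_elem (f ` X)) \<in> linmap (quot_alg A I) M"
  by (rule linmapI; elim quotE)
    (simp_all add: quot_add quot_smult quot_lift[OF assms] linmap_add[OF assms(1)]
      linmap_smult[OF assms(1)] linmap_closed[OF assms(1)])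

end

locale alg_quot = kalg A + ideal I A for A :: "('k::field, 'b, 'm) module_scheme" (structure) and I

text \<open>An ideal is a subspace because scaling by \<open>s\<close> is left multiplication by
  \<open>s \<odot> \<one>\<close>.\<close>

sublocale alg_quot \<subseteq> vquot A I
proof (intro vquot.intro vquot_axioms.intro)
  show "vspace A" by (rule vspace_axioms)
next
  show "submodule class_ring I A"
  proof (rule submoduleI)
    fix s x assume x: "x \<in> I"
    then have "(s \<odot> \<one>) \<otimes> x = s \<odot> x" using a_subset by (subst smult_mult_l) auto
    then show "s \<odot> x \<in> I" using I_l_closed[OF x, of "s \<odot> \<one>"] by simp
  qed (use a_subset in auto)
qed

context alg_quot
begin

lemma quot_mult:
  "x \<in> carrier A \<Longrightarrow> y \<in> carrier A \<Longrightarrow> (I +> x) \<otimes>\<^bsub>quot_alg A I\<^esub> (I +> y) = I +> (x \<otimes> y)"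
  by (simp add: quot_alg_def FactRing_def rcoset_mult_add)

lemma kalg_quot: "kalg (quot_alg A I)"
  by (rule kalgI[OF vspace_quot]; (elim quotE)?)
    (simp_all add: quot_add quot_smult quot_mult m_assoc l_distr r_distr
      smult_mult_l smult_mult_r)

lemma quot_lift_hom:
  assumes "f \<in> alg_hom A B" "vspace B" "\<And>x. x \<in> I \<Longrightarrow> f x = \<zero>\<^bsub>B\<^esub>"
  shows "(\<lambda>X. the_elem (f ` X)) \<in> alg_hom (quot_alg A I) B"
proof -
  have f: "f \<in> linmap A B" using assms by (simp add: alg_hom_def)
  show ?thesis
    using assms quot_lift_linmap[OF f assms(2,3)]
    by (auto simp: alg_hom_def quot_lift[OF f assms(2,3)] quot_mult elim!: quotE)
qed

end

section \<open>Monoid algebras\<close>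

lemma monoid_alg_simps [simp]:
  "carrier (monoid_alg G) = {p. Poly_Mapping.keys p \<subseteq> carrier G}"
  "\<zero>\<^bsub>monoid_alg G\<^esub> = 0" "\<one>\<^bsub>monoid_alg G\<^esub> = Poly_Mapping.single \<one>\<^bsub>G\<^esub> 1"
  "p \<oplus>\<^bsub>monoid_alg G\<^esub> r = p + r"
  by (simp_all add: monoid_alg_def)

lemma lookup_monoid_alg_smult [simp]:
  "Poly_Mapping.lookup (s \<odot>\<^bsub>monoid_alg G\<^esub> p) x = s * Poly_Mapping.lookup p x"
  by (simp add: monoid_alg_def Poly_Mapping.map.rep_eq when_def)

lemma monoid_alg_smult_single:
  "s \<odot>\<^bsub>monoid_alg G\<^esub> Poly_Mapping.single x t = Poly_Mapping.single x (s * t)"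
  by (rule poly_mapping_eqI) (simp add: lookup_single when_def)

lemma keys_monoid_alg_smult:
  "Poly_Mapping.keys (s \<odot>\<^bsub>monoid_alg G\<^esub> p) \<subseteq> Poly_Mapping.keys p"
  by (auto simp: in_keys_iff)

lemma vspace_monoid_alg: "vspace (monoid_alg G :: ('k::field, 'g \<Rightarrow>\<^sub>0 'k) module)"
proof (rule vspaceI)
  show "abelian_group (monoid_alg G :: ('k::field, 'g \<Rightarrow>\<^sub>0 'k) module)"
  proof (rule abelian_groupI)
    fix p :: "'g \<Rightarrow>\<^sub>0 'k" assume "p \<in> carrier (monoid_alg G)"
    then show "\<exists>r\<in>carrier (monoid_alg G). r \<oplus>\<^bsub>monoid_alg G\<^esub> p = \<zero>\<^bsub>monoid_alg G\<^esub>"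
      by (intro bexI[of _ "- p"]) auto
  next
    fix p r :: "'g \<Rightarrow>\<^sub>0 'k" assume "p \<in> carrier (monoid_alg G)" "r \<in> carrier (monoid_alg G)"
    then show "p \<oplus>\<^bsub>monoid_alg G\<^esub> r \<in> carrier (monoid_alg G)"
      using Poly_Mapping.keys_add[of p r] by auto
  qed (auto simp: ac_simps)
next
  fix p :: "'g \<Rightarrow>\<^sub>0 'k" and s assume "p \<in> carrier (monoid_alg G)"
  then show "s \<odot>\<^bsub>monoid_alg G\<^esub> p \<in> carrier (monoid_alg G)"
    using keys_monoid_alg_smult[where s = s and G = G and p = p] by auto
qed (auto intro!: poly_mapping_eqI simp: lookup_add algebra_simps)

lemma monoid_alg_minus:
  assumes "p \<in> carrier (monoid_alg G)" "r \<in> carrier (monoid_alg G)"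
  shows "p \<ominus>\<^bsub>monoid_alg G\<^esub> (r :: 'g \<Rightarrow>\<^sub>0 'k::field) = p - r"
proof -
  interpret F: vspace "monoid_alg G :: ('k, 'g \<Rightarrow>\<^sub>0 'k) module" by (rule vspace_monoid_alg)
  have "\<ominus>\<^bsub>monoid_alg G\<^esub> r = - r"
    using assms by (intro F.minus_equality) auto
  then show ?thesis by (simp add: a_minus_def)
qed

text \<open>Every element is the finite sum of its scaled basis elements. This is the induction
  principle behind all later reductions to basis elements.\<close>

lemma monoid_alg_subset_submodule:
  assumes "submodule class_ring N (monoid_alg G :: ('k::field, 'g \<Rightarrow>\<^sub>0 'k) module)"
    "\<And>x. x \<in> carrier G \<Longrightarrow> Poly_Mapping.single x 1 \<in> N" "p \<in> carrier (monoid_alg G)"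
  shows "p \<in> N"
proof -
  have single: "Poly_Mapping.single x s \<in> N" if "x \<in> carrier G" for x s
  proof -
    have "s \<odot>\<^bsub>monoid_alg G\<^esub> Poly_Mapping.single x 1 \<in> N"
      using submodule.smult_closed[OF assms(1), of s] assms(2)[OF that] by simp
    then show ?thesis by (simp add: monoid_alg_smult_single)
  qed
  have sums: "(\<Sum>x\<in>K. Poly_Mapping.single x (c x)) \<in> N" if "finite K" "K \<subseteq> carrier G" for K c
    using that
  proof (induction K rule: finite_induct)
    case empty
    then show ?case using submodule.zero_closed[OF assms(1)] by simp
  next
    case (insert x K)
    then show ?case using submodule.m_closed[OF assms(1) single[of x "c x"]] by simp
  qed
  have "p = (\<Sum>x\<in>Poly_Mapping.keys p. Poly_Mapping.single x (Poly_Mapping.lookup p x))"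
    by (rule poly_mapping_eqI) (simp add: lookup_sum lookup_single when_def in_keys_iff)
  then show ?thesis using sums[of "Poly_Mapping.keys p" "Poly_Mapping.lookup p"] assms(3) by simp
qed

lemma monoid_alg_linmap_eq:
  assumes "f \<in> linmap (monoid_alg G) M" "g \<in> linmap (monoid_alg G) M" "vspace M"
    "\<And>x. x \<in> carrier G \<Longrightarrow> f (Poly_Mapping.single x 1) = g (Poly_Mapping.single x 1)"
    "p \<in> carrier (monoid_alg G)"
  shows "f p = g p"
proof -
  have "p \<in> {x \<in> carrier (monoid_alg G). f x = g x}"
    by (rule monoid_alg_subset_submodule[OF linmap_eq_submodule[OF assms(1,2) vspace_monoid_alg assms(3)] _ assms(5)])
      (simp add: assms(4))
  then show ?thesis by simp
qed

text \<open>The added summands vanish. The freedom in choosing \<open>K\<close> lets two elements be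
  summed over a common index set, which makes additivity a termwise statement.\<close>

lemma lin_ext_superset:
  assumes "vspace M" "finite K" "Poly_Mapping.keys p \<subseteq> K" "\<phi> \<in> K \<rightarrow> carrier M"
  shows "lin_ext M \<phi> p = (\<Oplus>\<^bsub>M\<^esub>x\<in>K. Poly_Mapping.lookup p x \<odot>\<^bsub>M\<^esub> \<phi> x)"
proof -
  interpret M: vspace M by fact
  show ?thesis unfolding lin_ext_def
    using assms(2-4) by (intro M.add.finprod_mono_neutral_cong_left) (auto simp: in_keys_iff Pi_iff)
qed

lemma lin_ext_linmap:
  fixes G :: "('g, 'm) monoid_scheme" and M :: "('k::field, 'b, 'n) module_scheme"
  assumes "vspace M" "\<phi> \<in> carrier G \<rightarrow> carrier M"
  shows "lin_ext M \<phi> \<in> linmap (monoid_alg G) M"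
proof -
  interpret M: vspace M by fact
  show ?thesis
  proof (rule linmapI)
    fix p :: "'g \<Rightarrow>\<^sub>0 'k" assume "p \<in> carrier (monoid_alg G)"
    then show "lin_ext M \<phi> p \<in> carrier M"
      using assms(2) by (auto simp: lin_ext_def intro!: M.finsum_closed)
  next
    fix p r :: "'g \<Rightarrow>\<^sub>0 'k" assume pr: "p \<in> carrier (monoid_alg G)" "r \<in> carrier (monoid_alg G)"
    define K where "K = Poly_Mapping.keys p \<union> Poly_Mapping.keys r"
    have K: "finite K" "Poly_Mapping.keys p \<subseteq> K" "Poly_Mapping.keys r \<subseteq> K"
      "Poly_Mapping.keys (p + r) \<subseteq> K" "\<phi> \<in> K \<rightarrow> carrier M"
      using pr assms(2) Poly_Mapping.keys_add[of p r] by (auto simp: K_def)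
    then have "(\<Oplus>\<^bsub>M\<^esub>x\<in>K. Poly_Mapping.lookup (p + r) x \<odot>\<^bsub>M\<^esub> \<phi> x) =
      (\<Oplus>\<^bsub>M\<^esub>x\<in>K. Poly_Mapping.lookup p x \<odot>\<^bsub>M\<^esub> \<phi> x \<oplus>\<^bsub>M\<^esub> Poly_Mapping.lookup r x \<odot>\<^bsub>M\<^esub> \<phi> x)"
      by (intro M.finsum_cong') (auto simp: lookup_add M.smult_l_distr Pi_iff)
    also have "\<dots> = (\<Oplus>\<^bsub>M\<^esub>x\<in>K. Poly_Mapping.lookup p x \<odot>\<^bsub>M\<^esub> \<phi> x) \<oplus>\<^bsub>M\<^esub>
      (\<Oplus>\<^bsub>M\<^esub>x\<in>K. Poly_Mapping.lookup r x \<odot>\<^bsub>M\<^esub> \<phi> x)"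
      using K(5) by (intro M.finsum_addf) auto
    finally show "lin_ext M \<phi> (p \<oplus>\<^bsub>monoid_alg G\<^esub> r) = lin_ext M \<phi> p \<oplus>\<^bsub>M\<^esub> lin_ext M \<phi> r"
      unfolding monoid_alg_simps lin_ext_superset[OF assms(1) K(1,2,5)]
        lin_ext_superset[OF assms(1) K(1,3,5)] lin_ext_superset[OF assms(1) K(1,4,5)]
      .
  next
    fix p :: "'g \<Rightarrow>\<^sub>0 'k" and s assume p: "p \<in> carrier (monoid_alg G)"
    define K where "K = Poly_Mapping.keys p"
    have K: "finite K" "Poly_Mapping.keys p \<subseteq> K"
      "Poly_Mapping.keys (s \<odot>\<^bsub>monoid_alg G\<^esub> p) \<subseteq> K" "\<phi> \<in> K \<rightarrow> carrier M"
      using p assms(2) keys_monoid_alg_smult[where s = s and G = G and p = p] by (auto simp: K_def)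
    then show "lin_ext M \<phi> (s \<odot>\<^bsub>monoid_alg G\<^esub> p) = s \<odot>\<^bsub>M\<^esub> lin_ext M \<phi> p"
      unfolding lin_ext_superset[OF assms(1) K(1,2,4)] lin_ext_superset[OF assms(1) K(1,3,4)]
      by (subst M.finsum_smult)
        (auto simp: M.smult_smult Pi_iff intro!: M.finsum_cong')
  qed
qed

lemma lin_ext_single:
  assumes "vspace M" "\<phi> x \<in> carrier M"
  shows "lin_ext M \<phi> (Poly_Mapping.single x s) = s \<odot>\<^bsub>M\<^esub> \<phi> x"
proof -
  interpret M: vspace M by fact
  show ?thesis
    using assms(2) by (subst lin_ext_superset[OF assms(1), of "{x}"]) auto
qed

lemma monoid_alg_mult_superset:
  assumes "finite K" "finite L" "Poly_Mapping.keys p \<subseteq> K" "Poly_Mapping.keys r \<subseteq> L"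
  shows "p \<otimes>\<^bsub>monoid_alg G\<^esub> r = (\<Sum>x\<in>K. \<Sum>y\<in>L. Poly_Mapping.single (x \<otimes>\<^bsub>G\<^esub> y)
           (Poly_Mapping.lookup p x * Poly_Mapping.lookup r y))"
proof -
  have "p \<otimes>\<^bsub>monoid_alg G\<^esub> r = (\<Sum>x\<in>Poly_Mapping.keys p. \<Sum>y\<in>Poly_Mapping.keys r.
     Poly_Mapping.single (x \<otimes>\<^bsub>G\<^esub> y) (Poly_Mapping.lookup p x * Poly_Mapping.lookup r y))"
    by (simp add: monoid_alg_def)
  also have "\<dots> = (\<Sum>x\<in>Poly_Mapping.keys p. \<Sum>y\<in>L. Poly_Mapping.single (x \<otimes>\<^bsub>G\<^esub> y)
           (Poly_Mapping.lookup p x * Poly_Mapping.lookup r y))"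
    using assms by (intro sum.cong refl sum.mono_neutral_left) (auto simp: in_keys_iff)
  also have "\<dots> = (\<Sum>x\<in>K. \<Sum>y\<in>L. Poly_Mapping.single (x \<otimes>\<^bsub>G\<^esub> y)
           (Poly_Mapping.lookup p x * Poly_Mapping.lookup r y))"
    using assms by (intro sum.mono_neutral_left) (auto simp: in_keys_iff)
  finally show ?thesis .
qed

lemma monoid_alg_mult_single [simp]:
  "Poly_Mapping.single x s \<otimes>\<^bsub>monoid_alg G\<^esub> Poly_Mapping.single y t =
   Poly_Mapping.single (x \<otimes>\<^bsub>G\<^esub> y) (s * t)"
  by (subst monoid_alg_mult_superset[of "{x}" "{y}"]) auto

lemma monoid_alg_smult_sum:
  "s \<odot>\<^bsub>monoid_alg G\<^esub> sum f A = (\<Sum>x\<in>A. s \<odot>\<^bsub>monoid_alg G\<^esub> f x)"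
  by (rule poly_mapping_eqI) (simp add: lookup_sum sum_distrib_left)

context monoid
begin

lemma monoid_alg_mult_closed:
  assumes "p \<in> carrier (monoid_alg G)" "r \<in> carrier (monoid_alg G)"
  shows "p \<otimes>\<^bsub>monoid_alg G\<^esub> r \<in> carrier (monoid_alg G :: ('k::field, 'a \<Rightarrow>\<^sub>0 'k) module)"
proof -
  have "Poly_Mapping.keys (p \<otimes>\<^bsub>monoid_alg G\<^esub> r) \<subseteq>
    (\<Union>x\<in>Poly_Mapping.keys p. \<Union>y\<in>Poly_Mapping.keys r. {x \<otimes> y})"
    unfolding monoid_alg_def
    by (force dest!: subsetD[OF Poly_Mapping.keys_sum] split: if_splits)
  also have "\<dots> \<subseteq> carrier G" using assms by auto
  finally show ?thesis by simp
qed

lemma monoid_alg_mult_linmap_l: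
  assumes r: "r \<in> carrier (monoid_alg G)"
  shows "(\<lambda>p. p \<otimes>\<^bsub>monoid_alg G\<^esub> r) \<in> linmap (monoid_alg G) (monoid_alg G :: ('k::field, 'a \<Rightarrow>\<^sub>0 'k) module)"
proof (rule linmapI)
  fix p p' :: "'a \<Rightarrow>\<^sub>0 'k"
  define K where "K = Poly_Mapping.keys p \<union> Poly_Mapping.keys p'"
  have K: "finite K" "Poly_Mapping.keys p \<subseteq> K" "Poly_Mapping.keys p' \<subseteq> K"
      "Poly_Mapping.keys (p + p') \<subseteq> K"
    using Poly_Mapping.keys_add[of p p'] by (auto simp: K_def)
  show "(p \<oplus>\<^bsub>monoid_alg G\<^esub> p') \<otimes>\<^bsub>monoid_alg G\<^esub> r = p \<otimes>\<^bsub>monoid_alg G\<^esub> r \<oplus>\<^bsub>monoid_alg G\<^esub> p' \<otimes>\<^bsub>monoid_alg G\<^esub> r"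
    unfolding monoid_alg_simps monoid_alg_mult_superset[OF K(1) finite_keys K(2) subset_refl]
      monoid_alg_mult_superset[OF K(1) finite_keys K(3) subset_refl]
      monoid_alg_mult_superset[OF K(1) finite_keys K(4) subset_refl]
    by (simp add: lookup_add distrib_right single_add sum.distrib)
next
  fix p :: "'a \<Rightarrow>\<^sub>0 'k" and s
  show "(s \<odot>\<^bsub>monoid_alg G\<^esub> p) \<otimes>\<^bsub>monoid_alg G\<^esub> r = s \<odot>\<^bsub>monoid_alg G\<^esub> (p \<otimes>\<^bsub>monoid_alg G\<^esub> r)"
    unfolding monoid_alg_mult_superset[OF finite_keys[of p] finite_keys[of r] keys_monoid_alg_smult subset_refl]
    unfolding      monoid_alg_mult_superset[OF finite_keys finite_keys subset_refl subset_refl]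
    by (simp add: monoid_alg_smult_sum monoid_alg_smult_single mult.assoc)
qed (use monoid_alg_mult_closed r in auto)

lemma monoid_alg_mult_linmap_r:
  assumes r: "r \<in> carrier (monoid_alg G)"
  shows "(\<lambda>p. r \<otimes>\<^bsub>monoid_alg G\<^esub> p) \<in> linmap (monoid_alg G) (monoid_alg G :: ('k::field, 'a \<Rightarrow>\<^sub>0 'k) module)"
proof (rule linmapI)
  fix p p' :: "'a \<Rightarrow>\<^sub>0 'k"
  define K where "K = Poly_Mapping.keys p \<union> Poly_Mapping.keys p'"
  have K: "finite K" "Poly_Mapping.keys p \<subseteq> K" "Poly_Mapping.keys p' \<subseteq> K"
      "Poly_Mapping.keys (p + p') \<subseteq> K"
    using Poly_Mapping.keys_add[of p p'] by (auto simp: K_def)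
  show "r \<otimes>\<^bsub>monoid_alg G\<^esub> (p \<oplus>\<^bsub>monoid_alg G\<^esub> p') = r \<otimes>\<^bsub>monoid_alg G\<^esub> p \<oplus>\<^bsub>monoid_alg G\<^esub> r \<otimes>\<^bsub>monoid_alg G\<^esub> p'"
    unfolding monoid_alg_simps monoid_alg_mult_superset[OF finite_keys K(1) subset_refl K(2)]
      monoid_alg_mult_superset[OF finite_keys K(1) subset_refl K(3)]
      monoid_alg_mult_superset[OF finite_keys K(1) subset_refl K(4)]
    by (simp add: lookup_add distrib_left single_add sum.distrib)
next
  fix p :: "'a \<Rightarrow>\<^sub>0 'k" and s
  show "r \<otimes>\<^bsub>monoid_alg G\<^esub> (s \<odot>\<^bsub>monoid_alg G\<^esub> p) = s \<odot>\<^bsub>monoid_alg G\<^esub> (r \<otimes>\<^bsub>monoid_alg G\<^esub> p)"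
    unfolding monoid_alg_mult_superset[OF finite_keys[of r] finite_keys[of p] subset_refl keys_monoid_alg_smult]
    unfolding      monoid_alg_mult_superset[OF finite_keys finite_keys subset_refl subset_refl]
    by (simp add: monoid_alg_smult_sum monoid_alg_smult_single mult.left_commute)
qed (use monoid_alg_mult_closed r in auto)

lemma monoid_alg_bilinear_eq:
  fixes M :: "('k::field, 'c, 'n) module_scheme"
  assumes M: "vspace M"
    and "\<And>p. p \<in> carrier (monoid_alg G) \<Longrightarrow> f p \<in> linmap (monoid_alg G) M"
    "\<And>p. p \<in> carrier (monoid_alg G) \<Longrightarrow> g p \<in> linmap (monoid_alg G) M"
    "\<And>r. r \<in> carrier (monoid_alg G) \<Longrightarrow> (\<lambda>p. f p r) \<in> linmap (monoid_alg G) M"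
    "\<And>r. r \<in> carrier (monoid_alg G) \<Longrightarrow> (\<lambda>p. g p r) \<in> linmap (monoid_alg G) M"
    "\<And>x y. x \<in> carrier G \<Longrightarrow> y \<in> carrier G \<Longrightarrow>
       f (Poly_Mapping.single x 1) (Poly_Mapping.single y 1) =
       g (Poly_Mapping.single x 1) (Poly_Mapping.single y 1)"
    and pr: "p \<in> carrier (monoid_alg G)" "r \<in> carrier (monoid_alg G)"
  shows "f p r = g p r"
proof (rule monoid_alg_linmap_eq[of "\<lambda>p. f p r" G M "\<lambda>p. g p r"])
  fix x assume x: "x \<in> carrier G"
  show "f (Poly_Mapping.single x 1) r = g (Poly_Mapping.single x 1) r"
    by (rule monoid_alg_linmap_eq[of "f (Poly_Mapping.single x 1)" G M "g (Poly_Mapping.single x 1)"])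
      (use assms x in auto)
qed (use assms in auto)

lemma kalg_monoid_alg: "kalg (monoid_alg G :: ('k::field, 'a \<Rightarrow>\<^sub>0 'k) module)"
proof (rule kalgI[OF vspace_monoid_alg])
  let ?F = "monoid_alg G :: ('k::field, 'a \<Rightarrow>\<^sub>0 'k) module"
  note l = monoid_alg_mult_linmap_l and r = monoid_alg_mult_linmap_r
  fix x y z assume [simp]: "x \<in> carrier ?F" "y \<in> carrier ?F" "z \<in> carrier ?F"
  note [simp del] = monoid_alg_simps(1)
  show "x \<otimes>\<^bsub>?F\<^esub> y \<in> carrier ?F" by (rule monoid_alg_mult_closed) auto
  \<comment> \<open>Associativity is trilinear: \<open>x\<close> and \<open>y\<close> are reduced to
    basis elements together, then \<open>z\<close> separately.\<close>
  show "(x \<otimes>\<^bsub>?F\<^esub> y) \<otimes>\<^bsub>?F\<^esub> z = x \<otimes>\<^bsub>?F\<^esub> (y \<otimes>\<^bsub>?F\<^esub> z)"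
  proof (rule monoid_alg_bilinear_eq[where f = "\<lambda>x y. (x \<otimes>\<^bsub>?F\<^esub> y) \<otimes>\<^bsub>?F\<^esub> z"
        and g = "\<lambda>x y. x \<otimes>\<^bsub>?F\<^esub> (y \<otimes>\<^bsub>?F\<^esub> z)", OF vspace_monoid_alg])
    fix a b assume ab: "a \<in> carrier G" "b \<in> carrier G"
    let ?a = "Poly_Mapping.single a (1::'k)" and ?b = "Poly_Mapping.single b (1::'k)"
    have [simp]: "?a \<in> carrier ?F" "?b \<in> carrier ?F" using ab by (auto simp: monoid_alg_simps(1))
    show "(?a \<otimes>\<^bsub>?F\<^esub> ?b) \<otimes>\<^bsub>?F\<^esub> z = ?a \<otimes>\<^bsub>?F\<^esub> (?b \<otimes>\<^bsub>?F\<^esub> z)"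
    proof (rule monoid_alg_linmap_eq[where f = "\<lambda>z. (?a \<otimes>\<^bsub>?F\<^esub> ?b) \<otimes>\<^bsub>?F\<^esub> z"
        and g = "\<lambda>z. ?a \<otimes>\<^bsub>?F\<^esub> (?b \<otimes>\<^bsub>?F\<^esub> z)", OF _ _ vspace_monoid_alg])
      show "(\<lambda>z. (?a \<otimes>\<^bsub>?F\<^esub> ?b) \<otimes>\<^bsub>?F\<^esub> z) \<in> linmap ?F ?F"
        by (intro r monoid_alg_mult_closed) auto
      show "(\<lambda>z. ?a \<otimes>\<^bsub>?F\<^esub> (?b \<otimes>\<^bsub>?F\<^esub> z)) \<in> linmap ?F ?F"
        by (rule linmap_comp[OF r r]) auto
    qed (use ab m_assoc in auto)
  next
    fix a assume a [simp]: "a \<in> carrier ?F"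
    show "(\<lambda>y. (a \<otimes>\<^bsub>?F\<^esub> y) \<otimes>\<^bsub>?F\<^esub> z) \<in> linmap ?F ?F" by (rule linmap_comp[OF r l]) auto
    show "(\<lambda>y. a \<otimes>\<^bsub>?F\<^esub> (y \<otimes>\<^bsub>?F\<^esub> z)) \<in> linmap ?F ?F" by (rule linmap_comp[OF l r]) auto
    show "(\<lambda>x. (x \<otimes>\<^bsub>?F\<^esub> a) \<otimes>\<^bsub>?F\<^esub> z) \<in> linmap ?F ?F" by (rule linmap_comp[OF l l]) auto
    show "(\<lambda>x. x \<otimes>\<^bsub>?F\<^esub> (a \<otimes>\<^bsub>?F\<^esub> z)) \<in> linmap ?F ?F"
      by (rule l) (auto intro: monoid_alg_mult_closed)
  qed auto
  have one: "\<one>\<^bsub>?F\<^esub> \<in> carrier ?F" by (simp add: monoid_alg_simps(1))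
  show "\<one>\<^bsub>?F\<^esub> \<otimes>\<^bsub>?F\<^esub> x = x"
    by (rule monoid_alg_linmap_eq[OF r[OF one] _ vspace_monoid_alg]) (auto intro!: linmapI)
  show "x \<otimes>\<^bsub>?F\<^esub> \<one>\<^bsub>?F\<^esub> = x"
    by (rule monoid_alg_linmap_eq[OF l[OF one] _ vspace_monoid_alg]) (auto intro!: linmapI)
  show "(x \<oplus>\<^bsub>?F\<^esub> y) \<otimes>\<^bsub>?F\<^esub> z = x \<otimes>\<^bsub>?F\<^esub> z \<oplus>\<^bsub>?F\<^esub> y \<otimes>\<^bsub>?F\<^esub> z"
    by (rule linmap_add[OF l]) auto
  show "z \<otimes>\<^bsub>?F\<^esub> (x \<oplus>\<^bsub>?F\<^esub> y) = z \<otimes>\<^bsub>?F\<^esub> x \<oplus>\<^bsub>?F\<^esub> z \<otimes>\<^bsub>?F\<^esub> y"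
    by (rule linmap_add[OF r]) auto
  show "(s \<odot>\<^bsub>?F\<^esub> x) \<otimes>\<^bsub>?F\<^esub> y = s \<odot>\<^bsub>?F\<^esub> (x \<otimes>\<^bsub>?F\<^esub> y)" for s by (rule linmap_smult[OF l]) auto
  show "x \<otimes>\<^bsub>?F\<^esub> (s \<odot>\<^bsub>?F\<^esub> y) = s \<odot>\<^bsub>?F\<^esub> (x \<otimes>\<^bsub>?F\<^esub> y)" for s by (rule linmap_smult[OF r]) auto
qed simp

lemma lin_ext_alg_hom:
  fixes A :: "('k::field, 'c, 'n) module_scheme"
  assumes "kalg A" "\<phi> \<in> carrier G \<rightarrow> carrier A" "\<phi> \<one> = \<one>\<^bsub>A\<^esub>"
    "\<And>x y. x \<in> carrier G \<Longrightarrow> y \<in> carrier G \<Longrightarrow> \<phi> (x \<otimes> y) = \<phi> x \<otimes>\<^bsub>A\<^esub> \<phi> y"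
  shows "lin_ext A \<phi> \<in> alg_hom (monoid_alg G) A"
proof -
  interpret A: kalg A by fact
  have lin: "lin_ext A \<phi> \<in> linmap (monoid_alg G) A"
    by (rule lin_ext_linmap[OF A.vspace_axioms assms(2)])
  note cl = linmap_closed[OF lin]
  have mult: "lin_ext A \<phi> (p \<otimes>\<^bsub>monoid_alg G\<^esub> r) = lin_ext A \<phi> p \<otimes>\<^bsub>A\<^esub> lin_ext A \<phi> r"
    if "p \<in> carrier (monoid_alg G)" "r \<in> carrier (monoid_alg G)" for p r
  proof (rule monoid_alg_bilinear_eq[where f = "\<lambda>p r. lin_ext A \<phi> (p \<otimes>\<^bsub>monoid_alg G\<^esub> r)"
        and g = "\<lambda>p r. lin_ext A \<phi> p \<otimes>\<^bsub>A\<^esub> lin_ext A \<phi> r", OF A.vspace_axioms _ _ _ _ _ that])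
    fix p :: "'a \<Rightarrow>\<^sub>0 'k" assume p: "p \<in> carrier (monoid_alg G)"
    show "(\<lambda>r. lin_ext A \<phi> (p \<otimes>\<^bsub>monoid_alg G\<^esub> r)) \<in> linmap (monoid_alg G) A"
      by (rule linmap_comp[OF monoid_alg_mult_linmap_r[OF p] lin])
    show "(\<lambda>r. lin_ext A \<phi> (r \<otimes>\<^bsub>monoid_alg G\<^esub> p)) \<in> linmap (monoid_alg G) A"
      by (rule linmap_comp[OF monoid_alg_mult_linmap_l[OF p] lin])
    show "(\<lambda>r. lin_ext A \<phi> p \<otimes>\<^bsub>A\<^esub> lin_ext A \<phi> r) \<in> linmap (monoid_alg G) A"
      using cl[OF p] cl by (intro linmapI)
        (simp_all only: linmap_add[OF lin] linmap_smult[OF lin] A.r_distr A.smult_mult_r A.m_closed)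
    show "(\<lambda>r. lin_ext A \<phi> r \<otimes>\<^bsub>A\<^esub> lin_ext A \<phi> p) \<in> linmap (monoid_alg G) A"
      using cl[OF p] cl by (intro linmapI)
        (simp_all only: linmap_add[OF lin] linmap_smult[OF lin] A.l_distr A.smult_mult_l A.m_closed)
  next
    fix x y assume "x \<in> carrier G" "y \<in> carrier G"
    moreover then have "\<phi> x \<in> carrier A" "\<phi> y \<in> carrier A" "\<phi> (x \<otimes> y) \<in> carrier A" using assms(2) by auto
    ultimately show "lin_ext A \<phi> (Poly_Mapping.single x 1 \<otimes>\<^bsub>monoid_alg G\<^esub> Poly_Mapping.single y 1) =
      lin_ext A \<phi> (Poly_Mapping.single x 1) \<otimes>\<^bsub>A\<^esub> lin_ext A \<phi> (Poly_Mapping.single y 1)"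
      by (simp add: lin_ext_single[OF A.vspace_axioms] assms(4))
  qed
  show ?thesis
    using lin mult assms(3) lin_ext_single[OF A.vspace_axioms, of \<phi> \<one> 1] by (simp add: alg_hom_def)
qed

end

section \<open>Tensor products\<close>

definition bilin ::
  "('k::field, 'v, 'm) module_scheme \<Rightarrow> ('k, 'w, 'n) module_scheme \<Rightarrow>
    ('k, 'b, 'l) module_scheme \<Rightarrow> ('v \<Rightarrow> 'w \<Rightarrow> 'b) \<Rightarrow> bool" where
  "bilin V W M \<beta> \<longleftrightarrow> (\<forall>v\<in>carrier V. \<beta> v \<in> linmap W M) \<and> (\<forall>w\<in>carrier W. (\<lambda>v. \<beta> v w) \<in> linmap V M)"

lemma bilinI:
  assumes "\<And>v. v \<in> carrier V \<Longrightarrow> \<beta> v \<in> linmap W M" "\<And>w. w \<in> carrier W \<Longrightarrow> (\<lambda>v. \<beta> v w) \<in> linmap V M"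
  shows "bilin V W M \<beta>"
  using assms by (simp add: bilin_def)

lemma bilinD1: "bilin V W M \<beta> \<Longrightarrow> v \<in> carrier V \<Longrightarrow> \<beta> v \<in> linmap W M"
  and bilinD2: "bilin V W M \<beta> \<Longrightarrow> w \<in> carrier W \<Longrightarrow> (\<lambda>v. \<beta> v w) \<in> linmap V M"
  by (simp_all add: bilin_def)

lemma carrier_DirProd [simp]: "carrier (G \<times>\<times> H) = carrier G \<times> carrier H"
  by (simp add: DirProd_def)

locale tensor_product = V: vspace V + W: vspace W
  for V :: "('k::field, 'v, 'm) module_scheme" and W :: "('k, 'w, 'n) module_scheme"
begin

abbreviation F :: "('k, 'v \<times> 'w \<Rightarrow>\<^sub>0 'k) module" where
  "F \<equiv> monoid_alg (V \<times>\<times> W)"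

abbreviation T :: "('k, ('v \<times> 'w \<Rightarrow>\<^sub>0 'k) set) module" where
  "T \<equiv> tensor V W"

lemma bilin_rels_sub: "bilin_rels V W \<subseteq> carrier F"
proof -
  have "p + r \<in> carrier F" "p - r \<in> carrier F" if "p \<in> carrier F" "r \<in> carrier F" for p r
    using that Poly_Mapping.keys_add[of p r] Poly_Mapping.keys_add[of p "- r"] by auto
  moreover have "Poly_Mapping.single (v, w) s \<in> carrier F"
    if "v \<in> carrier V" "w \<in> carrier W" for v w s using that by auto
  ultimately show ?thesis
    by (auto simp: bilin_rels_def Let_def simp del: monoid_alg_simps(1))
qed

text \<open>The \<open>rewrites\<close> clause makes the general facts on quotients available in
  terms of \<open>T\<close>.\<close>

sublocale vquot F "tensor_null V W"
  rewrites "quot_alg F (tensor_null V W) = T"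
proof -
  interpret F: vspace F by (rule vspace_monoid_alg)
  show "vquot F (tensor_null V W)"
    unfolding tensor_null_def
    by (intro vquot.intro vquot_axioms.intro F.vspace_axioms
        module.span_is_submodule[OF F.is_module bilin_rels_sub])
  show "quot_alg F (tensor_null V W) = T" by (simp add: tensor_def)
qed

lemma rels_null: "p \<in> bilin_rels V W \<Longrightarrow> p \<in> tensor_null V W"
  unfolding tensor_null_def
  using module.in_own_span[OF is_module bilin_rels_sub] by auto

lemma single_in_F: "v \<in> carrier V \<Longrightarrow> w \<in> carrier W \<Longrightarrow> Poly_Mapping.single (v, w) s \<in> carrier F"
  by auto

lemma pure_closed [simp, intro]:
  "v \<in> carrier V \<Longrightarrow> w \<in> carrier W \<Longrightarrow> pure_tensor V W v w \<in> carrier T"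
  unfolding pure_tensor_def by (rule coset_in_quot) auto

lemma vspace_tensor: "vspace T"
  by (rule vspace_quot)

lemma coset_diff_null:
  assumes "p \<in> carrier F" "r \<in> carrier F" "p - r \<in> tensor_null V W"
  shows "tensor_null V W +>\<^bsub>F\<^esub> p = tensor_null V W +>\<^bsub>F\<^esub> r"
  using assms by (intro coset_eqI) (simp_all add: monoid_alg_minus del: monoid_alg_simps(1))

lemma pure_add_l:
  assumes "v \<in> carrier V" "v' \<in> carrier V" "w \<in> carrier W"
  shows "pure_tensor V W (v \<oplus>\<^bsub>V\<^esub> v') w = pure_tensor V W v w \<oplus>\<^bsub>T\<^esub> pure_tensor V W v' w"
proof -
  have "pure_tensor V W (v \<oplus>\<^bsub>V\<^esub> v') w =
      tensor_null V W +>\<^bsub>F\<^esub> (Poly_Mapping.single (v, w) 1 + Poly_Mapping.single (v', w) 1)"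
    unfolding pure_tensor_def
  proof (rule coset_diff_null)
    show "Poly_Mapping.single (v, w) 1 + Poly_Mapping.single (v', w) 1 \<in> carrier F"
      using assms single_in_F add.m_closed[of "Poly_Mapping.single (v, w) 1" "Poly_Mapping.single (v', w) 1"]
      by simp
    show "Poly_Mapping.single (v \<oplus>\<^bsub>V\<^esub> v', w) 1 -
        (Poly_Mapping.single (v, w) 1 + Poly_Mapping.single (v', w) (1::'k)) \<in> tensor_null V W"
      unfolding diff_diff_eq[symmetric] using assms
      by (intro rels_null) (auto simp: bilin_rels_def Let_def)
  qed (use assms in auto)
  also have "\<dots> = pure_tensor V W v w \<oplus>\<^bsub>T\<^esub> pure_tensor V W v' w"
    using assms unfolding pure_tensor_def
    by (subst linmap_add[OF coset_linmap, symmetric]) auto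
  finally show ?thesis .
qed

lemma pure_add_r:
  assumes "v \<in> carrier V" "w \<in> carrier W" "w' \<in> carrier W"
  shows "pure_tensor V W v (w \<oplus>\<^bsub>W\<^esub> w') = pure_tensor V W v w \<oplus>\<^bsub>T\<^esub> pure_tensor V W v w'"
proof -
  have "pure_tensor V W v (w \<oplus>\<^bsub>W\<^esub> w') =
      tensor_null V W +>\<^bsub>F\<^esub> (Poly_Mapping.single (v, w) 1 + Poly_Mapping.single (v, w') 1)"
    unfolding pure_tensor_def
  proof (rule coset_diff_null)
    show "Poly_Mapping.single (v, w) 1 + Poly_Mapping.single (v, w') 1 \<in> carrier F"
      using assms single_in_F add.m_closed[of "Poly_Mapping.single (v, w) 1" "Poly_Mapping.single (v, w') 1"]
      by simp
    show "Poly_Mapping.single (v, w \<oplus>\<^bsub>W\<^esub> w') 1 -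
        (Poly_Mapping.single (v, w) 1 + Poly_Mapping.single (v, w') (1::'k)) \<in> tensor_null V W"
      unfolding diff_diff_eq[symmetric] using assms
      by (intro rels_null) (auto simp: bilin_rels_def Let_def)
  qed (use assms in auto)
  also have "\<dots> = pure_tensor V W v w \<oplus>\<^bsub>T\<^esub> pure_tensor V W v w'"
    using assms unfolding pure_tensor_def
    by (subst linmap_add[OF coset_linmap, symmetric]) auto
  finally show ?thesis .
qed

lemma smult_pure:
  assumes "v \<in> carrier V" "w \<in> carrier W"
  shows "s \<odot>\<^bsub>T\<^esub> pure_tensor V W v w = tensor_null V W +>\<^bsub>F\<^esub> Poly_Mapping.single (v, w) s"
  using assms unfolding pure_tensor_def
  by (subst linmap_smult[OF coset_linmap, symmetric]) (auto simp: monoid_alg_smult_single)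

lemma pure_smult_l:
  assumes "v \<in> carrier V" "w \<in> carrier W"
  shows "pure_tensor V W (s \<odot>\<^bsub>V\<^esub> v) w = s \<odot>\<^bsub>T\<^esub> pure_tensor V W v w"
  unfolding smult_pure[OF assms] unfolding pure_tensor_def
  using assms by (intro coset_diff_null rels_null) (auto simp: bilin_rels_def Let_def)

lemma pure_smult_r:
  assumes "v \<in> carrier V" "w \<in> carrier W"
  shows "pure_tensor V W v (s \<odot>\<^bsub>W\<^esub> w) = s \<odot>\<^bsub>T\<^esub> pure_tensor V W v w"
  unfolding smult_pure[OF assms] unfolding pure_tensor_def
  using assms by (intro coset_diff_null rels_null) (auto simp: bilin_rels_def Let_def)

lemma bilin_pure: "bilin V W T (pure_tensor V W)"
  by (intro bilinI linmapI) (auto simp: pure_add_l pure_add_r pure_smult_l pure_smult_r)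

text \<open>Pure tensors are the cosets of the basis elements of the free space, so composing with
  the projection reduces the claim to linear maps on that space.\<close>

lemma tensor_linmap_eq:
  fixes M :: "('k, 'c, 'o) module_scheme"
  assumes "f \<in> linmap T M" "g \<in> linmap T M" "vspace M"
    "\<And>v w. v \<in> carrier V \<Longrightarrow> w \<in> carrier W \<Longrightarrow> f (pure_tensor V W v w) = g (pure_tensor V W v w)"
    "t \<in> carrier T"
  shows "f t = g t"
proof -
  obtain p where p: "p \<in> carrier F" "t = tensor_null V W +>\<^bsub>F\<^esub> p" using assms(5) by (rule quotE)
  have "f (tensor_null V W +>\<^bsub>F\<^esub> p) = g (tensor_null V W +>\<^bsub>F\<^esub> p)"
    by (rule monoid_alg_linmap_eq[OF linmap_comp[OF coset_linmap assms(1)]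
          linmap_comp[OF coset_linmap assms(2)] assms(3) _ p(1)])
      (use assms(4) in \<open>auto simp: pure_tensor_def\<close>)
  with p show ?thesis by simp
qed

context
  fixes M :: "('k, 'c, 'o) module_scheme" and \<beta>
  assumes \<beta>: "bilin V W M \<beta>" and M: "vspace M"
begin

lemma lin_ext_bilin: "lin_ext M (\<lambda>(v, w). \<beta> v w) \<in> linmap F M"
  using linmap_closed[OF bilinD1[OF \<beta>]] by (intro lin_ext_linmap[OF M]) auto

lemma lin_ext_bilin_single:
  "v \<in> carrier V \<Longrightarrow> w \<in> carrier W \<Longrightarrow>
    lin_ext M (\<lambda>(v, w). \<beta> v w) (Poly_Mapping.single (v, w) s) = s \<odot>\<^bsub>M\<^esub> \<beta> v w"
  using linmap_closed[OF bilinD1[OF \<beta>]] by (subst lin_ext_single[OF M]) auto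

text \<open>Each family of bilinearity relations is killed by one of the linearity properties of
  \<open>\<beta>\<close>; on the span of the relations the extension therefore agrees with the zero
  map. This is why \<open>tensor_lift\<close> is well defined.\<close>

lemma lin_ext_bilin_null:
  assumes "p \<in> tensor_null V W"
  shows "lin_ext M (\<lambda>(v, w). \<beta> v w) p = \<zero>\<^bsub>M\<^esub>"
proof (rule linmap_span_eq[OF lin_ext_bilin const_zero_linmap[OF M] vspace_monoid_alg M bilin_rels_sub])
  interpret M: vspace M by (rule M)
  note cl = linmap_closed[OF bilinD1[OF \<beta>]]
  have diff: "lin_ext M (\<lambda>(v, w). \<beta> v w) (p - r) =
    lin_ext M (\<lambda>(v, w). \<beta> v w) p \<ominus>\<^bsub>M\<^esub> lin_ext M (\<lambda>(v, w). \<beta> v w) r"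
    if "p \<in> carrier F" "r \<in> carrier F" for p r
    using linmap_minus[OF lin_ext_bilin vspace_monoid_alg M that] monoid_alg_minus[OF that] by simp
  have diff3: "lin_ext M (\<lambda>(v, w). \<beta> v w) (p - r - r') =
    lin_ext M (\<lambda>(v, w). \<beta> v w) p \<ominus>\<^bsub>M\<^esub> lin_ext M (\<lambda>(v, w). \<beta> v w) r \<ominus>\<^bsub>M\<^esub> lin_ext M (\<lambda>(v, w). \<beta> v w) r'"
    if "p \<in> carrier F" "r \<in> carrier F" "r' \<in> carrier F" for p r r'
    using that minus_closed[OF that(1,2)]
    by (simp add: diff monoid_alg_minus del: monoid_alg_simps(1))
  have cancel: "a \<oplus>\<^bsub>M\<^esub> b \<ominus>\<^bsub>M\<^esub> a \<ominus>\<^bsub>M\<^esub> b = \<zero>\<^bsub>M\<^esub>" if "a \<in> carrier M" "b \<in> carrier M" for a b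
    using that M.r_neg[of "a \<oplus>\<^bsub>M\<^esub> b"] by (simp add: a_minus_def M.minus_add M.a_assoc)
  have cancel2: "a \<ominus>\<^bsub>M\<^esub> a = \<zero>\<^bsub>M\<^esub>" if "a \<in> carrier M" for a
    using that by (simp add: a_minus_def M.r_neg)
  fix r assume "r \<in> bilin_rels V W"
  then show "lin_ext M (\<lambda>(v, w). \<beta> v w) r = \<zero>\<^bsub>M\<^esub>"
    unfolding bilin_rels_def Let_def
    by (elim UnE CollectE exE conjE)
      (simp_all add: diff diff3 single_in_F lin_ext_bilin_single cl cancel cancel2
        linmap_add[OF bilinD1[OF \<beta>]] linmap_add[OF bilinD2[OF \<beta>]]
        linmap_smult[OF bilinD1[OF \<beta>]] linmap_smult[OF bilinD2[OF \<beta>]] del: monoid_alg_simps(1))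
qed (use assms in \<open>simp add: tensor_null_def\<close>)

lemma tensor_lift_linmap: "tensor_lift M \<beta> \<in> linmap T M"
  using quot_lift_linmap[OF lin_ext_bilin M lin_ext_bilin_null]
  by (simp add: tensor_lift_def[abs_def])

lemma tensor_lift_pure:
  assumes "v \<in> carrier V" "w \<in> carrier W"
  shows "tensor_lift M \<beta> (pure_tensor V W v w) = \<beta> v w"
  unfolding tensor_lift_def pure_tensor_def
  using assms linmap_closed[OF bilinD1[OF \<beta>]] vspace.one_smult[OF M]
  by (subst quot_lift[OF lin_ext_bilin M lin_ext_bilin_null])
    (auto simp: lin_ext_bilin_single)

end

end

section \<open>The product on a tensor product of algebras\<close>

locale tensor_alg = V: kalg V + W: kalg W
  for V :: "('k::field, 'v, 'm) module_scheme" and W :: "('k, 'w, 'n) module_scheme"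

sublocale tensor_alg \<subseteq> tensor_product V W ..

context tensor_alg
begin

lemma monoid_DirProd: "monoid (V \<times>\<times> W)"
  by (rule DirProd_monoid) (rule V.monoid_axioms W.monoid_axioms)+

lemma kalg_F: "kalg F"
  by (rule monoid.kalg_monoid_alg[OF monoid_DirProd])

text \<open>Multiplication by a basis element carries each bilinearity relation to one of the same
  family, with products as its new entries: distributivity handles the two additive families, and
  scalars passing through products the other two. So it preserves the span of the relations.\<close>

lemma single_mult_null:
  assumes "x \<in> carrier V" "y \<in> carrier W" "p \<in> tensor_null V W"
  shows "Poly_Mapping.single (x, y) 1 \<otimes>\<^bsub>F\<^esub> p \<in> tensor_null V W"
    and "p \<otimes>\<^bsub>F\<^esub> Poly_Mapping.single (x, y) 1 \<in> tensor_null V W"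
proof -
  interpret F: kalg F by (rule kalg_F)
  have s: "Poly_Mapping.single (x, y) 1 \<in> carrier F" using assms by auto
  note lin = monoid.monoid_alg_mult_linmap_r[OF monoid_DirProd s]
    monoid.monoid_alg_mult_linmap_l[OF monoid_DirProd s]
  have diff: "f (a - b) = f a - f b" if "f \<in> linmap F F" "a \<in> carrier F" "b \<in> carrier F" for f a b
    using linmap_minus[OF that(1) vspace_monoid_alg vspace_monoid_alg that(2,3)]
    by (simp add: monoid_alg_minus that linmap_closed[OF that(1)] del: monoid_alg_simps(1))
  have diff3: "f (a - b - c) = f a - f b - f c"
    if "f \<in> linmap F F" "a \<in> carrier F" "b \<in> carrier F" "c \<in> carrier F" for f a b c
    using that minus_closed[OF that(2,3)] by (simp add: diff monoid_alg_minus del: monoid_alg_simps(1))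
  have main: "f p \<in> tensor_null V W" if f: "f \<in> linmap F F" and
    *: "\<And>r. r \<in> bilin_rels V W \<Longrightarrow> f r \<in> bilin_rels V W" for f
  proof -
    have "submodule class_ring {r \<in> carrier F. f r \<in> tensor_null V W} F"
      by (rule linmap_vimage_submodule[OF f vspace_monoid_alg vspace_monoid_alg sub])
    then have "tensor_null V W \<subseteq> {r \<in> carrier F. f r \<in> tensor_null V W}"
      unfolding tensor_null_def using bilin_rels_sub * rels_null
      by (intro module.span_is_subset[OF is_module]) (auto simp: tensor_null_def)
    then show ?thesis using assms(3) by auto
  qed
  have *: "Poly_Mapping.single (x, y) 1 \<otimes>\<^bsub>F\<^esub> r \<in> bilin_rels V W" if "r \<in> bilin_rels V W" for r
    using that assms(1,2) unfolding bilin_rels_def Let_def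
    apply (elim UnE CollectE exE conjE)
       apply (simp_all add: diff[OF lin(1)] diff3[OF lin(1)] single_in_F V.r_distr W.r_distr
        V.smult_mult_r W.smult_mult_r del: monoid_alg_simps(1))
       apply (metis V.m_closed W.m_closed)+
    done
  show "Poly_Mapping.single (x, y) 1 \<otimes>\<^bsub>F\<^esub> p \<in> tensor_null V W"
    by (rule main[OF lin(1) *])
  have *: "r \<otimes>\<^bsub>F\<^esub> Poly_Mapping.single (x, y) 1 \<in> bilin_rels V W" if "r \<in> bilin_rels V W" for r
    using that assms(1,2) unfolding bilin_rels_def Let_def
    apply (elim UnE CollectE exE conjE)
       apply (simp_all add: diff[OF lin(2)] diff3[OF lin(2)] single_in_F V.l_distr W.l_distr
        V.smult_mult_l W.smult_mult_l del: monoid_alg_simps(1))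
       apply (metis V.m_closed W.m_closed)+
    done
  show "p \<otimes>\<^bsub>F\<^esub> Poly_Mapping.single (x, y) 1 \<in> tensor_null V W"
    by (rule main[OF lin(2) *])
qed

text \<open>For a fixed \<open>p\<close> in the null space, the multipliers that keep
  \<open>p\<close> inside form a subspace on either side. It contains the basis elements by
  \<open>single_mult_null\<close>, hence everything.\<close>

sublocale alg_quot F "tensor_null V W"
  rewrites "quot_alg F (tensor_null V W) = T"
proof -
  interpret F: kalg F by (rule kalg_F)
  have "ideal (tensor_null V W) F"
  proof (rule idealI)
    show "subgroup (tensor_null V W) (add_monoid F)" by (rule sg.a_subgroup)
    fix p r assume p: "p \<in> tensor_null V W" and r: "r \<in> carrier F"
    note pF = sg.a_Hcarr[OF p]
    have sub: "submodule class_ring {r \<in> carrier F. f r \<in> tensor_null V W} F"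
      if f: "f \<in> linmap F F" for f
      by (rule linmap_vimage_submodule[OF f vspace_monoid_alg vspace_monoid_alg sub])
    show "r \<otimes>\<^bsub>F\<^esub> p \<in> tensor_null V W"
      using monoid_alg_subset_submodule[OF sub[OF monoid.monoid_alg_mult_linmap_l[OF monoid_DirProd pF]] _ r]
        single_mult_null(1)[OF _ _ p] by auto
    show "p \<otimes>\<^bsub>F\<^esub> r \<in> tensor_null V W"
      using monoid_alg_subset_submodule[OF sub[OF monoid.monoid_alg_mult_linmap_r[OF monoid_DirProd pF]] _ r]
        single_mult_null(2)[OF _ _ p] by auto
  qed (rule F.ring_axioms)
  then show "alg_quot F (tensor_null V W)"
    by (intro alg_quot.intro kalg_F)
qed (simp add: tensor_def)

lemma kalg_tensor: "kalg T"
  by (rule kalg_quot)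

lemma pure_mult:
  assumes "v \<in> carrier V" "w \<in> carrier W" "v' \<in> carrier V" "w' \<in> carrier W"
  shows "pure_tensor V W v w \<otimes>\<^bsub>T\<^esub> pure_tensor V W v' w' = pure_tensor V W (v \<otimes>\<^bsub>V\<^esub> v') (w \<otimes>\<^bsub>W\<^esub> w')"
  using assms unfolding pure_tensor_def by (subst quot_mult) auto

lemma pure_one: "\<one>\<^bsub>T\<^esub> = pure_tensor V W \<one>\<^bsub>V\<^esub> \<one>\<^bsub>W\<^esub>"
  by (simp add: tensor_def pure_tensor_def)

end

section \<open>Finite coordinate systems\<close>

text \<open>A basis of \<open>n + 1\<close> vectors together with its dual functionals. Coordinates
  are thereby linear maps from the start, and linear independence is contained in
  \<open>coord_e\<close>.\<close>

locale frame = V: vspace V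
  for V :: "('k::field, 'v, 'm) module_scheme" +
  fixes n :: nat and e :: "nat \<Rightarrow> 'v" and \<phi> :: "nat \<Rightarrow> 'v \<Rightarrow> 'k"
  assumes e_closed: "i \<le> n \<Longrightarrow> e i \<in> carrier V"
    and coord_linmap: "i \<le> n \<Longrightarrow> \<phi> i \<in> linmap V base_alg"
    and coord_e: "i \<le> n \<Longrightarrow> j \<le> n \<Longrightarrow> \<phi> i (e j) = (if i = j then 1 else 0)"
    and expand: "x \<in> carrier V \<Longrightarrow> x = (\<Oplus>\<^bsub>V\<^esub>i\<in>{..n}. \<phi> i x \<odot>\<^bsub>V\<^esub> e i)"

lemma (in frame) linmap_eq:
  assumes "f \<in> linmap V M" "g \<in> linmap V M" "vspace M" "\<And>i. i \<le> n \<Longrightarrow> f (e i) = g (e i)" "x \<in> carrier V"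
  shows "f x = g x"
proof -
  interpret M: vspace M by fact
  have *: "h x = (\<Oplus>\<^bsub>M\<^esub>i\<in>{..n}. \<phi> i x \<odot>\<^bsub>M\<^esub> h (e i))" if h: "h \<in> linmap V M" for h
  proof -
    have "h x = h (\<Oplus>\<^bsub>V\<^esub>i\<in>{..n}. \<phi> i x \<odot>\<^bsub>V\<^esub> e i)" using expand[OF assms(5)] by simp
    also have "\<dots> = (\<Oplus>\<^bsub>M\<^esub>i\<in>{..n}. h (\<phi> i x \<odot>\<^bsub>V\<^esub> e i))"
      using e_closed by (intro linmap_finsum[OF h V.vspace_axioms assms(3)]) auto
    also have "\<dots> = (\<Oplus>\<^bsub>M\<^esub>i\<in>{..n}. \<phi> i x \<odot>\<^bsub>M\<^esub> h (e i))"
      using e_closed linmap_closed[OF h] by (intro M.finsum_cong') (auto simp: linmap_smult[OF h])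
    finally show ?thesis .
  qed
  show ?thesis
    unfolding *[OF assms(1)] *[OF assms(2)]
    using assms(4) e_closed linmap_closed[OF assms(2)] by (intro M.finsum_cong') auto
qed

lemma bilin_smult:
  assumes "\<phi> \<in> linmap V base_alg" "vspace W"
  shows "bilin V W W (\<lambda>v w. \<phi> v \<odot>\<^bsub>W\<^esub> w)"
proof -
  interpret W: vspace W by fact
  show ?thesis
    by (intro bilinI linmapI)
      (auto simp: linmap_add[OF assms(1)] linmap_smult[OF assms(1)] W.smult_l_distr W.smult_r_distr
        W.smult_smult mult.commute)
qed

locale frame_tensor = frame V n e \<phi> + tensor_product V W
  for V :: "('k::field, 'v, 'm) module_scheme" and W :: "('k, 'w, 'l) module_scheme" and n e \<phi>
begin

text \<open>Contraction of the first factor with the \<open>i\<close>-th coordinate. These maps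
  identify \<open>tensor V W\<close> with \<open>n + 1\<close> copies of \<open>W\<close>.\<close>

definition tcoord :: "nat \<Rightarrow> ('v \<times> 'w \<Rightarrow>\<^sub>0 'k) set \<Rightarrow> 'w" where
  "tcoord i = tensor_lift W (\<lambda>v w. \<phi> i v \<odot>\<^bsub>W\<^esub> w)"

lemma tcoord_linmap: "i \<le> n \<Longrightarrow> tcoord i \<in> linmap T W"
  unfolding tcoord_def
  by (intro tensor_lift_linmap bilin_smult coord_linmap W.vspace_axioms)

lemma tcoord_pure:
  "i \<le> n \<Longrightarrow> v \<in> carrier V \<Longrightarrow> w \<in> carrier W \<Longrightarrow> tcoord i (pure_tensor V W v w) = \<phi> i v \<odot>\<^bsub>W\<^esub> w"
  unfolding tcoord_def
  by (intro tensor_lift_pure bilin_smult coord_linmap W.vspace_axioms)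

lemma tensor_expand:
  assumes t: "t \<in> carrier T"
  shows "t = (\<Oplus>\<^bsub>T\<^esub>i\<in>{..n}. pure_tensor V W (e i) (tcoord i t))"
proof (rule tensor_linmap_eq[OF _ _ vspace_tensor _ t])
  interpret T: vspace T by (rule vspace_tensor)
  show "(\<lambda>t. t) \<in> linmap T T" by (rule linmapI) auto
  show "(\<lambda>t. \<Oplus>\<^bsub>T\<^esub>i\<in>{..n}. pure_tensor V W (e i) (tcoord i t)) \<in> linmap T T"
    using linmap_comp[OF tcoord_linmap bilinD1[OF bilin_pure e_closed]]
    by (intro linmap_pointwise_sum vspace_tensor) auto
  fix v w assume v: "v \<in> carrier V" and w: "w \<in> carrier W"
  have "pure_tensor V W v w = pure_tensor V W (\<Oplus>\<^bsub>V\<^esub>i\<in>{..n}. \<phi> i v \<odot>\<^bsub>V\<^esub> e i) w"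
    using expand[OF v] by simp
  also have "\<dots> = (\<Oplus>\<^bsub>T\<^esub>i\<in>{..n}. pure_tensor V W (\<phi> i v \<odot>\<^bsub>V\<^esub> e i) w)"
    using e_closed by (intro linmap_finsum[OF bilinD2[OF bilin_pure w] V.vspace_axioms vspace_tensor]) auto
  also have "\<dots> = (\<Oplus>\<^bsub>T\<^esub>i\<in>{..n}. pure_tensor V W (e i) (tcoord i (pure_tensor V W v w)))"
    using e_closed v w by (intro T.finsum_cong') (auto simp: tcoord_pure pure_smult_l pure_smult_r)
  finally show "pure_tensor V W v w = \<dots>" .
qed

text \<open>Source of uniqueness for both definite descriptions of coactions, on the coideal and on
  the twisted dual.\<close>

lemma tensor_eqI:
  assumes "t \<in> carrier T" "u \<in> carrier T" "\<And>i. i \<le> n \<Longrightarrow> tcoord i t = tcoord i u"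
  shows "t = u"
proof -
  interpret T: vspace T by (rule vspace_tensor)
  have "(\<Oplus>\<^bsub>T\<^esub>i\<in>{..n}. pure_tensor V W (e i) (tcoord i t)) = (\<Oplus>\<^bsub>T\<^esub>i\<in>{..n}. pure_tensor V W (e i) (tcoord i u))"
    using assms e_closed linmap_closed[OF tcoord_linmap] by (intro T.finsum_cong') auto
  then show ?thesis using tensor_expand[OF assms(1)] tensor_expand[OF assms(2)] by simp
qed

lemma tcoord_sum:
  assumes "i \<le> n" "\<And>j. j \<le> n \<Longrightarrow> w j \<in> carrier W"
  shows "tcoord i (\<Oplus>\<^bsub>T\<^esub>j\<in>{..n}. pure_tensor V W (e j) (w j)) = w i"
proof -
  have "tcoord i (\<Oplus>\<^bsub>T\<^esub>j\<in>{..n}. pure_tensor V W (e j) (w j)) =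
    (\<Oplus>\<^bsub>W\<^esub>j\<in>{..n}. tcoord i (pure_tensor V W (e j) (w j)))"
    using assms e_closed
    by (intro linmap_finsum[OF tcoord_linmap vspace_tensor W.vspace_axioms]) auto
  also have "\<dots> = (\<Oplus>\<^bsub>W\<^esub>j\<in>{..n}. if i = j then w j else \<zero>\<^bsub>W\<^esub>)"
    using assms e_closed by (intro W.finsum_cong') (auto simp: tcoord_pure coord_e)
  also have "\<dots> = w i" using assms by (intro W.finsum_singleton) auto
  finally show ?thesis .
qed

lemma tensor_sum_closed:
  assumes "\<And>j. j \<le> n \<Longrightarrow> w j \<in> carrier W"
  shows "(\<Oplus>\<^bsub>T\<^esub>j\<in>{..n}. pure_tensor V W (e j) (w j)) \<in> carrier T"
proof -
  interpret T: vspace T by (rule vspace_tensor)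
  show ?thesis using assms e_closed by (intro T.finsum_closed) auto
qed

end

section \<open>Algebra maps out of the quantized coordinate algebra\<close>

text \<open>An \<open>A\<close>-valued point of the quantum group: a matrix over \<open>A\<close>
  whose entries satisfy the defining relations, so that it induces an algebra map from
  \<open>Oq q\<close> to \<open>A\<close>. Each structure map arises from one such point. The
  relations are oriented as rewrite rules that sort words into the order \<open>d\<close>,
  \<open>b\<close>, \<open>c\<close>, \<open>a\<close> and eliminate the products of
  \<open>a\<close> and \<open>d\<close>.\<close>

locale sl2_point = kalg A for A :: "('k::field, 'b, 'm) module_scheme" (structure) +
  fixes q :: 'k and a b c d
  assumes gens_closed: "a \<in> carrier A" "b \<in> carrier A" "c \<in> carrier A" "d \<in> carrier A"
    and rels: "a \<otimes> b = q \<odot> (b \<otimes> a)" "a \<otimes> c = q \<odot> (c \<otimes> a)"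
      "b \<otimes> d = q \<odot> (d \<otimes> b)" "c \<otimes> d = q \<odot> (d \<otimes> c)" "c \<otimes> b = b \<otimes> c"
      "a \<otimes> d = \<one> \<oplus> q \<odot> (b \<otimes> c)" "d \<otimes> a = \<one> \<oplus> inverse q \<odot> (b \<otimes> c)"

abbreviation word_monoid :: "gen list monoid" where
  "word_monoid \<equiv> \<lparr>carrier = UNIV, mult = (@), one = []\<rparr>"

lemma monoid_word: "monoid word_monoid"
  by (rule monoidI) auto

lemma kalg_free_alg: "kalg (free_alg :: ('k::field, 'k free) module)"
  unfolding free_alg_def by (rule monoid.kalg_monoid_alg[OF monoid_word])

lemma free_alg_carrier [simp]: "carrier free_alg = UNIV"
  by (simp add: free_alg_def)

lemma free_alg_minus: "p \<ominus>\<^bsub>free_alg\<^esub> r = p - (r :: 'k::field free)"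
  unfolding free_alg_def by (rule monoid_alg_minus) auto

lemma alg_quot_free: "alg_quot (free_alg :: ('k::field, 'k free) module) (sl2_ideal q)"
proof -
  interpret kalg "free_alg :: ('k::field, 'k free) module" by (rule kalg_free_alg)
  show ?thesis
    unfolding sl2_ideal_def by (intro alg_quot.intro kalg_free_alg genideal_ideal) auto
qed

lemma kalg_Oq: "kalg (Oq q)"
  unfolding Oq_def by (rule alg_quot.kalg_quot[OF alg_quot_free])

lemma qgen_closed: "qgen (q :: 'k::field) g \<in> carrier (Oq q)"
proof -
  interpret alg_quot "free_alg :: ('k::field, 'k free) module" "sl2_ideal q" by (rule alg_quot_free)
  show ?thesis unfolding qgen_def Oq_def by (rule coset_in_quot) simp
qed

lemma sl2_point_Oq: "sl2_point (Oq q) (q :: 'k::field) (qgen q Ga) (qgen q Gb) (qgen q Gc) (qgen q Gd)"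
proof -
  let ?F = "free_alg :: ('k::field, 'k free) module"
  interpret alg_quot ?F "sl2_ideal q" by (rule alg_quot_free)
  have rels: "r \<in> sl2_ideal q" if "r \<in> sl2_rels q" for r
    using genideal_self[of "sl2_rels q"] that by (auto simp: sl2_ideal_def)
  have mult: "qgen q g \<otimes>\<^bsub>Oq q\<^esub> qgen q h = sl2_ideal q +>\<^bsub>?F\<^esub> Poly_Mapping.single [g, h] 1" for g h
    unfolding qgen_def Oq_def by (subst quot_mult) (auto simp: free_alg_def)
  have smult: "s \<odot>\<^bsub>Oq q\<^esub> (sl2_ideal q +>\<^bsub>?F\<^esub> Poly_Mapping.single w 1) = sl2_ideal q +>\<^bsub>?F\<^esub> Poly_Mapping.single w s"
    for s w
    unfolding Oq_def by (subst quot_smult) (auto simp: free_alg_def monoid_alg_smult_single)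
  have one: "\<one>\<^bsub>Oq q\<^esub> = sl2_ideal q +>\<^bsub>?F\<^esub> Poly_Mapping.single [] 1"
    by (simp add: Oq_def free_alg_def)
  have add: "(sl2_ideal q +>\<^bsub>?F\<^esub> x) \<oplus>\<^bsub>Oq q\<^esub> (sl2_ideal q +>\<^bsub>?F\<^esub> y) = sl2_ideal q +>\<^bsub>?F\<^esub> (x + y)" for x y
    unfolding Oq_def quot_alg_simps by (subst quot_add) (auto simp: free_alg_def)
  have eq: "sl2_ideal q +>\<^bsub>?F\<^esub> x = sl2_ideal q +>\<^bsub>?F\<^esub> y" if "x - y \<in> sl2_ideal q" for x y
    using that by (intro coset_eqI) (auto simp: free_alg_minus)
  show ?thesis
  proof (intro sl2_point.intro sl2_point_axioms.intro kalg_Oq qgen_closed; (unfold mult smult one add)?)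
    \<comment> \<open>Among the defining relations this one is stored as \<open>bc - cb\<close>,
      opposite to the orientation chosen in the locale.\<close>
    show "sl2_ideal q +>\<^bsub>?F\<^esub> Poly_Mapping.single [Gc, Gb] 1 = sl2_ideal q +>\<^bsub>?F\<^esub> Poly_Mapping.single [Gb, Gc] 1"
      by (rule eq[symmetric], rule rels) (simp add: sl2_rels_def)
  qed (rule eq, rule rels, simp add: sl2_rels_def diff_diff_eq[symmetric] add.commute)+
qed

context sl2_point
begin

abbreviation word_val :: "(gen \<Rightarrow> 'b) \<Rightarrow> gen list \<Rightarrow> 'b" where
  "word_val h w \<equiv> foldr (\<lambda>g y. h g \<otimes> y) w \<one>"

context
  fixes h assumes h: "h = case_gen a b c d"
begin

lemma gen_val_closed: "h g \<in> carrier A"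
  using gens_closed by (cases g) (auto simp: h)

lemma word_val_closed: "word_val h w \<in> carrier A"
  by (induction w) (auto simp: gen_val_closed)

lemma word_val_append: "word_val h (u @ w) = word_val h u \<otimes> word_val h w"
proof -
  \<comment> \<open>The induction needs an arbitrary starting value of the fold, since appending a
    word replaces the unit by the value of that word.\<close>
  have *: "foldr (\<lambda>g y. h g \<otimes> y) u x = word_val h u \<otimes> x" if "x \<in> carrier A" for x
    using that by (induction u) (auto simp: gen_val_closed word_val_closed m_assoc)
  show ?thesis using *[OF word_val_closed] by simp
qed

lemma lin_ext_word_val: "lin_ext A (word_val h) \<in> alg_hom free_alg A"
  unfolding free_alg_def
  by (rule monoid.lin_ext_alg_hom[OF monoid_word kalg_axioms])
    (auto simp: word_val_closed word_val_append simp del: foldr_append)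

text \<open>The kernel is a two-sided ideal, so the seven relations are all that has to be
  checked.\<close>

lemma lin_ext_ideal:
  assumes "p \<in> sl2_ideal q" shows "lin_ext A (word_val h) p = \<zero>"
proof -
  interpret F: kalg "free_alg :: ('k, 'k free) module" by (rule kalg_free_alg)
  let ?f = "lin_ext A (word_val h)"
  have lin: "?f \<in> linmap free_alg A" using lin_ext_word_val by (simp add: alg_hom_def)
  have single: "?f (Poly_Mapping.single w s) = s \<odot> word_val h w" for w s
    by (rule lin_ext_single[where \<phi> = "word_val h", OF vspace_axioms word_val_closed])
  have diff: "?f (p - r) = ?f p \<ominus> ?f r" for p r
    using linmap_minus[OF lin F.vspace_axioms vspace_axioms, of p r] by (simp add: free_alg_minus)
  have cancel: "x \<ominus> x = \<zero>" if "x \<in> carrier A" for x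
    using that by (simp add: a_minus_def r_neg)
  \<comment> \<open>The shape taken by the last two relations once \<open>ad\<close> and
    \<open>da\<close> have been rewritten by \<open>rels\<close>.\<close>
  have cancel3: "\<one> \<oplus> x \<ominus> x \<ominus> \<one> = \<zero>" if "x \<in> carrier A" for x
    using that r_neg[of "\<one> \<oplus> x"] by (simp add: a_minus_def minus_add a_ac)
  have hg: "h Ga = a" "h Gb = b" "h Gc = c" "h Gd = d" by (simp_all add: h)
  have "r \<in> {x \<in> carrier free_alg. ?f x = \<zero>}" if "r \<in> sl2_rels q" for r
    using that gens_closed unfolding sl2_rels_def Let_def
    by (elim insertE) (simp_all add: diff single hg rels cancel cancel3)
  then have "sl2_rels q \<subseteq> {x \<in> carrier free_alg. ?f x = \<zero>}" by blast
  then have "sl2_ideal q \<subseteq> {x \<in> carrier free_alg. ?f x = \<zero>}"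
    unfolding sl2_ideal_def
    by (rule F.genideal_minimal[OF alg_hom_kernel_ideal[OF lin_ext_word_val kalg_free_alg kalg_axioms]])
  then show ?thesis using assms by auto
qed

lemma alg_map_hom': "alg_map A h \<in> alg_hom (Oq q) A"
proof -
  interpret F: alg_quot "free_alg :: ('k, 'k free) module" "sl2_ideal q" by (rule alg_quot_free)
  show ?thesis
    using F.quot_lift_hom[OF lin_ext_word_val vspace_axioms lin_ext_ideal]
    by (simp add: alg_map_def[abs_def] Oq_def)
qed

lemma alg_map_qgen': "alg_map A h (qgen q g) = h g"
proof -
  interpret F: alg_quot "free_alg :: ('k, 'k free) module" "sl2_ideal q" by (rule alg_quot_free)
  have lin: "lin_ext A (word_val h) \<in> linmap free_alg A" using lin_ext_word_val by (simp add: alg_hom_def)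
  have "alg_map A h (qgen q g) = lin_ext A (word_val h) (Poly_Mapping.single [g] 1)"
    unfolding alg_map_def qgen_def
    by (rule F.quot_lift[OF lin vspace_axioms lin_ext_ideal]) auto
  also have "\<dots> = h g"
    using lin_ext_single[where \<phi> = "word_val h" and x = "[g]" and s = 1, OF vspace_axioms word_val_closed] gen_val_closed by simp
  finally show ?thesis .
qed

end

lemmas alg_map_hom = alg_map_hom'[OF refl]
lemmas alg_map_qgen = alg_map_qgen'[OF refl]

end

section \<open>The structure maps\<close>

lemma sl2_point_base_alg:
  assumes "q \<noteq> (0 :: 'k::field)"
  shows "sl2_point base_alg q (inverse q) 0 0 q"
  using assms by (intro sl2_point.intro sl2_point_axioms.intro kalg_base_alg) auto

lemma opposite_simps [simp]:
  "carrier (opposite A) = carrier A" "x \<otimes>\<^bsub>opposite A\<^esub> y = y \<otimes>\<^bsub>A\<^esub> x" "\<one>\<^bsub>opposite A\<^esub> = \<one>\<^bsub>A\<^esub>"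
  "\<zero>\<^bsub>opposite A\<^esub> = \<zero>\<^bsub>A\<^esub>" "x \<oplus>\<^bsub>opposite A\<^esub> y = x \<oplus>\<^bsub>A\<^esub> y" "s \<odot>\<^bsub>opposite A\<^esub> x = s \<odot>\<^bsub>A\<^esub> x"
  by (simp_all add: opposite_def)

lemma linmap_opposite [simp]: "linmap V (opposite A) = linmap V A"
  by (simp add: LinearCombinations.module_hom_def)

lemma kalg_opposite:
  assumes "kalg A" shows "kalg (opposite A)"
proof -
  interpret kalg A by fact
  have "abelian_group (opposite A)"
    by (rule abelian_groupI) (auto simp: a_ac intro: l_neg)
  then have "vspace (opposite A)"
    by (rule vspaceI) (auto simp: smult_l_distr smult_r_distr smult_smult)
  then show ?thesis
    by (rule kalgI) (auto simp: m_assoc l_distr r_distr smult_mult_l smult_mult_r)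
qed

lemma (in sl2_point) sl2_point_tau:
  "sl2_point A q a ((- 1) \<odot> b) ((- 1) \<odot> c) d"
  using gens_closed rels
  by (intro sl2_point.intro sl2_point_axioms.intro kalg_axioms)
    (auto simp: smult_mult_l smult_mult_r smult_smult)

text \<open>An antihomomorphism is a homomorphism to the opposite algebra. Reversing the factors
  undoes the exchange of \<open>a\<close> and \<open>d\<close> in the two determinant relations, and
  the scalars of \<open>b\<close> and \<open>c\<close> multiply to one.\<close>

lemma sl2_point_antipode:
  fixes A :: "('k::field, 'b) module" (structure)
  assumes "sl2_point A q a b c d" "q \<noteq> 0"
  shows "sl2_point (opposite A) q d ((- inverse q) \<odot> b) ((- q) \<odot> c) a"
proof -
  interpret sl2_point A q a b c d by fact
  show ?thesis
    using gens_closed rels assms(2)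
    by (intro sl2_point.intro sl2_point_axioms.intro kalg_opposite kalg_axioms)
      (auto simp: smult_mult_l smult_mult_r smult_smult mult.commute)
qed

text \<open>The matrix product of two points is again a point when the entries of one commute with
  those of the other, as they do in the two tensor factors. For the universal point and itself this
  gives the comultiplication.\<close>

lemma sl2_point_tensor:
  assumes "sl2_point A q a b c d" "sl2_point B q a' b' c' d'" "q \<noteq> 0"
  shows "sl2_point (tensor A B) q
    (pure_tensor A B a a' \<oplus>\<^bsub>tensor A B\<^esub> pure_tensor A B b c')
    (pure_tensor A B a b' \<oplus>\<^bsub>tensor A B\<^esub> pure_tensor A B b d')
    (pure_tensor A B c a' \<oplus>\<^bsub>tensor A B\<^esub> pure_tensor A B d c')
    (pure_tensor A B c b' \<oplus>\<^bsub>tensor A B\<^esub> pure_tensor A B d d')"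
proof -
  interpret A: sl2_point A q a b c d by fact
  interpret B: sl2_point B q a' b' c' d' by fact
  interpret tensor_alg A B ..
  interpret T: kalg T by (rule kalg_tensor)
  note [simp] = A.gens_closed B.gens_closed A.rels B.rels
  note distr = T.l_distr T.r_distr pure_mult pure_add_l pure_add_r pure_smult_l pure_smult_r
    T.smult_r_distr T.smult_smult pure_one assms(3) T.a_ac
  show ?thesis
    by (intro sl2_point.intro sl2_point_axioms.intro kalg_tensor) (simp_all add: distr)
qed

text \<open>The algebra of all linear endomorphisms of the functions
  \<open>'x \<Rightarrow> 'k\<close>. Taking all functions, not only those of finite support, keeps
  the representation space free of side conditions.\<close>

definition endo_alg :: "('k::field, ('x \<Rightarrow> 'k) \<Rightarrow> ('x \<Rightarrow> 'k)) module" where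
  "endo_alg = \<lparr>carrier = {f. (\<forall>u v. f (\<lambda>x. u x + v x) = (\<lambda>x. f u x + f v x)) \<and>
       (\<forall>s u. f (\<lambda>x. s * u x) = (\<lambda>x. s * f u x))},
     mult = (\<lambda>f g u. f (g u)), one = (\<lambda>u. u), zero = (\<lambda>u x. 0), add = (\<lambda>f g u x. f u x + g u x),
     smult = (\<lambda>s f u x. s * f u x)\<rparr>"

lemma endo_alg_simps [simp]:
  "f \<in> carrier endo_alg \<longleftrightarrow> (\<forall>u v. f (\<lambda>x. u x + v x) = (\<lambda>x. f u x + f v x)) \<and>
       (\<forall>s u. f (\<lambda>x. s * u x) = (\<lambda>x. s * f u x))"
  "f \<otimes>\<^bsub>endo_alg\<^esub> g = (\<lambda>u. f (g u))" "\<one>\<^bsub>endo_alg\<^esub> = (\<lambda>u. u)" "\<zero>\<^bsub>endo_alg\<^esub> = (\<lambda>u x. 0)"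
  "f \<oplus>\<^bsub>endo_alg\<^esub> g = (\<lambda>u x. f u x + g u x)" "s \<odot>\<^bsub>endo_alg\<^esub> f = (\<lambda>u x. s * f u x)"
  by (simp_all add: endo_alg_def)

lemma kalg_endo_alg: "kalg (endo_alg :: ('k::field, ('x \<Rightarrow> 'k) \<Rightarrow> ('x \<Rightarrow> 'k)) module)"
proof -
  let ?E = "endo_alg :: ('k::field, ('x \<Rightarrow> 'k) \<Rightarrow> ('x \<Rightarrow> 'k)) module"
  have "abelian_group ?E"
  proof (rule abelian_groupI)
    fix f assume "f \<in> carrier ?E"
    then show "\<exists>g\<in>carrier ?E. g \<oplus>\<^bsub>?E\<^esub> f = \<zero>\<^bsub>?E\<^esub>"
      by (intro bexI[of _ "\<lambda>u x. - f u x"]) auto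
  qed (auto simp: algebra_simps)
  then have "vspace ?E"
    by (rule vspaceI) (auto simp: algebra_simps)
  then show ?thesis
    by (rule kalgI) (auto simp: algebra_simps)
qed

text \<open>The representation on which \<open>a\<close> acts diagonally and \<open>b\<close> as a shift separates the monomials
  \<open>a^i b^j\<close> with \<open>i + j\<close> fixed.\<close>

lemma sl2_point_shift:
  assumes "q \<noteq> (0 :: 'k::field)"
  shows "sl2_point endo_alg q (\<lambda>u m. inverse q ^ m * u m) (\<lambda>u m. u (Suc m)) (\<lambda>u m. 0)
    (\<lambda>u m. q ^ m * u m)"
  using assms
  by (intro sl2_point.intro sl2_point_axioms.intro kalg_endo_alg)
    (auto simp: fun_eq_iff algebra_simps power_inverse)

lemma alg_homD:
  assumes "f \<in> alg_hom A B"
  shows "f \<in> linmap A B" "f \<one>\<^bsub>A\<^esub> = \<one>\<^bsub>B\<^esub>"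
    "x \<in> carrier A \<Longrightarrow> y \<in> carrier A \<Longrightarrow> f (x \<otimes>\<^bsub>A\<^esub> y) = f x \<otimes>\<^bsub>B\<^esub> f y"
  using assms by (auto simp: alg_hom_def)

lemma alg_hom_pow:
  assumes "f \<in> alg_hom A B" "kalg A" "kalg B" "x \<in> carrier A"
  shows "f (x [^]\<^bsub>A\<^esub> (n::nat)) = f x [^]\<^bsub>B\<^esub> n"
proof -
  interpret A: kalg A by fact
  interpret B: kalg B by fact
  show ?thesis
    using assms(4) by (induction n) (auto simp: alg_homD[OF assms(1)])
qed

locale qsl2 =
  fixes q :: "'k::field"
  assumes q_nz: "q \<noteq> 0"
begin

abbreviation C :: "('k, 'k free set) module" where "C \<equiv> Oq q"
abbreviation CC where "CC \<equiv> tensor C C"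
abbreviation a where "a \<equiv> qgen q Ga"
abbreviation b where "b \<equiv> qgen q Gb"
abbreviation c where "c \<equiv> qgen q Gc"
abbreviation d where "d \<equiv> qgen q Gd"

sublocale sl2_point C q a b c d
  by (rule sl2_point_Oq)

sublocale CC: tensor_alg C C ..

abbreviation \<Delta> where "\<Delta> \<equiv> comult q"

abbreviation pt (infixl "\<otimes>\<^sub>t" 75) where "x \<otimes>\<^sub>t y \<equiv> pure_tensor C C x y"

lemma comult_hom: "\<Delta> \<in> alg_hom C CC"
  and comult_a: "\<Delta> a = a \<otimes>\<^sub>t a \<oplus>\<^bsub>CC\<^esub> b \<otimes>\<^sub>t c"
  and comult_b: "\<Delta> b = a \<otimes>\<^sub>t b \<oplus>\<^bsub>CC\<^esub> b \<otimes>\<^sub>t d"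
proof -
  interpret T: sl2_point CC q "a \<otimes>\<^sub>t a \<oplus>\<^bsub>CC\<^esub> b \<otimes>\<^sub>t c" "a \<otimes>\<^sub>t b \<oplus>\<^bsub>CC\<^esub> b \<otimes>\<^sub>t d"
    "c \<otimes>\<^sub>t a \<oplus>\<^bsub>CC\<^esub> d \<otimes>\<^sub>t c" "c \<otimes>\<^sub>t b \<oplus>\<^bsub>CC\<^esub> d \<otimes>\<^sub>t d"
    by (rule sl2_point_tensor[OF sl2_point_Oq sl2_point_Oq q_nz])
  show "\<Delta> \<in> alg_hom C CC" unfolding comult_def Let_def by (rule T.alg_map_hom)
  show "\<Delta> a = a \<otimes>\<^sub>t a \<oplus>\<^bsub>CC\<^esub> b \<otimes>\<^sub>t c" "\<Delta> b = a \<otimes>\<^sub>t b \<oplus>\<^bsub>CC\<^esub> b \<otimes>\<^sub>t d"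
    unfolding comult_def Let_def by (simp_all add: T.alg_map_qgen)
qed

lemma gam_hom: "gam q \<in> alg_hom C base_alg"
  and gam_gens: "gam q a = inverse q" "gam q b = 0" "gam q c = 0" "gam q d = q"
proof -
  interpret B: sl2_point base_alg q "inverse q" 0 0 q by (rule sl2_point_base_alg[OF q_nz])
  show "gam q \<in> alg_hom C base_alg" unfolding gam_def by (rule B.alg_map_hom)
  show "gam q a = inverse q" "gam q b = 0" "gam q c = 0" "gam q d = q"
    unfolding gam_def by (simp_all add: B.alg_map_qgen)
qed

definition \<theta> :: "'k free set \<Rightarrow> 'k free set" where
  "\<theta> x = antipode q (tau q x)"

lemma tau_hom: "tau q \<in> alg_hom C C"
  and tau_gens: "tau q a = a" "tau q b = (- 1) \<odot>\<^bsub>C\<^esub> b" "tau q c = (- 1) \<odot>\<^bsub>C\<^esub> c" "tau q d = d"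
proof -
  interpret B: sl2_point C q a "(- 1) \<odot>\<^bsub>C\<^esub> b" "(- 1) \<odot>\<^bsub>C\<^esub> c" d by (rule sl2_point_tau)
  show "tau q \<in> alg_hom C C" unfolding tau_def by (rule B.alg_map_hom)
  show "tau q a = a" "tau q b = (- 1) \<odot>\<^bsub>C\<^esub> b" "tau q c = (- 1) \<odot>\<^bsub>C\<^esub> c" "tau q d = d"
    unfolding tau_def by (simp_all add: B.alg_map_qgen)
qed

lemma antipode_hom: "antipode q \<in> alg_hom C (opposite C)"
  and antipode_gens: "antipode q a = d" "antipode q b = (- inverse q) \<odot>\<^bsub>C\<^esub> b"
    "antipode q c = (- q) \<odot>\<^bsub>C\<^esub> c" "antipode q d = a"
proof -
  interpret B: sl2_point "opposite C" q d "(- inverse q) \<odot>\<^bsub>C\<^esub> b" "(- q) \<odot>\<^bsub>C\<^esub> c" a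
    by (rule sl2_point_antipode[OF sl2_point_Oq q_nz])
  show "antipode q \<in> alg_hom C (opposite C)" unfolding antipode_def by (rule B.alg_map_hom)
  show "antipode q a = d" "antipode q b = (- inverse q) \<odot>\<^bsub>C\<^esub> b"
    "antipode q c = (- q) \<odot>\<^bsub>C\<^esub> c" "antipode q d = a"
    unfolding antipode_def by (simp_all add: B.alg_map_qgen)
qed

lemma theta_linmap: "\<theta> \<in> linmap C C"
  using linmap_comp[OF alg_homD(1)[OF tau_hom], of "antipode q"] alg_homD(1)[OF antipode_hom]
  by (simp add: \<theta>_def[abs_def])

lemmas theta_closed [simp] = linmap_closed[OF theta_linmap]

lemma theta_mult:
  assumes "x \<in> carrier C" "y \<in> carrier C"
  shows "\<theta> (x \<otimes>\<^bsub>C\<^esub> y) = \<theta> y \<otimes>\<^bsub>C\<^esub> \<theta> x"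
  using assms linmap_closed[OF alg_homD(1)[OF tau_hom]]
  by (simp add: \<theta>_def alg_homD(3)[OF tau_hom] alg_homD(3)[OF antipode_hom])

lemma theta_one: "\<theta> \<one>\<^bsub>C\<^esub> = \<one>\<^bsub>C\<^esub>"
  by (simp add: \<theta>_def alg_homD(2)[OF tau_hom] alg_homD(2)[OF antipode_hom])

text \<open>The sign of \<open>tau\<close> cancels that of the antipode on \<open>b\<close> and
  \<open>c\<close>. The remaining scalars accumulate to the factor \<open>q powi (i - j)\<close> in
  \<open>theta_M\<close>.\<close>

lemma theta_gens: "\<theta> a = d" "\<theta> b = inverse q \<odot>\<^bsub>C\<^esub> b" "\<theta> c = q \<odot>\<^bsub>C\<^esub> c" "\<theta> d = a"
  using gens_closed
  by (simp_all add: \<theta>_def tau_gens antipode_gens linmap_smult[OF alg_homD(1)[OF antipode_hom]] smult_smult)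

section \<open>Monomials in \<open>a\<close> and \<open>b\<close> and functionals that separate
  them\<close>

definition mono_ab :: "nat \<Rightarrow> nat \<Rightarrow> 'k free set" where
  "mono_ab i j = a [^]\<^bsub>C\<^esub> i \<otimes>\<^bsub>C\<^esub> b [^]\<^bsub>C\<^esub> j"

text \<open>A matrix coefficient of the shift representation: \<open>x\<close> acts on the delta
  function at \<open>j\<close> and the result is evaluated at \<open>0\<close>. There powers of
  \<open>a\<close> act as the identity, while \<open>b\<close> to the power \<open>k\<close> moves
  position \<open>k\<close> to \<open>0\<close>.\<close>

definition coord :: "nat \<Rightarrow> 'k free set \<Rightarrow> 'k" where
  "coord j x = alg_map endo_alg (case_gen (\<lambda>u m. inverse q ^ m * u m) (\<lambda>u m. u (Suc m)) (\<lambda>u m. 0)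
    (\<lambda>u m. q ^ m * u m)) x (\<lambda>m. if m = j then 1 else 0) 0"

lemma coord_linmap: "coord j \<in> linmap C base_alg"
proof -
  interpret B: sl2_point endo_alg q "\<lambda>u m. inverse q ^ m * u m" "\<lambda>u m. u (Suc m)" "\<lambda>u m. 0"
    "\<lambda>u m. q ^ m * u m" by (rule sl2_point_shift[OF q_nz])
  note lin = alg_homD(1)[OF B.alg_map_hom]
  show ?thesis
    by (rule linmapI) (auto simp: coord_def[abs_def] linmap_add[OF lin] linmap_smult[OF lin])
qed

lemma coord_mono_ab: "coord j (mono_ab i k) = (if j = k then 1 else 0)"
proof -
  interpret B: sl2_point endo_alg q "\<lambda>u m. inverse q ^ m * u m" "\<lambda>u m. u (Suc m)" "\<lambda>u m. 0"
    "\<lambda>u m. q ^ m * u m" by (rule sl2_point_shift[OF q_nz])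
  have a: "((\<lambda>u m. inverse q ^ m * u m) [^]\<^bsub>endo_alg\<^esub> i) u 0 = (u 0 :: 'k)" for i :: nat and u
    by (induction i arbitrary: u) auto
  have b: "((\<lambda>u m. u (Suc m)) [^]\<^bsub>endo_alg\<^esub> i) u m = (u (m + i) :: 'k)" for i :: nat and u m
    by (induction i arbitrary: u m) auto
  show ?thesis
    using gens_closed
    by (auto simp: coord_def mono_ab_def alg_homD(3)[OF B.alg_map_hom] B.alg_map_qgen a b
        alg_hom_pow[OF B.alg_map_hom kalg_axioms kalg_endo_alg])
qed

end

section \<open>Gaussian binomial coefficients\<close>

text \<open>The base is \<open>q\<^sup>-\<^sup>2\<close>; the lower index is an integer, so that no boundary cases arise.\<close>

primrec gbinom :: "'k::field \<Rightarrow> nat \<Rightarrow> int \<Rightarrow> 'k" where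
  "gbinom q 0 j = (if j = 0 then 1 else 0)"
| "gbinom q (Suc n) j = q powi (- 2 * j) * gbinom q n j + gbinom q n (j - 1)"

lemma gbinom_outside: "j < 0 \<or> int n < j \<Longrightarrow> gbinom q n j = 0"
  by (induction n arbitrary: j) auto

lemma powi_mult: "q \<noteq> 0 \<Longrightarrow> q powi i * q powi j = (q :: 'k::field) powi (i + j)"
  by (simp add: power_int_add)

lemma powi_mult_left: "q \<noteq> 0 \<Longrightarrow> q powi i * (q powi j * x) = (q :: 'k::field) powi (i + j) * x"
  by (simp add: power_int_add)

text \<open>The companion of the defining rule, with the power of \<open>q\<close> on the other
  term. Together the two rules give the symmetry and the ratio of neighbouring coefficients. The
  induction expands both sides into the same terms at \<open>j\<close>, \<open>j - 1\<close> and
  \<open>j - 2\<close>.\<close>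

lemma gbinom_pascal:
  assumes "q \<noteq> 0"
  shows "gbinom q (Suc n) j = gbinom q n j + q powi (2 * j - 2 * int n - 2) * gbinom q n (j - 1)"
proof (induction n arbitrary: j)
  case 0
  then show ?case by auto
next
  case (Suc n)
  have "gbinom q (Suc (Suc n)) j = q powi (- 2 * j) * gbinom q (Suc n) j + gbinom q (Suc n) (j - 1)"
    by simp
  also have "\<dots> = q powi (- 2 * j) * gbinom q n j + q powi (- 2 * j + (2 * j - 2 * int n - 2)) * gbinom q n (j - 1)
    + gbinom q n (j - 1) + q powi (2 * j - 2 * int n - 4) * gbinom q n (j - 2)"
    unfolding Suc.IH using assms by (simp add: algebra_simps powi_mult powi_mult_left)
  also have "\<dots> = gbinom q (Suc n) j + q powi (2 * j - 2 * int (Suc n) - 2) * gbinom q (Suc n) (j - 1)"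
    using assms by (simp add: algebra_simps powi_mult powi_mult_left)
  finally show ?case .
qed

text \<open>At the reflected index the companion rule becomes the defining rule.\<close>

lemma gbinom_sym: "q \<noteq> 0 \<Longrightarrow> gbinom q n (int n - j) = gbinom q n j"
proof (induction n arbitrary: j)
  case (Suc n)
  have "gbinom q (Suc n) (int (Suc n) - j) =
    gbinom q n (int n - (j - 1)) + q powi (2 * (int (Suc n) - j) - 2 * int n - 2) * gbinom q n (int n - j)"
    using gbinom_pascal[OF Suc.prems, of n "int (Suc n) - j"] by (simp add: algebra_simps)
  then show ?case by (simp add: Suc.IH[OF Suc.prems])
qed auto

text \<open>Equating the two Pascal rules relates the coefficients at \<open>j\<close> and
  \<open>j + 1\<close>, each multiplied by one minus a power of \<open>q\<close>. The factor at
  \<open>j\<close> is nonzero because \<open>j < n\<close>, so the coefficient at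
  \<open>j + 1\<close> cannot vanish if the one at \<open>j\<close> does not.\<close>

lemma gbinom_nonzero:
  assumes "q \<noteq> 0" and nru: "\<forall>n::nat. n > 0 \<longrightarrow> q ^ n \<noteq> 1" and "j \<le> n"
  shows "gbinom q n (int j) \<noteq> 0"
  using assms(3)
proof (induction j)
  case 0
  show ?case by (induction n) (auto simp: gbinom_outside)
next
  case (Suc j)
  have "(1 - q powi (2 * int j - 2 * int n)) * gbinom q n (int j) =
    (1 - q powi (- 2 * int (Suc j))) * gbinom q n (int (Suc j))"
    using gbinom_pascal[OF assms(1), of n "int (Suc j)"] by (simp add: algebra_simps)
  moreover have "q powi (2 * int j - 2 * int n) \<noteq> 1"
  proof
    assume "q powi (2 * int j - 2 * int n) = 1"
    then have "q powi (- (2 * int j - 2 * int n)) = 1" by (simp only: power_int_minus) simp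
    moreover have "- (2 * int j - 2 * int n) = int (2 * (n - j))" using Suc.prems by simp
    ultimately have "q ^ (2 * (n - j)) = 1" by (simp only: power_int_of_nat)
    then show False using nru Suc.prems by auto
  qed
  ultimately show ?case using Suc by auto
qed

context kalg
begin

lemma pow_commute:
  assumes "x \<in> carrier A" "y \<in> carrier A" "x \<otimes> y = q \<odot> (y \<otimes> x)" "q \<noteq> 0"
  shows "y [^] (n::nat) \<otimes> x = q powi (- int n) \<odot> (x \<otimes> y [^] n)"
proof (induction n)
  case (Suc n)
  have yx: "y \<otimes> x = inverse q \<odot> (x \<otimes> y)"
    using assms by (simp add: smult_smult)
  have "y [^] Suc n \<otimes> x = y [^] n \<otimes> (y \<otimes> x)" using assms by (simp add: m_assoc)
  also have "\<dots> = inverse q \<odot> ((y [^] n \<otimes> x) \<otimes> y)"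
    using assms by (simp add: yx smult_mult_r m_assoc)
  also have "\<dots> = (inverse q * q powi (- int n)) \<odot> (x \<otimes> y [^] Suc n)"
    using assms by (simp add: Suc smult_mult_l smult_smult m_assoc)
  also have "inverse q * q powi (- int n) = q powi (- int (Suc n))"
    using assms(4) powi_mult[of q "- 1" "- int n"] by (simp add: power_int_minus)
  finally show ?case .
qed (use assms in simp)

text \<open>The \<open>q\<close>-binomial theorem for \<open>(u x + v y)^n\<close> with \<open>u v = q v u\<close> commuting with \<open>x\<close> and \<open>y\<close>:
  \<open>R n j\<close> is the coefficient of \<open>u^(n - j) v^j\<close>.\<close>

lemma qbinomial:
  assumes "x \<in> carrier A" "y \<in> carrier A" "x \<otimes> y = q \<odot> (y \<otimes> x)" "q \<noteq> 0"
    and "\<And>j. R 0 j = (if j = 0 then \<one> else \<zero>)"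
    "\<And>n j. R (Suc n) j = q powi (- j) \<odot> (R n j \<otimes> x) \<oplus> R n (j - 1) \<otimes> y"
  shows "R n j = gbinom q n j \<odot> (x [^] nat (int n - j) \<otimes> y [^] nat j)"
proof (induction n arbitrary: j)
  case 0
  then show ?case using assms(1,2) by (simp add: assms(5))
next
  case (Suc n)
  have cl: "x [^] (i::nat) \<otimes> y [^] (m::nat) \<in> carrier A" for i m using assms by auto
  \<comment> \<open>Outside the range of \<open>j\<close> the function \<open>nat\<close> truncates
    the exponents, but there the coefficient vanishes on both sides. Inside, moving \<open>x\<close>
    to the left past \<open>j\<close> factors \<open>y\<close> costs the second power of
    \<open>q\<close>.\<close>
  have 1: "q powi (- j) \<odot> (R n j \<otimes> x) =
    (q powi (- 2 * j) * gbinom q n j) \<odot> (x [^] nat (int (Suc n) - j) \<otimes> y [^] nat j)"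
  proof (cases "0 \<le> j \<and> j \<le> int n")
    case True
    define k l where "k = nat (int n - j)" and "l = nat j"
    have kl: "nat (int n - j) = k" "nat j = l" "nat (int (Suc n) - j) = Suc k" "j = int l"
      using True by (auto simp: k_def l_def)
    have "(x [^] k \<otimes> y [^] l) \<otimes> x = q powi (- j) \<odot> (x [^] Suc k \<otimes> y [^] l)"
      using assms(1,2) pow_commute[OF assms(1-4), of l] by (simp add: kl(4) m_assoc smult_mult_r)
    then have "q powi (- j) \<odot> (R n j \<otimes> x) = (q powi (- j) * (gbinom q n j * q powi (- j))) \<odot>
      (x [^] Suc k \<otimes> y [^] l)"
      unfolding Suc.IH kl(1-3) using assms(1,2) cl by (simp only: smult_mult_l smult_smult)
    also have "q powi (- j) * (gbinom q n j * q powi (- j)) = q powi (- 2 * j) * gbinom q n j"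
      using assms(4) by (simp add: powi_mult mult.commute[of "gbinom q n j"] powi_mult_left)
    finally show ?thesis unfolding kl(1-3) .
  next
    case False
    then show ?thesis using cl assms(1,2) by (simp add: Suc.IH gbinom_outside not_le)
  qed
  have 2: "R n (j - 1) \<otimes> y = gbinom q n (j - 1) \<odot> (x [^] nat (int (Suc n) - j) \<otimes> y [^] nat j)"
  proof (cases "0 \<le> j - 1")
    case True
    define k l where "k = nat (int (Suc n) - j)" and "l = nat (j - 1)"
    have kl: "nat (int n - (j - 1)) = k" "nat (j - 1) = l" "nat (int (Suc n) - j) = k" "nat j = Suc l"
      using True by (auto simp: k_def l_def)
    show ?thesis unfolding Suc.IH kl using assms(1,2) cl by (simp add: smult_mult_l m_assoc)
  next
    case False
    then have "gbinom q n (j - 1) = 0" by (intro gbinom_outside) auto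
    then show ?thesis unfolding Suc.IH using assms(2) by (simp only: zero_smult cl l_null)
  qed
  show ?case unfolding assms(6) 1 2 gbinom.simps using cl by (simp add: smult_l_distr)
qed

end

section \<open>The matrix coefficients\<close>

context qsl2
begin

text \<open>\<open>M n i j\<close> is the coefficient of \<open>x^(n - i) y^i u^(n - j) v^j\<close> in \<open>(x a u + x b v + y c u + y d v)^n\<close>
  where \<open>x y = q y x\<close>, \<open>u v = q v u\<close> and \<open>x, y, u, v\<close> commute with everything else. The recursion splits
  off the last factor, \<open>M_left\<close> the first one.\<close>

primrec M :: "nat \<Rightarrow> int \<Rightarrow> int \<Rightarrow> 'k free set" where
  "M 0 i j = (if i = 0 \<and> j = 0 then \<one>\<^bsub>C\<^esub> else \<zero>\<^bsub>C\<^esub>)"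
| "M (Suc n) i j = q powi (- i - j) \<odot>\<^bsub>C\<^esub> (M n i j \<otimes>\<^bsub>C\<^esub> a) \<oplus>\<^bsub>C\<^esub> q powi (- j) \<odot>\<^bsub>C\<^esub> (M n (i - 1) j \<otimes>\<^bsub>C\<^esub> c)
     \<oplus>\<^bsub>C\<^esub> q powi (- i) \<odot>\<^bsub>C\<^esub> (M n i (j - 1) \<otimes>\<^bsub>C\<^esub> b) \<oplus>\<^bsub>C\<^esub> M n (i - 1) (j - 1) \<otimes>\<^bsub>C\<^esub> d"

lemma M_closed [simp, intro]: "M n i j \<in> carrier C"
  using gens_closed by (induction n arbitrary: i j) auto

lemma M_outside: "i < 0 \<or> int n < i \<Longrightarrow> M n i j = \<zero>\<^bsub>C\<^esub>"
  using gens_closed by (induction n arbitrary: i j) auto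

text \<open>Row and column of a generator in the matrix with rows \<open>a\<close>, \<open>b\<close>
  and \<open>c\<close>, \<open>d\<close>. With them the four summands of a recursion become one sum
  over generators, so that two such sums can be interchanged.\<close>

primrec row_shift :: "gen \<Rightarrow> int" where
  "row_shift Ga = 0" | "row_shift Gb = 0" | "row_shift Gc = 1" | "row_shift Gd = 1"

primrec col_shift :: "gen \<Rightarrow> int" where
  "col_shift Ga = 0" | "col_shift Gb = 1" | "col_shift Gc = 0" | "col_shift Gd = 1"

lemma finsum_gen:
  assumes "\<And>g. f g \<in> carrier C"
  shows "finsum C f UNIV = f Ga \<oplus>\<^bsub>C\<^esub> f Gc \<oplus>\<^bsub>C\<^esub> f Gb \<oplus>\<^bsub>C\<^esub> f Gd"
proof -
  have U: "UNIV = {Ga, Gb, Gc, Gd}" using gen.exhaust by auto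
  show ?thesis unfolding U using assms by (simp add: a_ac)
qed

lemma finite_gen: "finite (UNIV :: gen set)"
proof -
  have U: "UNIV = {Ga, Gb, Gc, Gd}" using gen.exhaust by auto
  show ?thesis unfolding U by simp
qed

lemma M_right_sum:
  "M (Suc n) i j = (\<Oplus>\<^bsub>C\<^esub>g\<in>UNIV. q powi (- (1 - row_shift g) * i - (1 - col_shift g) * j) \<odot>\<^bsub>C\<^esub>
     (M n (i - row_shift g) (j - col_shift g) \<otimes>\<^bsub>C\<^esub> qgen q g))"
  using gens_closed by (subst finsum_gen) (auto simp: qgen_closed)

text \<open>The exponent is the cost of moving \<open>y\<close> or \<open>v\<close> from the first
  factor past the powers of \<open>x\<close> or \<open>u\<close> contributed by the others. In the
  induction the last factor is split off by definition and the first by the hypothesis;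
  interchanging the two sums reassembles the last factor.\<close>

lemma M_left_sum:
  "M (Suc n) i j = (\<Oplus>\<^bsub>C\<^esub>g\<in>UNIV. q powi (row_shift g * (i - int n - 1) + col_shift g * (j - int n - 1)) \<odot>\<^bsub>C\<^esub>
     (qgen q g \<otimes>\<^bsub>C\<^esub> M n (i - row_shift g) (j - col_shift g)))"
proof (induction n arbitrary: i j)
  case 0
  show ?case using gens_closed
    by (subst finsum_gen) (auto simp: qgen_closed)
next
  case (Suc n)
  note [simp] = qgen_closed
  let ?r = "\<lambda>g i j. - (1 - row_shift g) * i - (1 - col_shift g) * j"
  let ?l = "\<lambda>n g i j. row_shift g * (i - int n - 1) + col_shift g * (j - int n - 1)"
  let ?s = "\<lambda>g h. q powi (?l (Suc n) g i j + ?r h (i - row_shift g) (j - col_shift g))"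
  let ?t = "\<lambda>g h. qgen q g \<otimes>\<^bsub>C\<^esub> M n (i - row_shift g - row_shift h) (j - col_shift g - col_shift h) \<otimes>\<^bsub>C\<^esub> qgen q h"
  have "q powi (?r h i j) \<odot>\<^bsub>C\<^esub> (M (Suc n) (i - row_shift h) (j - col_shift h) \<otimes>\<^bsub>C\<^esub> qgen q h) =
     (\<Oplus>\<^bsub>C\<^esub>g\<in>UNIV. ?s g h \<odot>\<^bsub>C\<^esub> ?t g h)" for h
  proof -
    have "q powi (?r h i j) \<odot>\<^bsub>C\<^esub> (M (Suc n) (i - row_shift h) (j - col_shift h) \<otimes>\<^bsub>C\<^esub> qgen q h) =
      (\<Oplus>\<^bsub>C\<^esub>g\<in>UNIV. q powi (?r h i j) \<odot>\<^bsub>C\<^esub> ((q powi (?l n g (i - row_shift h) (j - col_shift h)) \<odot>\<^bsub>C\<^esub>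
        (qgen q g \<otimes>\<^bsub>C\<^esub> M n (i - row_shift h - row_shift g) (j - col_shift h - col_shift g))) \<otimes>\<^bsub>C\<^esub> qgen q h))"
      unfolding Suc.IH by (subst finsum_ldistr) (auto simp: finite_gen intro!: finsum_smult)
    also have "\<dots> = (\<Oplus>\<^bsub>C\<^esub>g\<in>UNIV. ?s g h \<odot>\<^bsub>C\<^esub> ?t g h)"
    proof (intro finsum_cong' refl)
      fix g
      \<comment> \<open>The total power of \<open>q\<close> does not depend on which outer factor is
        split off first; the sixteen pairs of generators are checked one by one.\<close>
      have e: "?r h i j + ?l n g (i - row_shift h) (j - col_shift h) = ?l (Suc n) g i j + ?r h (i - row_shift g) (j - col_shift g)"
        by (cases g; cases h) simp_all
      have m: "i - row_shift h - row_shift g = i - row_shift g - row_shift h" "j - col_shift h - col_shift g = j - col_shift g - col_shift h" by simp_all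
      show "q powi (?r h i j) \<odot>\<^bsub>C\<^esub> ((q powi (?l n g (i - row_shift h) (j - col_shift h)) \<odot>\<^bsub>C\<^esub>
        (qgen q g \<otimes>\<^bsub>C\<^esub> M n (i - row_shift h - row_shift g) (j - col_shift h - col_shift g))) \<otimes>\<^bsub>C\<^esub> qgen q h) = ?s g h \<odot>\<^bsub>C\<^esub> ?t g h"
        unfolding m e[symmetric] powi_mult[OF q_nz, symmetric]
        by (simp only: smult_mult_l smult_smult m_closed M_closed qgen_closed)
    qed auto
    finally show ?thesis .
  qed
  then have "M (Suc (Suc n)) i j = (\<Oplus>\<^bsub>C\<^esub>h\<in>UNIV. \<Oplus>\<^bsub>C\<^esub>g\<in>UNIV. ?s g h \<odot>\<^bsub>C\<^esub> ?t g h)"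
    unfolding M_right_sum[of "Suc n"] by simp
  also have "\<dots> = (\<Oplus>\<^bsub>C\<^esub>g\<in>UNIV. \<Oplus>\<^bsub>C\<^esub>h\<in>UNIV. ?s g h \<odot>\<^bsub>C\<^esub> ?t g h)"
    by (rule finsum_finsum_swap) (auto simp: finite_gen qgen_closed)
  also have "\<dots> = (\<Oplus>\<^bsub>C\<^esub>g\<in>UNIV. q powi (?l (Suc n) g i j) \<odot>\<^bsub>C\<^esub>
     (qgen q g \<otimes>\<^bsub>C\<^esub> M (Suc n) (i - row_shift g) (j - col_shift g)))"
  proof (intro finsum_cong' refl)
    fix g
    have "q powi (?l (Suc n) g i j) \<odot>\<^bsub>C\<^esub> (qgen q g \<otimes>\<^bsub>C\<^esub> M (Suc n) (i - row_shift g) (j - col_shift g)) =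
      (\<Oplus>\<^bsub>C\<^esub>h\<in>UNIV. q powi (?l (Suc n) g i j) \<odot>\<^bsub>C\<^esub> (qgen q g \<otimes>\<^bsub>C\<^esub>
        (q powi (?r h (i - row_shift g) (j - col_shift g)) \<odot>\<^bsub>C\<^esub> (M n (i - row_shift g - row_shift h) (j - col_shift g - col_shift h) \<otimes>\<^bsub>C\<^esub> qgen q h))))"
      unfolding M_right_sum[of n] by (subst finsum_rdistr) (auto simp: finite_gen intro!: finsum_smult)
    also have "\<dots> = (\<Oplus>\<^bsub>C\<^esub>h\<in>UNIV. ?s g h \<odot>\<^bsub>C\<^esub> ?t g h)"
      unfolding powi_mult[OF q_nz, symmetric]
      by (intro finsum_cong' refl) (simp_all add: smult_mult_r smult_smult m_assoc del: of_nat_Suc)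
    finally show "(\<Oplus>\<^bsub>C\<^esub>h\<in>UNIV. ?s g h \<odot>\<^bsub>C\<^esub> ?t g h) = q powi (?l (Suc n) g i j) \<odot>\<^bsub>C\<^esub>
      (qgen q g \<otimes>\<^bsub>C\<^esub> M (Suc n) (i - row_shift g) (j - col_shift g))" by (rule sym)
  qed (auto simp del: M.simps)
  finally show ?case .
qed

lemma M_left:
  "M (Suc n) i j = a \<otimes>\<^bsub>C\<^esub> M n i j \<oplus>\<^bsub>C\<^esub> q powi (i - int n - 1) \<odot>\<^bsub>C\<^esub> (c \<otimes>\<^bsub>C\<^esub> M n (i - 1) j)
     \<oplus>\<^bsub>C\<^esub> q powi (j - int n - 1) \<odot>\<^bsub>C\<^esub> (b \<otimes>\<^bsub>C\<^esub> M n i (j - 1))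
     \<oplus>\<^bsub>C\<^esub> q powi (i - int n - 1 + (j - int n - 1)) \<odot>\<^bsub>C\<^esub> (d \<otimes>\<^bsub>C\<^esub> M n (i - 1) (j - 1))"
  unfolding M_left_sum using gens_closed by (subst finsum_gen) (auto simp: qgen_closed)

text \<open>As \<open>\<theta>\<close> reverses products, it turns the recursion at the last factor
  into \<open>M_left\<close>. The index change is the reflection in the antidiagonal, which
  exchanges the places of \<open>a\<close> and \<open>d\<close> and keeps those of \<open>b\<close>
  and \<open>c\<close>, just as \<open>\<theta>\<close> does up to scalars.\<close>

lemma theta_M: "\<theta> (M n i j) = q powi (i - j) \<odot>\<^bsub>C\<^esub> M n (int n - j) (int n - i)"
proof (induction n arbitrary: i j)
  case 0
  then show ?case using theta_one linmap_zero[OF theta_linmap vspace_axioms vspace_axioms] by auto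
next
  case (Suc n)
  have g: "\<theta> a = d" "\<theta> b = q powi (-1) \<odot>\<^bsub>C\<^esub> b" "\<theta> c = q powi 1 \<odot>\<^bsub>C\<^esub> c" "\<theta> d = a"
    using theta_gens by (simp_all add: power_int_minus)
  have "\<theta> (M (Suc n) i j) = q powi (- i - j) \<odot>\<^bsub>C\<^esub> (\<theta> a \<otimes>\<^bsub>C\<^esub> \<theta> (M n i j)) \<oplus>\<^bsub>C\<^esub>
     q powi (- j) \<odot>\<^bsub>C\<^esub> (\<theta> c \<otimes>\<^bsub>C\<^esub> \<theta> (M n (i - 1) j)) \<oplus>\<^bsub>C\<^esub>
     q powi (- i) \<odot>\<^bsub>C\<^esub> (\<theta> b \<otimes>\<^bsub>C\<^esub> \<theta> (M n i (j - 1))) \<oplus>\<^bsub>C\<^esub> \<theta> d \<otimes>\<^bsub>C\<^esub> \<theta> (M n (i - 1) (j - 1))"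
    using gens_closed by (simp add: linmap_add[OF theta_linmap] linmap_smult[OF theta_linmap] theta_mult)
  also have "\<dots> = q powi (i - j) \<odot>\<^bsub>C\<^esub> M (Suc n) (int (Suc n) - j) (int (Suc n) - i)"
  proof -
    have ix: "int (Suc n) - j - 1 = int n - j" "int (Suc n) - i - 1 = int n - i"
      "int n - (j - 1) = int (Suc n) - j" "int n - (i - 1) = int (Suc n) - i" by simp_all
    have e: "q powi (- i - j) * q powi (i - j) = q powi (i - j) * q powi (- i - j)"
      "q powi (- j) * (q powi (i - 1 - j) * q powi 1) = q powi (i - j) * q powi (- j)"
      "q powi (- i) * (q powi (i - (j - 1)) * q powi (- 1)) = q powi (i - j) * q powi (- i)"
      "i - 1 - (j - 1) = i - j"
      unfolding powi_mult[OF q_nz] by (simp_all add: algebra_simps)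
    have l: "int (Suc n) - j - int n - 1 = - j" "int (Suc n) - i - int n - 1 = - i"
      "- j + - i = - i - j" by simp_all
    show ?thesis
      unfolding Suc.IH g M_left ix l using gens_closed
      by (simp only: smult_mult_l smult_mult_r smult_r_distr smult_smult M_closed smult_closed
          m_closed a_closed e a_ac)
  qed
  finally show ?case .
qed

text \<open>Since \<open>gam q\<close> kills \<open>b\<close> and \<open>c\<close>, only the terms
  with \<open>a\<close> and \<open>d\<close> survive, and these preserve \<open>i - j\<close>. On
  the diagonal, after removal of the power of \<open>q\<close>, what remains is the recursion of
  \<open>gbinom\<close>.\<close>

lemma gam_M: "gam q (M n i j) = (if i = j then q powi (2 * j - int n) * gbinom q n j else 0)"
proof (induction n arbitrary: i j)
  case 0
  then show ?case
    using alg_homD(2)[OF gam_hom]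
      linmap_zero[OF alg_homD(1)[OF gam_hom] vspace_axioms vspace_base_alg] by auto
next
  case (Suc n)
  note lin = alg_homD(1)[OF gam_hom]
  have step: "gam q (M (Suc n) i j) = q powi (- i - j) * (gam q (M n i j) * inverse q) + gam q (M n (i - 1) (j - 1)) * q"
    using gens_closed by (simp add: linmap_add[OF lin] linmap_smult[OF lin] alg_homD(3)[OF gam_hom] gam_gens)
  have "q powi (- j - j) * (q powi (2 * j - int n) * x * inverse q) + q powi (2 * (j - 1) - int n) * y * q
    = q powi (2 * j - int (Suc n)) * (q powi (- 2 * j) * x + y)" for x y
  proof -
    have e: "q powi (- j - j) * q powi (2 * j - int n) * q powi (- 1) = q powi (2 * j - int (Suc n)) * q powi (- 2 * j)"
      "q powi (2 * (j - 1) - int n) * q powi 1 = q powi (2 * j - int (Suc n))"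
      unfolding powi_mult[OF q_nz] by (simp_all add: algebra_simps)
    have "q powi (- j - j) * (q powi (2 * j - int n) * x * inverse q) + q powi (2 * (j - 1) - int n) * y * q
      = q powi (- j - j) * q powi (2 * j - int n) * q powi (- 1) * x + q powi (2 * (j - 1) - int n) * q powi 1 * y"
      by (simp add: power_int_minus)
    then show ?thesis unfolding e by (simp add: algebra_simps)
  qed
  then show ?case unfolding step Suc.IH gbinom.simps by simp
qed

text \<open>In row zero the terms with \<open>c\<close> and \<open>d\<close> come from row
  \<open>-1\<close> and vanish, which leaves the binomial recursion for \<open>a\<close> and
  \<open>b\<close>.\<close>

lemma M_row_zero: "M n 0 j = gbinom q n j \<odot>\<^bsub>C\<^esub> mono_ab (nat (int n - j)) (nat j)"
  unfolding mono_ab_def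
  using gens_closed rels
  by (intro qbinomial[where R = "\<lambda>n. M n 0"] q_nz) (auto simp: M_outside)

section \<open>The comultiplication of the monomials in \<open>a\<close> and
  \<open>b\<close>\<close>

lemma mono_ab_closed [simp, intro]: "mono_ab i j \<in> carrier C"
  using gens_closed by (simp add: mono_ab_def)

lemma mono_ab_a: "mono_ab i j \<otimes>\<^bsub>C\<^esub> a = q powi (- int j) \<odot>\<^bsub>C\<^esub> mono_ab (Suc i) j"
  using gens_closed pow_commute[OF gens_closed(1,2) rels(1) q_nz, of j]
  by (simp add: mono_ab_def m_assoc smult_mult_r)

lemma mono_ab_b: "mono_ab i j \<otimes>\<^bsub>C\<^esub> b = mono_ab i (Suc j)"
  using gens_closed by (simp add: mono_ab_def m_assoc)

text \<open>The prospective value of the comultiplication on \<open>gbinom q n j\<close> times the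
  monomial with exponents \<open>n - j\<close> and \<open>j\<close>. The scaling by the binomial
  makes it satisfy a recursion without denominators.\<close>

definition comult_sum :: "nat \<Rightarrow> int \<Rightarrow> ('k free set \<times> 'k free set \<Rightarrow>\<^sub>0 'k) set" where
  "comult_sum n j = (\<Oplus>\<^bsub>CC\<^esub>i\<in>{..n}. mono_ab (n - i) i \<otimes>\<^sub>t M n (int i) j)"

text \<open>This is the recursion required by \<open>qbinomial\<close> for the pair
  \<open>\<Delta> a\<close>, \<open>\<Delta> b\<close>.\<close>

lemma comult_sum_Suc: "comult_sum (Suc n) j = q powi (- j) \<odot>\<^bsub>CC\<^esub> (comult_sum n j \<otimes>\<^bsub>CC\<^esub> \<Delta> a) \<oplus>\<^bsub>CC\<^esub> comult_sum n (j - 1) \<otimes>\<^bsub>CC\<^esub> \<Delta> b"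
proof -
  interpret T: kalg CC by (rule CC.kalg_tensor)
  note [simp] = gens_closed
  note pure = CC.pure_add_l CC.pure_add_r CC.pure_smult_l CC.pure_smult_r CC.pure_mult
  \<comment> \<open>In the recursion for \<open>M\<close>, \<open>f\<close> collects the terms with
    \<open>a\<close> and \<open>b\<close>, which keep the row, and \<open>g\<close> those with
    \<open>c\<close> and \<open>d\<close>, which raise it. The first vanishes at
    \<open>Suc n\<close> and the second at \<open>0\<close>, so after a shift of \<open>g\<close>
    both run over the same range.\<close>
  define f where "f i = mono_ab (Suc n - i) i \<otimes>\<^sub>t (q powi (- int i - j) \<odot>\<^bsub>C\<^esub> (M n (int i) j \<otimes>\<^bsub>C\<^esub> a)
    \<oplus>\<^bsub>C\<^esub> q powi (- int i) \<odot>\<^bsub>C\<^esub> (M n (int i) (j - 1) \<otimes>\<^bsub>C\<^esub> b))" for i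
  define g where "g i = mono_ab (Suc n - i) i \<otimes>\<^sub>t (q powi (- j) \<odot>\<^bsub>C\<^esub> (M n (int i - 1) j \<otimes>\<^bsub>C\<^esub> c)
    \<oplus>\<^bsub>C\<^esub> M n (int i - 1) (j - 1) \<otimes>\<^bsub>C\<^esub> d)" for i
  define h where "h i j = mono_ab (n - i) i \<otimes>\<^sub>t M n (int i) j" for i j
  have [simp]: "f i \<in> carrier CC" "g i \<in> carrier CC" "h i j \<in> carrier CC" for i j
    by (auto simp: f_def g_def h_def)
  have pure0: "x \<otimes>\<^sub>t \<zero>\<^bsub>C\<^esub> = \<zero>\<^bsub>CC\<^esub>" if "x \<in> carrier C" for x
    using linmap_zero[OF bilinD1[OF CC.bilin_pure that] vspace_axioms CC.vspace_tensor] .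
  have f0: "f (Suc n) = \<zero>\<^bsub>CC\<^esub>" by (simp add: f_def M_outside pure0)
  have g0: "g 0 = \<zero>\<^bsub>CC\<^esub>" by (simp add: g_def M_outside pure0)
  have "comult_sum (Suc n) j = (\<Oplus>\<^bsub>CC\<^esub>i\<in>{..Suc n}. f i \<oplus>\<^bsub>CC\<^esub> g i)"
    unfolding comult_sum_def
    by (intro T.finsum_cong') (auto simp: f_def g_def CC.pure_add_r[symmetric] a_ac simp del: of_nat_Suc)
  also have "\<dots> = (\<Oplus>\<^bsub>CC\<^esub>i\<in>{..Suc n}. f i) \<oplus>\<^bsub>CC\<^esub> (\<Oplus>\<^bsub>CC\<^esub>i\<in>{..Suc n}. g i)"
    by (rule T.finsum_addf) auto
  also have "(\<Oplus>\<^bsub>CC\<^esub>i\<in>{..Suc n}. f i) = (\<Oplus>\<^bsub>CC\<^esub>i\<in>{..n}. f i)"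
    by (subst T.finsum_Suc) (auto simp: f0)
  also have "(\<Oplus>\<^bsub>CC\<^esub>i\<in>{..Suc n}. g i) = (\<Oplus>\<^bsub>CC\<^esub>i\<in>{..n}. g (Suc i))"
    by (subst T.finsum_Suc2) (auto simp: g0)
  also have "(\<Oplus>\<^bsub>CC\<^esub>i\<in>{..n}. f i) \<oplus>\<^bsub>CC\<^esub> (\<Oplus>\<^bsub>CC\<^esub>i\<in>{..n}. g (Suc i)) = (\<Oplus>\<^bsub>CC\<^esub>i\<in>{..n}. f i \<oplus>\<^bsub>CC\<^esub> g (Suc i))"
    by (rule T.finsum_addf[symmetric]) auto
  also have "\<dots> = (\<Oplus>\<^bsub>CC\<^esub>i\<in>{..n}. q powi (- j) \<odot>\<^bsub>CC\<^esub> (h i j \<otimes>\<^bsub>CC\<^esub> \<Delta> a) \<oplus>\<^bsub>CC\<^esub> h i (j - 1) \<otimes>\<^bsub>CC\<^esub> \<Delta> b)"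
  proof (intro T.finsum_cong' refl)
    fix i assume "i \<in> {..n}"
    have e: "- int i - j = - j - int i" by simp
    from \<open>i \<in> {..n}\<close> have "Suc n - i = Suc (n - i)" by auto
    then show "f i \<oplus>\<^bsub>CC\<^esub> g (Suc i) = q powi (- j) \<odot>\<^bsub>CC\<^esub> (h i j \<otimes>\<^bsub>CC\<^esub> \<Delta> a) \<oplus>\<^bsub>CC\<^esub> h i (j - 1) \<otimes>\<^bsub>CC\<^esub> \<Delta> b"
      by (simp add: f_def g_def h_def comult_a comult_b T.r_distr pure mono_ab_a mono_ab_b
        T.smult_r_distr T.smult_smult powi_mult[OF q_nz] T.a_ac e)
  qed (auto simp: comult_a comult_b)
  also have "\<dots> = (\<Oplus>\<^bsub>CC\<^esub>i\<in>{..n}. q powi (- j) \<odot>\<^bsub>CC\<^esub> (h i j \<otimes>\<^bsub>CC\<^esub> \<Delta> a)) \<oplus>\<^bsub>CC\<^esub>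
      (\<Oplus>\<^bsub>CC\<^esub>i\<in>{..n}. h i (j - 1) \<otimes>\<^bsub>CC\<^esub> \<Delta> b)"
    by (rule T.finsum_addf) (auto simp: comult_a comult_b)
  also have "\<dots> = q powi (- j) \<odot>\<^bsub>CC\<^esub> (comult_sum n j \<otimes>\<^bsub>CC\<^esub> \<Delta> a) \<oplus>\<^bsub>CC\<^esub> comult_sum n (j - 1) \<otimes>\<^bsub>CC\<^esub> \<Delta> b"
  proof -
    have cl: "\<Delta> a \<in> carrier CC" "\<Delta> b \<in> carrier CC" by (auto simp: comult_a comult_b)
    have hcl: "(\<lambda>i. h i j) \<in> {..n} \<rightarrow> carrier CC" for j by auto
    have hcl2: "(\<lambda>i. h i j \<otimes>\<^bsub>CC\<^esub> x) \<in> {..n} \<rightarrow> carrier CC" if "x \<in> carrier CC" for j x using that by auto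
    show ?thesis
      unfolding comult_sum_def h_def[symmetric] T.finsum_ldistr[OF finite_atMost cl(1) hcl]
        T.finsum_ldistr[OF finite_atMost cl(2) hcl] T.finsum_smult[OF hcl2[OF cl(1)]] ..
  qed
  finally show ?thesis .
qed

text \<open>The elements \<open>\<Delta> a\<close> and \<open>\<Delta> b\<close> satisfy the same
  commutation rule as \<open>a\<close> and \<open>b\<close>, because the comultiplication is an
  algebra map. The binomial theorem therefore applies in the tensor square.\<close>

lemma comult_mono_ab:
  assumes "j \<le> n"
  shows "gbinom q n (int j) \<odot>\<^bsub>CC\<^esub> \<Delta> (mono_ab (n - j) j) = comult_sum n (int j)"
proof -
  interpret T: kalg CC by (rule CC.kalg_tensor)
  note [simp] = gens_closed
  have cl: "\<Delta> a \<in> carrier CC" "\<Delta> b \<in> carrier CC" by (auto simp: comult_a comult_b)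
  have comm: "\<Delta> a \<otimes>\<^bsub>CC\<^esub> \<Delta> b = q \<odot>\<^bsub>CC\<^esub> (\<Delta> b \<otimes>\<^bsub>CC\<^esub> \<Delta> a)"
    by (simp add: rels linmap_smult[OF alg_homD(1)[OF comult_hom]] flip: alg_homD(3)[OF comult_hom])
  have "comult_sum 0 j = (if j = 0 then \<one>\<^bsub>CC\<^esub> else \<zero>\<^bsub>CC\<^esub>)" for j
    using linmap_zero[OF bilinD1[OF CC.bilin_pure one_closed] vspace_axioms CC.vspace_tensor]
    by (auto simp: comult_sum_def mono_ab_def CC.pure_one)
  then have "comult_sum n (int j) = gbinom q n (int j) \<odot>\<^bsub>CC\<^esub>
    (\<Delta> a [^]\<^bsub>CC\<^esub> nat (int n - int j) \<otimes>\<^bsub>CC\<^esub> \<Delta> b [^]\<^bsub>CC\<^esub> nat (int j))"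
    by (intro T.qbinomial[OF cl comm q_nz] comult_sum_Suc)
  also have "\<Delta> a [^]\<^bsub>CC\<^esub> nat (int n - int j) \<otimes>\<^bsub>CC\<^esub> \<Delta> b [^]\<^bsub>CC\<^esub> nat (int j) = \<Delta> (mono_ab (n - j) j)"
    using assms
    by (simp add: mono_ab_def alg_homD(3)[OF comult_hom] alg_hom_pow[OF comult_hom kalg_axioms CC.kalg_tensor]
      nat_diff_distrib)
  finally show ?thesis by simp
qed

end

section \<open>Homomorphism spaces and traces\<close>

lemma hom_space_simps [simp]:
  "carrier (hom_space V W) = linmap V W \<inter> extensional (carrier V)"
  "\<zero>\<^bsub>hom_space V W\<^esub> = (\<lambda>v\<in>carrier V. \<zero>\<^bsub>W\<^esub>)"
  "f \<oplus>\<^bsub>hom_space V W\<^esub> g = (\<lambda>v\<in>carrier V. f v \<oplus>\<^bsub>W\<^esub> g v)"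
  "s \<odot>\<^bsub>hom_space V W\<^esub> f = (\<lambda>v\<in>carrier V. s \<odot>\<^bsub>W\<^esub> f v)"
  by (simp_all add: hom_space_def)

lemma restrict_linmap:
  assumes "vspace V" shows "restrict f (carrier V) \<in> linmap V W \<longleftrightarrow> f \<in> linmap V W"
proof
  assume "f \<in> linmap V W"
  then show "restrict f (carrier V) \<in> linmap V W"
    by (rule linmap_cong[OF _ assms]) simp
next
  assume "restrict f (carrier V) \<in> linmap V W"
  then show "f \<in> linmap V W" by (rule linmap_cong[OF _ assms]) simp
qed

lemma linmap_smult_vector:
  assumes "f \<in> linmap V base_alg" "vspace W" "w \<in> carrier W"
  shows "(\<lambda>v. f v \<odot>\<^bsub>W\<^esub> w) \<in> linmap V W"
  using bilinD2[OF bilin_smult[OF assms(1,2)] assms(3)] .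

lemma vspace_hom_space:
  assumes "vspace V" "vspace W"
  shows "vspace (hom_space V W)"
proof -
  interpret V: vspace V by fact
  interpret W: vspace W by fact
  note add = linmap_pointwise_add[OF _ _ assms(2)]
  note smult = linmap_pointwise_smult[OF _ assms(2)]
  have ab: "abelian_group (hom_space V W)"
  proof (rule abelian_groupI)
    fix f assume "f \<in> carrier (hom_space V W)"
    then have f: "f \<in> linmap V W" "f \<in> extensional (carrier V)" by auto
    show "\<exists>g\<in>carrier (hom_space V W). g \<oplus>\<^bsub>hom_space V W\<^esub> f = \<zero>\<^bsub>hom_space V W\<^esub>"
    proof (rule bexI)
      show "(\<lambda>v\<in>carrier V. (- 1) \<odot>\<^bsub>W\<^esub> f v) \<in> carrier (hom_space V W)"
        using f by (simp add: restrict_linmap[OF assms(1)] smult)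
      show "(\<lambda>v\<in>carrier V. (- 1) \<odot>\<^bsub>W\<^esub> f v) \<oplus>\<^bsub>hom_space V W\<^esub> f = \<zero>\<^bsub>hom_space V W\<^esub>"
        using linmap_closed[OF f(1)] by (auto simp: W.minus_one_smult W.l_neg intro!: restrict_ext)
    qed
    show "\<zero>\<^bsub>hom_space V W\<^esub> \<oplus>\<^bsub>hom_space V W\<^esub> f = f"
      using linmap_closed[OF f(1)] f(2) by (auto intro!: extensionalityI[of _ "carrier V"])
  next
    fix f g h
    assume "f \<in> carrier (hom_space V W)" "g \<in> carrier (hom_space V W)" "h \<in> carrier (hom_space V W)"
    then have lin: "f \<in> linmap V W" "g \<in> linmap V W" "h \<in> linmap V W" by auto
    note cl = lin[THEN linmap_closed]
    show "f \<oplus>\<^bsub>hom_space V W\<^esub> g \<in> carrier (hom_space V W)"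
      by (simp add: restrict_linmap[OF assms(1)] add lin)
    show "f \<oplus>\<^bsub>hom_space V W\<^esub> g \<oplus>\<^bsub>hom_space V W\<^esub> h = f \<oplus>\<^bsub>hom_space V W\<^esub> (g \<oplus>\<^bsub>hom_space V W\<^esub> h)"
      unfolding hom_space_simps by (rule restrict_ext) (simp add: cl W.a_assoc)
    show "f \<oplus>\<^bsub>hom_space V W\<^esub> g = g \<oplus>\<^bsub>hom_space V W\<^esub> f"
      unfolding hom_space_simps by (rule restrict_ext) (simp add: cl W.a_comm)
  qed (simp add: restrict_linmap[OF assms(1)] const_zero_linmap[OF assms(2)])
  show ?thesis
  proof (rule vspaceI[OF ab])
    fix f g s t assume "f \<in> carrier (hom_space V W)" "g \<in> carrier (hom_space V W)"
    then have lin: "f \<in> linmap V W" "g \<in> linmap V W" by auto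
    note cl = lin[THEN linmap_closed]
    show "s \<odot>\<^bsub>hom_space V W\<^esub> f \<in> carrier (hom_space V W)"
      by (simp add: restrict_linmap[OF assms(1)] smult lin)
    show "(s + t) \<odot>\<^bsub>hom_space V W\<^esub> f = s \<odot>\<^bsub>hom_space V W\<^esub> f \<oplus>\<^bsub>hom_space V W\<^esub> t \<odot>\<^bsub>hom_space V W\<^esub> f"
      unfolding hom_space_simps by (rule restrict_ext) (simp add: cl W.smult_l_distr)
    show "s \<odot>\<^bsub>hom_space V W\<^esub> (f \<oplus>\<^bsub>hom_space V W\<^esub> g) =
      s \<odot>\<^bsub>hom_space V W\<^esub> f \<oplus>\<^bsub>hom_space V W\<^esub> s \<odot>\<^bsub>hom_space V W\<^esub> g"
      unfolding hom_space_simps by (rule restrict_ext) (simp add: cl W.smult_r_distr)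
    show "(s * t) \<odot>\<^bsub>hom_space V W\<^esub> f = s \<odot>\<^bsub>hom_space V W\<^esub> (t \<odot>\<^bsub>hom_space V W\<^esub> f)"
      unfolding hom_space_simps by (rule restrict_ext) (simp add: cl W.smult_smult)
  next
    fix f assume "f \<in> carrier (hom_space V W)"
    then have f: "f \<in> linmap V W" "f \<in> extensional (carrier V)" by auto
    show "1 \<odot>\<^bsub>hom_space V W\<^esub> f = f"
      unfolding hom_space_simps using linmap_closed[OF f(1)] f(2)
      by (intro extensionalityI[of _ "carrier V"]) auto
  qed
qed

lemma eval_linmap:
  assumes "v \<in> carrier V" shows "(\<lambda>f. f v) \<in> linmap (hom_space V W) W"
  using assms by (intro linmapI) (auto intro: linmap_closed)

text \<open>The basis chosen in \<open>lin_trace\<close> is unspecified. The basis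
  \<open>{f0}\<close> shows that the dimension is one, so the chosen basis is some singleton
  \<open>{b}\<close> with \<open>b\<close> nonzero, and the coordinate of \<open>F b = b\<close> is
  1.\<close>

lemma lin_trace_one_dim:
  fixes H :: "('k::field, 'v, 'm) module_scheme"
  assumes "vspace H" "f0 \<in> carrier H" "f0 \<noteq> \<zero>\<^bsub>H\<^esub>"
    "\<And>f. f \<in> carrier H \<Longrightarrow> \<exists>s. f = s \<odot>\<^bsub>H\<^esub> f0"
    "\<And>f. f \<in> carrier H \<Longrightarrow> F f = f"
  shows "lin_trace H F = 1"
proof -
  interpret H: vspace H by fact
  interpret K: vectorspace "class_ring :: 'k ring" H
    by (intro vectorspace.intro H.is_module class_field)
  have lincomb: "K.lincomb c {b} = c b \<odot>\<^bsub>H\<^esub> b" if "b \<in> carrier H" for b c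
    using that by (simp add: K.lincomb_def)
  have basis0: "K.basis {f0}"
    unfolding K.basis_def
  proof (intro conjI)
    show "K.lin_indpt {f0}"
    proof (rule K.finite_lin_indpt2)
      fix c :: "'v \<Rightarrow> 'k" assume "K.lincomb c {f0} = \<zero>\<^bsub>H\<^esub>"
      then have "c f0 \<odot>\<^bsub>H\<^esub> f0 = 0 \<odot>\<^bsub>H\<^esub> f0" using assms(2) by (simp add: lincomb)
      then show "\<forall>v\<in>{f0}. c v = \<zero>\<^bsub>class_ring\<^esub>"
        using H.smult_eq_cancel_right[of "c f0" f0 0] assms(2,3) by simp
    qed (use assms(2) in auto)
    have "carrier H \<subseteq> K.span {f0}"
    proof
      fix f assume "f \<in> carrier H"
      then obtain s where "f = s \<odot>\<^bsub>H\<^esub> f0" using assms(4) by blast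
      then have "f = K.lincomb (\<lambda>_. s) {f0}" using assms(2) by (simp add: lincomb)
      then show "f \<in> K.span {f0}" unfolding K.span_def by (auto intro!: exI[of _ "{f0}"] exI[of _ "\<lambda>_. s"])
    qed
    then show "K.span {f0} = carrier H"
      using K.span_is_subset2[of "{f0}"] assms(2) by auto
  qed (use assms(2) in auto)
  define B where "B = (SOME B. finite B \<and> K.basis B)"
  have "finite {f0} \<and> K.basis {f0}" using basis0 by simp
  then have B: "finite B" "K.basis B"
    unfolding B_def by (metis (mono_tags, lifting) someI_ex)+
  have "card B = 1" using K.dim_basis[OF B] K.dim_basis[OF _ basis0] by simp
  then obtain b where b: "B = {b}" by (auto simp: card_1_singleton_iff)
  have bH: "b \<in> carrier H" using B(2) by (simp add: b K.basis_def)
  have "b \<noteq> \<zero>\<^bsub>H\<^esub>"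
  proof -
    have "UNIV \<noteq> {0::'k}" by (metis UNIV_I singletonD zero_neq_one)
    then show ?thesis using B(2) K.zero_nin_lin_indpt[of B] by (auto simp: b K.basis_def)
  qed
  have uniq: "c b = 1" if "K.lincomb c {b} = F b" for c
    using that H.smult_eq_cancel_right[of "c b" b 1] bH \<open>b \<noteq> \<zero>\<^bsub>H\<^esub>\<close> assms(5)[OF bH] by (simp add: lincomb)
  have "(THE c. c \<in> {b} \<rightarrow>\<^sub>E UNIV \<and> K.lincomb c {b} = F b) = (\<lambda>x\<in>{b}. 1)"
  proof (rule the_equality)
    show "(\<lambda>x\<in>{b}. 1) \<in> {b} \<rightarrow>\<^sub>E UNIV \<and> K.lincomb (\<lambda>x\<in>{b}. 1) {b} = F b"
      using bH assms(5)[OF bH] by (simp add: lincomb)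
    show "c = (\<lambda>x\<in>{b}. 1)" if "c \<in> {b} \<rightarrow>\<^sub>E UNIV \<and> K.lincomb c {b} = F b" for c
      using that uniq[of c] by (auto simp: PiE_def intro!: extensionalityI[of _ "{b}"])
  qed
  then show ?thesis
    unfolding lin_trace_def Let_def B_def[symmetric] b by simp
qed

section \<open>Comodules with a basis\<close>

text \<open>Adding a coaction field produces a different record, although the tensor product reads
  only these five fields. The multiplication and the unit enter through the direct product that
  indexes the free space.\<close>

lemma tensor_cong:
  assumes "carrier V = carrier V'" "mult V = mult V'" "one V = one V'" "add V = add V'" "smult V = smult V'"
  shows "tensor V C = tensor V' C" "pure_tensor V C = pure_tensor V' C"
proof -
  have D: "V \<times>\<times> C = V' \<times>\<times> C" using assms by (simp add: DirProd_def)
  have N: "tensor_null V C = tensor_null V' C"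
    by (simp only: tensor_null_def D bilin_rels_def assms)
  show "tensor V C = tensor V' C" by (simp add: tensor_def D N)
  show "pure_tensor V C = pure_tensor V' C" by (intro ext) (simp add: pure_tensor_def D N)
qed

text \<open>A comodule with a chosen basis and matrix coefficients \<open>t i j\<close>. Here the
  definition of the indicator is turned into matrix identities, away from the concrete
  algebra.\<close>

locale based_comodule = frame_tensor V C n e \<phi>
  for V :: "('k::field, 'v, 'c) comodule" and C :: "('k, 'c) module" and n e \<phi> +
  fixes t :: "nat \<Rightarrow> nat \<Rightarrow> 'c" and S \<tau> :: "'c \<Rightarrow> 'c" and \<gamma> :: "'c \<Rightarrow> 'k"
  assumes coact_linmap: "coact V \<in> linmap V (tensor V C)"
    and t_closed: "i \<le> n \<Longrightarrow> j \<le> n \<Longrightarrow> t i j \<in> carrier C"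
    and coact_e: "j \<le> n \<Longrightarrow> coact V (e j) = (\<Oplus>\<^bsub>tensor V C\<^esub>i\<in>{..n}. pure_tensor V C (e i) (t i j))"
    and S_tau_linmap: "(\<lambda>c. S (\<tau> c)) \<in> linmap C C"
    and gamma_linmap: "\<gamma> \<in> linmap C base_alg"
begin

section \<open>The dual basis and the coaction of the twisted dual\<close>

abbreviation U where "U \<equiv> sharp C S \<tau> V"
abbreviation Vd where "Vd \<equiv> dual_space V"

lemma vspace_dual: "vspace Vd"
  unfolding dual_space_def by (rule vspace_hom_space[OF V.vspace_axioms vspace_base_alg])

lemma dualD:
  assumes "g \<in> carrier Vd" shows "g \<in> linmap V base_alg" "g \<in> extensional (carrier V)"
  using assms by (auto simp: dual_space_def)

lemma linmap_base_expand:
  assumes "g \<in> linmap V base_alg" "v \<in> carrier V" shows "g v = (\<Sum>i\<le>n. g (e i) * \<phi> i v)"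
proof -
  have "(\<lambda>v. \<Sum>i\<le>n. g (e i) * \<phi> i v) \<in> linmap V base_alg"
    using linmap_pointwise_sum[OF linmap_pointwise_smult[OF coord_linmap vspace_base_alg] vspace_base_alg, of "{..n}"]
    by simp
  then show ?thesis
    by (rule linmap_eq[OF assms(1) _ vspace_base_alg _ assms(2)])
      (simp add: coord_e if_distrib cong: if_cong)
qed

definition dual_e :: "nat \<Rightarrow> 'v \<Rightarrow> 'k" where "dual_e i = restrict (\<phi> i) (carrier V)"

lemma frame_dual: "frame Vd n dual_e (\<lambda>i g. g (e i))"
proof (rule frame.intro[OF vspace_dual], unfold_locales)
  interpret D: vspace Vd by (rule vspace_dual)
  show ed: "dual_e i \<in> carrier Vd" if "i \<le> n" for i
    using that by (simp add: dual_space_def dual_e_def restrict_linmap[OF V.vspace_axioms] coord_linmap)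
  have ev: "(\<lambda>g. g v) \<in> linmap Vd base_alg" if "v \<in> carrier V" for v
    unfolding dual_space_def using that by (rule eval_linmap)
  show "(\<lambda>g. g (e i)) \<in> linmap Vd base_alg" if "i \<le> n" for i
    by (rule ev) (rule e_closed[OF that])
  show "dual_e j (e i) = (if i = j then 1 else 0)" if "i \<le> n" "j \<le> n" for i j
    using that by (auto simp: dual_e_def e_closed coord_e)
  show "g = (\<Oplus>\<^bsub>Vd\<^esub>i\<in>{..n}. g (e i) \<odot>\<^bsub>Vd\<^esub> dual_e i)" if g: "g \<in> carrier Vd" for g
  proof (rule extensionalityI[of _ "carrier V"])
    have sm: "(\<lambda>i. g (e i) \<odot>\<^bsub>Vd\<^esub> dual_e i) \<in> {..n} \<rightarrow> carrier Vd" using ed by auto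
    show "g \<in> extensional (carrier V)" by (rule dualD[OF g])
    show "(\<Oplus>\<^bsub>Vd\<^esub>i\<in>{..n}. g (e i) \<odot>\<^bsub>Vd\<^esub> dual_e i) \<in> extensional (carrier V)"
      by (rule dualD(2)[OF D.finsum_closed[OF sm]])
    fix v assume v: "v \<in> carrier V"
    have "(\<Oplus>\<^bsub>Vd\<^esub>i\<in>{..n}. g (e i) \<odot>\<^bsub>Vd\<^esub> dual_e i) v = (\<Sum>i\<le>n. (g (e i) \<odot>\<^bsub>Vd\<^esub> dual_e i) v)"
      using linmap_finsum[OF ev[OF v] vspace_dual vspace_base_alg sm] by simp
    also have "\<dots> = g v"
      using v linmap_base_expand[OF dualD(1)[OF g] v] by (simp add: dual_space_def dual_e_def)
    finally show "g v = (\<Oplus>\<^bsub>Vd\<^esub>i\<in>{..n}. g (e i) \<odot>\<^bsub>Vd\<^esub> dual_e i) v" by simp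
  qed
qed

sublocale D: frame_tensor Vd C n dual_e "\<lambda>i g. g (e i)"
  by (intro frame_tensor.intro frame_dual tensor_product.intro vspace_dual W.vspace_axioms)

lemma sharp_simps [simp]:
  "carrier U = carrier Vd" "mult U = mult Vd" "one U = one Vd" "zero U = zero Vd" "add U = add Vd" "smult U = smult Vd"
  by (simp_all add: sharp_def module.defs)

lemma tensor_sharp: "tensor U C = tensor Vd C" "pure_tensor U C = pure_tensor Vd C"
  by (rule tensor_cong; simp)+

lemma linmap_sharp: "linmap X U = linmap X Vd" "linmap U Y = linmap Vd Y"
  by (simp_all add: LinearCombinations.module_hom_def)

lemma lift_coact_e:
  fixes N :: "('k, 'd, 'o) module_scheme"
  assumes "bilin V C N \<beta>" "vspace N" "j \<le> n"
  shows "tensor_lift N \<beta> (coact V (e j)) = (\<Oplus>\<^bsub>N\<^esub>i\<in>{..n}. \<beta> (e i) (t i j))"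
proof -
  interpret N: vspace N by fact
  have "tensor_lift N \<beta> (coact V (e j)) = (\<Oplus>\<^bsub>N\<^esub>i\<in>{..n}. tensor_lift N \<beta> (pure_tensor V C (e i) (t i j)))"
    unfolding coact_e[OF assms(3)] using assms(3) e_closed t_closed
    by (intro linmap_finsum[OF tensor_lift_linmap[OF assms(1,2)] vspace_tensor assms(2)]) auto
  also have "\<dots> = (\<Oplus>\<^bsub>N\<^esub>i\<in>{..n}. \<beta> (e i) (t i j))"
    using assms(3) e_closed t_closed linmap_closed[OF bilinD1[OF assms(1)]]
    by (intro N.finsum_cong') (auto simp: tensor_lift_pure[OF assms(1,2)])
  finally show ?thesis .
qed

lemma lift_coact_linmap:
  assumes "bilin V C N \<beta>" "vspace N"
  shows "(\<lambda>v. tensor_lift N \<beta> (coact V v)) \<in> linmap V N"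
  by (rule linmap_comp[OF coact_linmap tensor_lift_linmap[OF assms]])

text \<open>The right-hand side of the equation that characterises the coaction of \<open>g\<close>,
  taken at \<open>v = e j\<close>; hence the coefficient at the dual basis vector
  \<open>dual_e j\<close>.\<close>

definition sharp_coeff :: "('v \<Rightarrow> 'k) \<Rightarrow> nat \<Rightarrow> 'c" where
  "sharp_coeff g j = (\<Oplus>\<^bsub>C\<^esub>k\<in>{..n}. g (e k) \<odot>\<^bsub>C\<^esub> S (\<tau> (t k j)))"

lemma S_tau_t_closed: "i \<le> n \<Longrightarrow> j \<le> n \<Longrightarrow> S (\<tau> (t i j)) \<in> carrier C"
  using linmap_closed[OF S_tau_linmap t_closed] by simp

lemma sharp_coeff_closed: "j \<le> n \<Longrightarrow> sharp_coeff g j \<in> carrier C"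
  unfolding sharp_coeff_def using S_tau_t_closed by (intro W.finsum_closed) auto

text \<open>The explicit sum satisfies the characterising equation because both sides are linear in
  \<open>v\<close> and agree on the basis. Any other solution has the same coordinates.\<close>

lemma coact_sharp:
  assumes g: "g \<in> carrier Vd"
  shows "coact U g = (\<Oplus>\<^bsub>tensor Vd C\<^esub>j\<in>{..n}. pure_tensor Vd C (dual_e j) (sharp_coeff g j))" (is "_ = ?t")
proof -
  have bs: "bilin V C C (\<lambda>x c. g x \<odot>\<^bsub>C\<^esub> S (\<tau> c))"
    using bilin_smult[OF dualD(1)[OF g] W.vspace_axioms] linmap_comp[OF S_tau_linmap] linmap_closed[OF S_tau_linmap]
    unfolding bilin_def by blast
  have be: "bilin Vd C C (\<lambda>h c. h v \<odot>\<^bsub>C\<^esub> c)" if "v \<in> carrier V" for v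
    unfolding dual_space_def by (rule bilin_smult[OF eval_linmap[OF that] W.vspace_axioms])
  have rhs: "tensor_lift C (\<lambda>x c. g x \<odot>\<^bsub>C\<^esub> S (\<tau> c)) (coact V (e j)) = sharp_coeff g j" if "j \<le> n" for j
    unfolding sharp_coeff_def by (rule lift_coact_e[OF bs W.vspace_axioms that])
  have "coact U g = (THE t. t \<in> carrier (tensor Vd C) \<and>
       (\<forall>v\<in>carrier V. tensor_lift C (\<lambda>h c. h v \<odot>\<^bsub>C\<^esub> c) t
                    = tensor_lift C (\<lambda>x c. g x \<odot>\<^bsub>C\<^esub> S (\<tau> c)) (coact V v)))"
    by (simp add: sharp_def module.defs comodule.defs)
  also have "\<dots> = ?t"
  proof (rule the_equality, intro conjI ballI)
    show tc: "?t \<in> carrier (tensor Vd C)" by (rule D.tensor_sum_closed[OF sharp_coeff_closed])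
    fix v assume v: "v \<in> carrier V"
    have "tensor_lift C (\<lambda>h c. h v \<odot>\<^bsub>C\<^esub> c) ?t =
      (\<Oplus>\<^bsub>C\<^esub>j\<in>{..n}. tensor_lift C (\<lambda>h c. h v \<odot>\<^bsub>C\<^esub> c) (pure_tensor Vd C (dual_e j) (sharp_coeff g j)))"
      using sharp_coeff_closed D.e_closed
      by (intro linmap_finsum[OF D.tensor_lift_linmap[OF be[OF v] W.vspace_axioms] D.vspace_tensor W.vspace_axioms]) auto
    also have "\<dots> = (\<Oplus>\<^bsub>C\<^esub>j\<in>{..n}. \<phi> j v \<odot>\<^bsub>C\<^esub> sharp_coeff g j)"
      using sharp_coeff_closed D.e_closed v
      by (intro W.finsum_cong') (auto simp: D.tensor_lift_pure[OF be[OF v] W.vspace_axioms] dual_e_def)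
    also have "\<dots> = tensor_lift C (\<lambda>x c. g x \<odot>\<^bsub>C\<^esub> S (\<tau> c)) (coact V v)"
    proof (rule linmap_eq[OF _ lift_coact_linmap[OF bs W.vspace_axioms] W.vspace_axioms _ v])
      show "(\<lambda>v. \<Oplus>\<^bsub>C\<^esub>j\<in>{..n}. \<phi> j v \<odot>\<^bsub>C\<^esub> sharp_coeff g j) \<in> linmap V C"
        using sharp_coeff_closed coord_linmap
        by (intro linmap_pointwise_sum[OF linmap_smult_vector] W.vspace_axioms) auto
      fix i assume i: "i \<le> n"
      have "(\<Oplus>\<^bsub>C\<^esub>j\<in>{..n}. \<phi> j (e i) \<odot>\<^bsub>C\<^esub> sharp_coeff g j) = (\<Oplus>\<^bsub>C\<^esub>j\<in>{..n}. if i = j then sharp_coeff g j else \<zero>\<^bsub>C\<^esub>)"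
        using i sharp_coeff_closed by (intro W.finsum_cong') (auto simp: coord_e)
      also have "\<dots> = sharp_coeff g i" using i sharp_coeff_closed by (intro W.finsum_singleton) auto
      finally show "(\<Oplus>\<^bsub>C\<^esub>j\<in>{..n}. \<phi> j (e i) \<odot>\<^bsub>C\<^esub> sharp_coeff g j) =
        tensor_lift C (\<lambda>x c. g x \<odot>\<^bsub>C\<^esub> S (\<tau> c)) (coact V (e i))" by (simp add: rhs[OF i])
    qed
    finally show "tensor_lift C (\<lambda>h c. h v \<odot>\<^bsub>C\<^esub> c) ?t = \<dots>" .
  next
    fix u assume u: "u \<in> carrier (tensor Vd C) \<and> (\<forall>v\<in>carrier V. tensor_lift C (\<lambda>h c. h v \<odot>\<^bsub>C\<^esub> c) u
                    = tensor_lift C (\<lambda>x c. g x \<odot>\<^bsub>C\<^esub> S (\<tau> c)) (coact V v))"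
    show "u = ?t"
    proof (rule D.tensor_eqI)
      fix i assume i: "i \<le> n"
      \<comment> \<open>For the dual frame the coordinate functional is evaluation at
        \<open>e i\<close>, so \<open>D.tcoord i\<close> is the left-hand side of the characterising
        equation at \<open>v = e i\<close>.\<close>
      have "D.tcoord i u = sharp_coeff g i" unfolding D.tcoord_def using u e_closed[OF i] rhs[OF i] by simp
      then show "D.tcoord i u = D.tcoord i ?t" using i sharp_coeff_closed by (simp add: D.tcoord_sum)
    qed (use u D.tensor_sum_closed[OF sharp_coeff_closed] in auto)
  qed
  finally show ?thesis .
qed

lemma sharp_coeff_linmap: "j \<le> n \<Longrightarrow> (\<lambda>g. sharp_coeff g j) \<in> linmap Vd C"
  unfolding sharp_coeff_def using S_tau_t_closed
  by (intro linmap_pointwise_sum[OF linmap_smult_vector] W.vspace_axioms D.coord_linmap) auto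

lemma coact_sharp_linmap: "coact U \<in> linmap Vd (tensor Vd C)"
proof (rule linmap_cong[OF _ vspace_dual coact_sharp[symmetric]])
  show "(\<lambda>g. \<Oplus>\<^bsub>tensor Vd C\<^esub>j\<in>{..n}. pure_tensor Vd C (dual_e j) (sharp_coeff g j)) \<in> linmap Vd (tensor Vd C)"
    using D.e_closed
    by (intro linmap_pointwise_sum[OF linmap_comp[OF sharp_coeff_linmap bilinD1[OF D.bilin_pure]]] D.vspace_tensor) auto
qed

text \<open>Both sides of the colinearity condition are linear in the vector, so they are compared
  at \<open>e i\<close>, and there through their coefficients at \<open>dual_e j\<close>. The matrix
  of \<open>f\<close> has the entries \<open>f (e i) (e j)\<close>.\<close>

lemma comod_hom_iff:
  "f \<in> comod_hom C V U \<longleftrightarrow> f \<in> carrier (hom_space V U) \<and>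
     (\<forall>i\<le>n. \<forall>j\<le>n. (\<Oplus>\<^bsub>C\<^esub>k\<in>{..n}. f (e i) (e k) \<odot>\<^bsub>C\<^esub> S (\<tau> (t k j))) = (\<Oplus>\<^bsub>C\<^esub>k\<in>{..n}. f (e k) (e j) \<odot>\<^bsub>C\<^esub> t k i))"
proof (cases "f \<in> carrier (hom_space V U)")
  case True
  then have f: "f \<in> linmap V Vd" by (simp add: linmap_sharp)
  note fd = linmap_closed[OF f]
  let ?l = "\<lambda>v. coact U (f v)"
  let ?r = "\<lambda>v. tensor_lift (tensor Vd C) (\<lambda>x c. pure_tensor Vd C (f x) c) (coact V v)"
  have b: "bilin V C (tensor Vd C) (\<lambda>x c. pure_tensor Vd C (f x) c)"
    using bilinD1[OF D.bilin_pure fd] linmap_comp[OF f bilinD2[OF D.bilin_pure]]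
    by (intro bilinI) auto
  have l: "?l \<in> linmap V (tensor Vd C)" by (rule linmap_comp[OF f coact_sharp_linmap])
  have r: "?r \<in> linmap V (tensor Vd C)" by (rule lift_coact_linmap[OF b D.vspace_tensor])
  have le: "D.tcoord j (?l (e i)) = (\<Oplus>\<^bsub>C\<^esub>k\<in>{..n}. f (e i) (e k) \<odot>\<^bsub>C\<^esub> S (\<tau> (t k j)))" if "i \<le> n" "j \<le> n" for i j
    using that sharp_coeff_closed by (simp add: coact_sharp[OF fd] e_closed D.tcoord_sum) (simp add: sharp_coeff_def)
  have re: "D.tcoord j (?r (e i)) = (\<Oplus>\<^bsub>C\<^esub>k\<in>{..n}. f (e k) (e j) \<odot>\<^bsub>C\<^esub> t k i)" if "i \<le> n" "j \<le> n" for i j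
  proof -
    have "D.tcoord j (?r (e i)) = D.tcoord j (\<Oplus>\<^bsub>tensor Vd C\<^esub>k\<in>{..n}. pure_tensor Vd C (f (e k)) (t k i))"
      by (simp add: lift_coact_e[OF b D.vspace_tensor that(1)])
    also have "\<dots> = (\<Oplus>\<^bsub>C\<^esub>k\<in>{..n}. D.tcoord j (pure_tensor Vd C (f (e k)) (t k i)))"
      using that e_closed t_closed fd
      by (intro linmap_finsum[OF D.tcoord_linmap D.vspace_tensor W.vspace_axioms]) auto
    also have "\<dots> = (\<Oplus>\<^bsub>C\<^esub>k\<in>{..n}. f (e k) (e j) \<odot>\<^bsub>C\<^esub> t k i)"
      using that e_closed t_closed fd by (intro W.finsum_cong') (auto simp: D.tcoord_pure)
    finally show ?thesis .
  qed
  have "f \<in> comod_hom C V U \<longleftrightarrow> (\<forall>v\<in>carrier V. ?l v = ?r v)"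
    using True by (simp add: comod_hom_def tensor_sharp)
  also have "\<dots> \<longleftrightarrow> (\<forall>i\<le>n. ?l (e i) = ?r (e i))"
    using linmap_eq[OF l r D.vspace_tensor] e_closed by blast
  also have "\<dots> \<longleftrightarrow> (\<forall>i\<le>n. \<forall>j\<le>n. D.tcoord j (?l (e i)) = D.tcoord j (?r (e i)))"
    using D.tensor_eqI linmap_closed[OF l] linmap_closed[OF r] e_closed by metis
  finally show ?thesis using True le re by simp
next
  case False
  then show ?thesis by (auto simp: comod_hom_def)
qed

text \<open>The sum in \<open>fixed\<close> is the \<open>(i, j)\<close> entry of the transformed
  form: the transpose evaluates \<open>j_map\<close> of \<open>e i\<close> at the functional
  \<open>f (e j)\<close>, and the coaction of \<open>e i\<close> brings in the
  \<open>t k i\<close>.\<close>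

lemma indicator_map_fixed:
  assumes f: "f \<in> carrier (hom_space V U)"
    and fixed: "\<And>i j. i \<le> n \<Longrightarrow> j \<le> n \<Longrightarrow> (\<Sum>k\<le>n. f (e j) (e k) * \<gamma> (t k i)) = f (e i) (e j)"
  shows "compose (carrier V) (transpose_map V U f) (j_map C S \<tau> \<gamma> V) = f"
proof (rule extensionalityI[of _ "carrier V"])
  have fl: "f \<in> linmap V Vd" using f by (simp add: linmap_sharp)
  note fd = linmap_closed[OF fl]
  show "f \<in> extensional (carrier V)" using f by simp
  have b: "bilin V C base_alg (\<lambda>x c. g x * \<gamma> c)" if "g \<in> linmap V base_alg" for g
    using bilin_smult[OF that vspace_base_alg] gamma_linmap linmap_comp[OF gamma_linmap] linmap_closed[OF gamma_linmap]
    unfolding bilin_def by fastforce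
  let ?J = "\<lambda>v g. tensor_lift base_alg (\<lambda>x c. g x * \<gamma> c) (coact V v)"
  fix v assume v: "v \<in> carrier V"
  \<comment> \<open>Displays the functional as a combination of evaluations at the
    \<open>e k\<close>, which shows its linearity in \<open>g\<close>.\<close>
  have J_expand: "?J v g = (\<Sum>k\<le>n. g (e k) * \<gamma> (tcoord k (coact V v)))" if g: "g \<in> linmap V base_alg" for g
  proof -
    define u where "u = coact V v"
    have u: "u \<in> carrier (tensor V C)" using linmap_closed[OF coact_linmap v] by (simp add: u_def)
    note tc = linmap_closed[OF tcoord_linmap u]
    have "tensor_lift base_alg (\<lambda>x c. g x * \<gamma> c) u =
      tensor_lift base_alg (\<lambda>x c. g x * \<gamma> c) (\<Oplus>\<^bsub>tensor V C\<^esub>i\<in>{..n}. pure_tensor V C (e i) (tcoord i u))"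
      using tensor_expand[OF u] by simp
    also have "\<dots> = (\<Oplus>\<^bsub>base_alg\<^esub>i\<in>{..n}. tensor_lift base_alg (\<lambda>x c. g x * \<gamma> c) (pure_tensor V C (e i) (tcoord i u)))"
      using tc e_closed
      by (intro linmap_finsum[OF tensor_lift_linmap[OF b[OF g] vspace_base_alg] vspace_tensor vspace_base_alg]) auto
    also have "\<dots> = (\<Sum>k\<le>n. g (e k) * \<gamma> (tcoord k u))"
      using tc e_closed by (simp add: tensor_lift_pure[OF b[OF g] vspace_base_alg])
    finally show ?thesis by (simp add: u_def)
  qed
  have Jlin: "(\<lambda>g. ?J v g) \<in> linmap Vd base_alg"
  proof (rule linmap_cong[OF _ vspace_dual])
    show "(\<lambda>g. \<Sum>k\<le>n. g (e k) * \<gamma> (tcoord k (coact V v))) \<in> linmap Vd base_alg"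
      using linmap_pointwise_sum[OF linmap_smult_vector[OF D.coord_linmap vspace_base_alg] vspace_base_alg, of "{..n}"]
      by simp
    show "(\<Sum>k\<le>n. x (e k) * \<gamma> (tcoord k (coact V v))) = ?J v x" if "x \<in> carrier Vd" for x
      by (simp add: J_expand dualD[OF that])
  qed
  have jv: "j_map C S \<tau> \<gamma> V v = restrict (?J v) (carrier Vd)" using v by (simp add: j_map_def)
  \<comment> \<open>Membership in the double dual is required because \<open>transpose_map\<close>
    is restricted to it.\<close>
  have "restrict (?J v) (carrier Vd) \<in> carrier (dual_space U)"
    using Jlin by (simp add: dual_space_def[of U] restrict_linmap[OF vspace_dual] linmap_sharp)
  then have "compose (carrier V) (transpose_map V U f) (j_map C S \<tau> \<gamma> V) v = (\<lambda>x\<in>carrier V. ?J v (f x))"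
    using v fd by (auto simp: compose_eq jv transpose_map_def intro!: restrict_ext)
  also have "\<dots> = f v"
  proof (rule extensionalityI[of _ "carrier V"])
    show "f v \<in> extensional (carrier V)" by (rule dualD(2)[OF fd[OF v]])
    fix x assume x: "x \<in> carrier V"
    \<comment> \<open>Both sides are linear in \<open>x\<close> and in \<open>v\<close>, which
      reduces the claim to pairs of basis vectors.\<close>
    have "?J v (f x) = f v x"
    proof (rule linmap_eq[where f = "\<lambda>x. ?J v (f x)" and g = "f v", OF _ _ vspace_base_alg _ x])
      show "(\<lambda>x. ?J v (f x)) \<in> linmap V base_alg" by (rule linmap_comp[OF fl Jlin])
      show "f v \<in> linmap V base_alg" by (rule dualD(1)[OF fd[OF v]])
      fix j assume j: "j \<le> n"
      note fj = dualD(1)[OF fd[OF e_closed[OF j]]]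
      show "?J v (f (e j)) = f v (e j)"
      proof (rule linmap_eq[where f = "\<lambda>v. ?J v (f (e j))" and g = "\<lambda>v. f v (e j)", OF _ _ vspace_base_alg _ v])
        show "(\<lambda>v. ?J v (f (e j))) \<in> linmap V base_alg" by (rule lift_coact_linmap[OF b[OF fj] vspace_base_alg])
        show "(\<lambda>v. f v (e j)) \<in> linmap V base_alg" by (rule linmap_comp[OF fl D.coord_linmap[OF j]])
        fix i assume i: "i \<le> n"
        show "?J (e i) (f (e j)) = f (e i) (e j)"
          using lift_coact_e[OF b[OF fj] vspace_base_alg i] fixed[OF i j] by simp
      qed
    qed
    then show "(\<lambda>x\<in>carrier V. ?J v (f x)) x = f v x" using x by simp
  qed simp
  finally show "compose (carrier V) (transpose_map V U f) (j_map C S \<tau> \<gamma> V) v = f v" .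
qed simp

lemma hom_eqI:
  assumes "f \<in> carrier (hom_space V U)" "g \<in> carrier (hom_space V U)"
    "\<And>i j. i \<le> n \<Longrightarrow> j \<le> n \<Longrightarrow> f (e i) (e j) = g (e i) (e j)"
  shows "f = g"
proof (rule extensionalityI[of _ "carrier V"])
  fix v assume v: "v \<in> carrier V"
  have fg: "f \<in> linmap V Vd" "g \<in> linmap V Vd" using assms by (simp_all add: linmap_sharp)
  show "f v = g v"
  proof (rule linmap_eq[OF fg vspace_dual _ v])
    fix i assume i: "i \<le> n"
    note fi = linmap_closed[OF fg(1) e_closed[OF i]] and gi = linmap_closed[OF fg(2) e_closed[OF i]]
    show "f (e i) = g (e i)"
    proof (rule extensionalityI[of _ "carrier V"])
      fix x assume x: "x \<in> carrier V"
      show "f (e i) x = g (e i) x"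
        by (rule linmap_eq[OF dualD(1)[OF fi] dualD(1)[OF gi] vspace_base_alg assms(3)[OF i] x])
    qed (rule dualD(2)[OF fi] dualD(2)[OF gi])+
  qed
qed (use assms in auto)

lemma vspace_hom_sharp: "vspace (hom_space V U)"
proof (rule vspace_hom_space[OF V.vspace_axioms])
  have "abelian_group U"
    by (rule abelian_groupI) (auto simp: D.V.a_ac intro: D.V.l_neg)
  then show "vspace U"
    by (rule vspaceI) (simp_all add: D.V.smult_l_distr D.V.smult_r_distr D.V.smult_smult)
qed

end

section \<open>The comodules \<open>X\<^sub>l\<close>\<close>

locale qsl2_comodule = qsl2 q for q :: "'k::field" +
  fixes n :: nat
  assumes not_root: "\<forall>m::nat. m > 0 \<longrightarrow> q ^ m \<noteq> 1"
begin

definition e :: "nat \<Rightarrow> 'k free set" where "e j = mono_ab (n - j) j"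

text \<open>By \<open>M_row_zero\<close> and \<open>comult_mono_ab\<close>, column \<open>j\<close>
  of \<open>M\<close> belongs to \<open>gbinom q n (int j)\<close> times the basis vector
  \<open>e j\<close>; dividing by the binomial gives the coefficients of \<open>e j\<close>
  itself.\<close>

definition t :: "nat \<Rightarrow> nat \<Rightarrow> 'k free set" where
  "t i j = inverse (gbinom q n (int j)) \<odot>\<^bsub>C\<^esub> M n (int i) (int j)"

definition X :: "'k free set set" where
  "X = LinearCombinations.module.span class_ring C (e ` {..n})"

text \<open>The subspace as a bare module, the form in which \<open>coideal_comodule\<close> uses it
  inside its tensor product. \<open>V\<close> is the same space with the coaction added.\<close>

abbreviation XM where "XM \<equiv> C\<lparr>carrier := X\<rparr>"

abbreviation V where "V \<equiv> coideal_comodule q X"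

lemma gbinom_nz: "j \<le> n \<Longrightarrow> gbinom q n (int j) \<noteq> 0"
  by (rule gbinom_nonzero[OF q_nz not_root])

lemma e_in_C [simp, intro]: "e j \<in> carrier C"
  by (simp add: e_def)

lemma t_in_C [simp, intro]: "t i j \<in> carrier C"
  by (simp add: t_def)

lemma coord_e: "coord i (e j) = (if i = j then 1 else 0)"
  by (simp add: e_def coord_mono_ab)

lemma X_submodule: "submodule class_ring X C"
  unfolding X_def by (rule module.span_is_submodule[OF is_module]) auto

lemma X_sub: "X \<subseteq> carrier C"
  by (rule submodule.subset[OF X_submodule])

lemma e_in_X: "j \<le> n \<Longrightarrow> e j \<in> X"
  using module.in_own_span[OF is_module, of "e ` {..n}"] by (auto simp: X_def)

lemma vspace_XM: "vspace XM"
  by (rule submodule_vspace[OF X_submodule])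

lemma linmap_restrict: "f \<in> linmap C W \<Longrightarrow> f \<in> linmap XM W"
  using X_sub
  by (intro linmapI) (auto intro: linmap_closed[of f] linmap_add[of f] linmap_smult[of f] dest: subsetD)

lemma incl_XM: "(\<lambda>x. x) \<in> linmap XM C"
  using X_sub by (intro linmapI) auto

lemma V_simps [simp]:
  "carrier V = X" "mult V = mult C" "one V = one C" "zero V = zero C" "add V = add C" "smult V = smult C"
  by (simp_all add: coideal_comodule_def Let_def module.defs)

lemma linmap_V: "linmap V W = linmap XM W"
  by (simp add: LinearCombinations.module_hom_def)

lemma tensor_V: "tensor V C = tensor XM C" "pure_tensor V C = pure_tensor XM C"
  by (rule tensor_cong; simp)+

lemma vspace_V: "vspace V"
proof -
  interpret XM: vspace XM by (rule vspace_XM)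
  have "abelian_group V"
  proof (rule abelian_groupI)
    fix x assume "x \<in> carrier V"
    then show "\<exists>y\<in>carrier V. y \<oplus>\<^bsub>V\<^esub> x = \<zero>\<^bsub>V\<^esub>"
      using XM.a_inv_closed[of x] XM.l_neg[of x] by auto
  qed (use XM.a_closed XM.zero_closed XM.a_assoc XM.a_comm XM.l_zero in auto)
  then show ?thesis
    by (rule vspaceI)
      (use XM.smult_closed XM.smult_l_distr XM.smult_r_distr XM.smult_smult XM.one_smult in auto)
qed

text \<open>The functionals are defined on all of \<open>C\<close>, so both sides of the expansion
  are linear maps on \<open>C\<close>. They agree on the \<open>e j\<close>, hence on the span
  \<open>X\<close>.\<close>

lemma frame_XM: "frame XM n e coord"
proof (intro frame.intro frame_axioms.intro vspace_XM)
  interpret XM: vspace XM by (rule vspace_XM)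
  show "e i \<in> carrier XM" if "i \<le> n" for i using e_in_X[OF that] by simp
  show "coord i \<in> linmap XM base_alg" for i by (rule linmap_restrict[OF coord_linmap])
  show "coord i (e j) = (if i = j then 1 else 0)" for i j by (rule coord_e)
  fix x assume x: "x \<in> carrier XM"
  have "x = (\<Oplus>\<^bsub>C\<^esub>i\<in>{..n}. coord i x \<odot>\<^bsub>C\<^esub> e i)"
  proof (rule linmap_span_eq[OF _ _ vspace_axioms vspace_axioms, of "\<lambda>x. x" "\<lambda>x. \<Oplus>\<^bsub>C\<^esub>i\<in>{..n}. coord i x \<odot>\<^bsub>C\<^esub> e i"])
    show "(\<lambda>x. x) \<in> linmap C C" by (intro linmapI) auto
    show "(\<lambda>x. \<Oplus>\<^bsub>C\<^esub>i\<in>{..n}. coord i x \<odot>\<^bsub>C\<^esub> e i) \<in> linmap C C"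
      by (intro linmap_pointwise_sum[OF linmap_smult_vector] vspace_axioms coord_linmap) auto
    show "x \<in> LinearCombinations.module.span class_ring C (e ` {..n})" using x by (simp add: X_def)
    fix y assume "y \<in> e ` {..n}"
    then obtain j where j: "j \<le> n" "y = e j" by auto
    have "(\<Oplus>\<^bsub>C\<^esub>i\<in>{..n}. coord i y \<odot>\<^bsub>C\<^esub> e i) = (\<Oplus>\<^bsub>C\<^esub>i\<in>{..n}. if j = i then e i else \<zero>\<^bsub>C\<^esub>)"
      by (intro finsum_cong') (auto simp: j coord_e)
    also have "\<dots> = y" using j by (subst finsum_singleton) auto
    finally show "y = (\<Oplus>\<^bsub>C\<^esub>i\<in>{..n}. coord i y \<odot>\<^bsub>C\<^esub> e i)" by simp
  qed auto
  also have "\<dots> = (\<Oplus>\<^bsub>XM\<^esub>i\<in>{..n}. coord i x \<odot>\<^bsub>C\<^esub> e i)"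
    using XM.smult_closed e_in_X
    by (intro linmap_finsum[OF incl_XM vspace_XM vspace_axioms, symmetric]) auto
  finally show "x = (\<Oplus>\<^bsub>XM\<^esub>i\<in>{..n}. coord i x \<odot>\<^bsub>XM\<^esub> e i)" by simp
qed

lemma frame_V: "frame V n e coord"
proof (intro frame.intro frame_axioms.intro vspace_V)
  interpret XM: frame XM n e coord by (rule frame_XM)
  interpret V: vspace V by (rule vspace_V)
  show "e i \<in> carrier V" if "i \<le> n" for i using e_in_X[OF that] by simp
  show "coord i \<in> linmap V base_alg" for i by (simp add: linmap_V linmap_restrict[OF coord_linmap])
  show "coord i (e j) = (if i = j then 1 else 0)" for i j by (rule coord_e)
  fix x assume "x \<in> carrier V"
  then have "x = (\<Oplus>\<^bsub>XM\<^esub>i\<in>{..n}. coord i x \<odot>\<^bsub>XM\<^esub> e i)" by (intro XM.expand) simp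
  also have "\<dots> = (\<Oplus>\<^bsub>V\<^esub>i\<in>{..n}. coord i x \<odot>\<^bsub>XM\<^esub> e i)"
    using XM.V.smult_closed e_in_X
    by (intro linmap_finsum[OF _ XM.V.vspace_axioms V.vspace_axioms, of "\<lambda>x. x"] linmapI) auto
  finally show "x = (\<Oplus>\<^bsub>V\<^esub>i\<in>{..n}. coord i x \<odot>\<^bsub>V\<^esub> e i)" by simp
qed

sublocale X: frame_tensor V C n e coord
  by (intro frame_tensor.intro frame_V tensor_product.intro vspace_V vspace_axioms)

section \<open>The coaction determined by the comultiplication\<close>

definition incl where "incl = tensor_lift CC (pure_tensor C C)"

lemma bilin_incl: "bilin V C CC (pure_tensor C C)"
  using X_sub bilinD1[OF CC.bilin_pure] linmap_restrict[OF bilinD2[OF CC.bilin_pure]]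
  by (intro bilinI) (auto simp: linmap_V)

lemma incl_linmap: "incl \<in> linmap (tensor V C) CC"
  unfolding incl_def by (rule X.tensor_lift_linmap[OF bilin_incl CC.vspace_tensor])

lemma incl_pure: "x \<in> X \<Longrightarrow> y \<in> carrier C \<Longrightarrow> incl (pure_tensor V C x y) = x \<otimes>\<^sub>t y"
  unfolding incl_def by (rule X.tensor_lift_pure[OF bilin_incl CC.vspace_tensor]) auto

text \<open>Since \<open>coord i\<close> is defined on the whole algebra, contracting the first
  factor of \<open>C \<otimes> C\<close> with it recovers \<open>X.tcoord i\<close> after the
  inclusion. All coordinates of a tensor are therefore visible in its image.\<close>

lemma incl_inj:
  assumes "u \<in> carrier (tensor V C)" "u' \<in> carrier (tensor V C)" "incl u = incl u'"
  shows "u = u'"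
proof (rule X.tensor_eqI[OF assms(1,2)])
  fix i assume i: "i \<le> n"
  let ?k = "tensor_lift C (\<lambda>v w. coord i v \<odot>\<^bsub>C\<^esub> w)"
  have b: "bilin C C C (\<lambda>v w. coord i v \<odot>\<^bsub>C\<^esub> w)" by (rule bilin_smult[OF coord_linmap vspace_axioms])
  have k: "?k (incl u) = X.tcoord i u" if "u \<in> carrier (tensor V C)" for u
  proof (rule X.tensor_linmap_eq[OF _ X.tcoord_linmap[OF i] vspace_axioms _ that])
    show "(\<lambda>u. ?k (incl u)) \<in> linmap (tensor V C) C"
      by (rule linmap_comp[OF incl_linmap CC.tensor_lift_linmap[OF b vspace_axioms]])
    fix v w assume v: "v \<in> carrier V" and w: "w \<in> carrier C"
    then show "?k (incl (pure_tensor V C v w)) = X.tcoord i (pure_tensor V C v w)"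
      using X_sub i by (auto simp: incl_pure X.tcoord_pure CC.tensor_lift_pure[OF b vspace_axioms])
  qed
  show "X.tcoord i u = X.tcoord i u'" using k[OF assms(1)] k[OF assms(2)] assms(3) by simp
qed

text \<open>An explicit candidate for the described coaction, written through coordinates so that
  its linearity is immediate.\<close>

definition coaction where
  "coaction x = (\<Oplus>\<^bsub>tensor V C\<^esub>j\<in>{..n}. coord j x \<odot>\<^bsub>tensor V C\<^esub> (\<Oplus>\<^bsub>tensor V C\<^esub>i\<in>{..n}. pure_tensor V C (e i) (t i j)))"

lemma coaction_linmap: "coaction \<in> linmap V (tensor V C)"
  unfolding coaction_def[abs_def] using X.tensor_sum_closed
  by (intro linmap_pointwise_sum[OF linmap_smult_vector] X.vspace_tensor X.coord_linmap) auto

lemma coaction_e: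
  assumes "j \<le> n"
  shows "coaction (e j) = (\<Oplus>\<^bsub>tensor V C\<^esub>i\<in>{..n}. pure_tensor V C (e i) (t i j))" (is "_ = ?w j")
proof -
  interpret T: vspace "tensor V C" by (rule X.vspace_tensor)
  have w: "?w j \<in> carrier (tensor V C)" for j by (rule X.tensor_sum_closed) auto
  have "coaction (e j) = (\<Oplus>\<^bsub>tensor V C\<^esub>i\<in>{..n}. if j = i then ?w i else \<zero>\<^bsub>tensor V C\<^esub>)"
    unfolding coaction_def using w by (intro T.finsum_cong') (auto simp: coord_e)
  also have "\<dots> = ?w j" using assms w by (intro T.finsum_singleton) auto
  finally show ?thesis .
qed

lemma comult_e:
  assumes "j \<le> n"
  shows "\<Delta> (e j) = (\<Oplus>\<^bsub>CC\<^esub>i\<in>{..n}. e i \<otimes>\<^sub>t t i j)"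
proof -
  interpret T: kalg CC by (rule CC.kalg_tensor)
  let ?g = "gbinom q n (int j)"
  have dc: "\<Delta> (e j) \<in> carrier CC" by (rule linmap_closed[OF alg_homD(1)[OF comult_hom]]) simp
  have "\<Delta> (e j) = inverse ?g \<odot>\<^bsub>CC\<^esub> (?g \<odot>\<^bsub>CC\<^esub> \<Delta> (e j))"
    using gbinom_nz[OF assms] dc by (simp add: T.smult_smult)
  also have "\<dots> = inverse ?g \<odot>\<^bsub>CC\<^esub> comult_sum n (int j)"
    using comult_mono_ab[OF assms] by (simp add: e_def)
  also have "\<dots> = (\<Oplus>\<^bsub>CC\<^esub>i\<in>{..n}. inverse ?g \<odot>\<^bsub>CC\<^esub> (mono_ab (n - i) i \<otimes>\<^sub>t M n (int i) (int j)))"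
    unfolding comult_sum_def by (rule T.finsum_smult) auto
  also have "\<dots> = (\<Oplus>\<^bsub>CC\<^esub>i\<in>{..n}. e i \<otimes>\<^sub>t t i j)"
    by (intro T.finsum_cong') (auto simp: e_def t_def CC.pure_smult_r)
  finally show ?thesis .
qed

lemma incl_coaction:
  assumes "x \<in> X" shows "incl (coaction x) = \<Delta> x"
proof (rule X.linmap_eq[where f = "\<lambda>x. incl (coaction x)" and g = \<Delta>])
  interpret T: kalg CC by (rule CC.kalg_tensor)
  show "(\<lambda>x. incl (coaction x)) \<in> linmap V CC" by (rule linmap_comp[OF coaction_linmap incl_linmap])
  show "\<Delta> \<in> linmap V CC" unfolding linmap_V by (rule linmap_restrict[OF alg_homD(1)[OF comult_hom]])
  fix j assume j: "j \<le> n"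
  have "incl (coaction (e j)) = (\<Oplus>\<^bsub>CC\<^esub>i\<in>{..n}. incl (pure_tensor V C (e i) (t i j)))"
    unfolding coaction_e[OF j] using e_in_X
    by (intro linmap_finsum[OF incl_linmap X.vspace_tensor CC.vspace_tensor]) auto
  also have "\<dots> = \<Delta> (e j)"
    unfolding comult_e[OF j] using e_in_X by (intro T.finsum_cong') (auto simp: incl_pure)
  finally show "incl (coaction (e j)) = \<Delta> (e j)" .
qed (use assms CC.vspace_tensor in auto)

lemma coact_V:
  assumes "x \<in> X" shows "coact V x = coaction x"
proof -
  have dc: "coaction x \<in> carrier (tensor V C)" using linmap_closed[OF coaction_linmap] assms by simp
  have "coact V x = (THE u. u \<in> carrier (tensor V C) \<and> incl u = \<Delta> x)"
    unfolding tensor_V incl_def by (simp add: coideal_comodule_def Let_def module.defs comodule.defs)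
  also have "\<dots> = coaction x"
    using dc incl_coaction[OF assms] incl_inj by (intro the_equality) auto
  finally show ?thesis .
qed

sublocale X: based_comodule V C n e coord t "antipode q" "tau q" "gam q"
proof (intro based_comodule.intro based_comodule_axioms.intro)
  show "frame_tensor V C n e coord" by (rule X.frame_tensor_axioms)
  show "coact V \<in> linmap V (tensor V C)"
    by (rule linmap_cong[OF coaction_linmap vspace_V]) (simp add: coact_V)
  show "coact V (e j) = (\<Oplus>\<^bsub>tensor V C\<^esub>i\<in>{..n}. pure_tensor V C (e i) (t i j))" if "j \<le> n" for j
    using that by (simp add: coact_V e_in_X coaction_e)
  show "(\<lambda>c. antipode q (tau q c)) \<in> linmap C C"
    using theta_linmap by (simp add: \<theta>_def[abs_def])
  show "gam q \<in> linmap C base_alg" by (rule alg_homD(1)[OF gam_hom])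
qed auto

text \<open>The weights solve the equations that \<open>theta_M\<close> imposes on an antidiagonal
  form; they are determined up to a common factor, and \<open>\<beta> 0 = 1\<close> is one
  normalisation.\<close>

definition \<beta> :: "nat \<Rightarrow> 'k" where
  "\<beta> i = q powi int i / gbinom q n (int i)"

lemma beta_nz: "i \<le> n \<Longrightarrow> \<beta> i \<noteq> 0"
  using q_nz gbinom_nz by (simp add: \<beta>_def)

lemma gbinom_reflect: "i \<le> n \<Longrightarrow> gbinom q n (int (n - i)) = gbinom q n (int i)"
  using gbinom_sym[OF q_nz, of n "int i"] by (simp add: of_nat_diff)

lemma beta_reflect: "i \<le> n \<Longrightarrow> \<beta> (n - i) = q powi (int n - int i) / gbinom q n (int i)"
  unfolding \<beta>_def gbinom_reflect by (simp add: of_nat_diff)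

text \<open>The scalar from \<open>theta_M\<close>, together with the two normalising binomials, is
  a ratio of weights. In this form the colinearity of the antidiagonal form reduces to a
  cancellation.\<close>

lemma theta_t:
  assumes "k \<le> n" "j \<le> n"
  shows "\<theta> (t k j) = (\<beta> (n - j) / \<beta> (n - k)) \<odot>\<^bsub>C\<^esub> t (n - j) (n - k)"
proof -
  have "\<theta> (t k j) = (inverse (gbinom q n (int j)) * q powi (int k - int j)) \<odot>\<^bsub>C\<^esub> M n (int (n - j)) (int (n - k))"
    using assms by (simp add: t_def linmap_smult[OF theta_linmap] theta_M smult_smult of_nat_diff)
  also have "inverse (gbinom q n (int j)) * q powi (int k - int j) =
      \<beta> (n - j) / \<beta> (n - k) * inverse (gbinom q n (int (n - k)))"
  proof -
    have "q powi (int n - int k) * q powi (int k - int j) = q powi (int n - int j)"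
      by (simp add: powi_mult[OF q_nz])
    moreover have "q powi (int n - int k) \<noteq> 0" using q_nz by simp
    ultimately have "q powi (int k - int j) = q powi (int n - int j) / q powi (int n - int k)"
      by (simp add: field_simps)
    then show ?thesis
      unfolding beta_reflect[OF assms(1)] beta_reflect[OF assms(2)] gbinom_reflect[OF assms(1)]
      using gbinom_nz[OF assms(1)] by (simp add: divide_inverse)
  qed
  finally show ?thesis by (simp add: t_def smult_smult)
qed

lemma gam_t:
  assumes "i \<le> n" "j \<le> n"
  shows "gam q (t i j) = (if i = j then q powi (2 * int j - int n) else 0)"
  using gbinom_nz[OF assms(2)]
  by (simp add: t_def linmap_smult[OF alg_homD(1)[OF gam_hom]] gam_M)

lemma t_row_zero: "j \<le> n \<Longrightarrow> t 0 j = e j"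
  using gbinom_nz[of j] M_row_zero[of n "int j"]
  by (simp add: t_def e_def smult_smult nat_diff_distrib flip: of_nat_diff)

lemma e_nonzero: "e j \<noteq> \<zero>\<^bsub>C\<^esub>"
  using coord_e[of j j] linmap_zero[OF coord_linmap vspace_axioms vspace_base_alg, of j] by auto

text \<open>The antidiagonal solution as a map into the dual space. Both arguments are restricted
  because \<open>hom_space\<close> and \<open>dual_space\<close> consist of extensional
  functions.\<close>

definition inv_form :: "'k free set \<Rightarrow> 'k free set \<Rightarrow> 'k" where
  "inv_form = (\<lambda>x\<in>X. \<lambda>y\<in>X. \<Sum>i\<le>n. coord i x * \<beta> i * coord (n - i) y)"

lemma inv_form_e: "i \<le> n \<Longrightarrow> j \<le> n \<Longrightarrow> inv_form (e i) (e j) = (if i + j = n then \<beta> i else 0)"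
proof -
  assume ij: "i \<le> n" "j \<le> n"
  have "inv_form (e i) (e j) = (\<Sum>k\<le>n. coord k (e i) * \<beta> k * coord (n - k) (e j))"
    using ij by (simp add: inv_form_def e_in_X)
  also have "\<dots> = (\<Sum>k\<le>n. if k = i then \<beta> i * coord (n - i) (e j) else 0)"
    by (intro sum.cong) (auto simp: coord_e)
  also have "\<dots> = \<beta> i * coord (n - i) (e j)" using ij by simp
  finally show ?thesis using ij by (auto simp: coord_e)
qed

lemma inv_form_hom: "inv_form \<in> carrier (hom_space V X.U)"
proof -
  have inner: "(\<lambda>y\<in>X. \<Sum>i\<le>n. coord i x * \<beta> i * coord (n - i) y) \<in> carrier X.Vd" for x
  proof -
    have "(\<lambda>y. \<Sum>i\<le>n. coord i x * \<beta> i * coord (n - i) y) \<in> linmap V base_alg"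
      using linmap_pointwise_sum[OF linmap_pointwise_smult[OF X.coord_linmap vspace_base_alg] vspace_base_alg,
        of "{..n}" "\<lambda>i. n - i" "\<lambda>i. coord i x * \<beta> i"] by simp
    then show ?thesis by (simp add: dual_space_def restrict_linmap[OF vspace_V, simplified])
  qed
  have "(\<lambda>x. \<lambda>y\<in>X. \<Sum>i\<le>n. coord i x * \<beta> i * coord (n - i) y) \<in> linmap V X.Vd"
  proof (rule linmapI)
    fix x y assume xy: "x \<in> carrier V" "y \<in> carrier V"
    then show "(\<lambda>z\<in>X. \<Sum>i\<le>n. coord i (x \<oplus>\<^bsub>V\<^esub> y) * \<beta> i * coord (n - i) z) =
      (\<lambda>z\<in>X. \<Sum>i\<le>n. coord i x * \<beta> i * coord (n - i) z) \<oplus>\<^bsub>X.Vd\<^esub> (\<lambda>z\<in>X. \<Sum>i\<le>n. coord i y * \<beta> i * coord (n - i) z)"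
      using linmap_add[OF X.coord_linmap xy]
      by (auto simp: dual_space_def distrib_right sum.distrib intro!: restrict_ext)
  next
    fix s x assume x: "x \<in> carrier V"
    then show "(\<lambda>z\<in>X. \<Sum>i\<le>n. coord i (s \<odot>\<^bsub>V\<^esub> x) * \<beta> i * coord (n - i) z) =
      s \<odot>\<^bsub>X.Vd\<^esub> (\<lambda>z\<in>X. \<Sum>i\<le>n. coord i x * \<beta> i * coord (n - i) z)"
      using linmap_smult[OF X.coord_linmap x]
      by (auto simp: dual_space_def sum_distrib_left mult.assoc intro!: restrict_ext)
  qed (use inner in simp)
  then show ?thesis
    by (simp add: inv_form_def X.linmap_sharp restrict_linmap[OF vspace_V, simplified])
qed

lemma comod_hom_V:
  "comod_hom C V X.U = {s \<odot>\<^bsub>hom_space V X.U\<^esub> inv_form | s. True}"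
proof (intro equalityI subsetI)
  fix f assume f: "f \<in> comod_hom C V X.U"
  then have fh: "f \<in> carrier (hom_space V X.U)"
    and eq: "\<And>i j. i \<le> n \<Longrightarrow> j \<le> n \<Longrightarrow>
      (\<Oplus>\<^bsub>C\<^esub>k\<in>{..n}. f (e i) (e k) \<odot>\<^bsub>C\<^esub> \<theta> (t k j)) = (\<Oplus>\<^bsub>C\<^esub>k\<in>{..n}. f (e k) (e j) \<odot>\<^bsub>C\<^esub> t k i)"
    unfolding X.comod_hom_iff \<theta>_def[symmetric] by auto
  note gl = alg_homD(1)[OF gam_hom]
  have gsum: "gam q (\<Oplus>\<^bsub>C\<^esub>k\<in>{..n}. s k \<odot>\<^bsub>C\<^esub> x k) = (\<Sum>k\<le>n. s k * gam q (x k))"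
    if "\<And>k. x k \<in> carrier C" for s x
    using linmap_finsum[OF gl vspace_axioms vspace_base_alg, of "\<lambda>k. s k \<odot>\<^bsub>C\<^esub> x k" "{..n}"] that
    by (simp add: linmap_smult[OF gl])
  \<comment> \<open>Applying \<open>gam q\<close> to the equation at \<open>i\<close>,
    \<open>j\<close> leaves one term on each side. Unless the entry is zero, this forces the powers
    of \<open>q\<close> with exponents \<open>n - 2 j\<close> and \<open>2 i - n\<close> to
    coincide.\<close>
  have off: "f (e i) (e j) = 0" if ij: "i \<le> n" "j \<le> n" "i + j \<noteq> n" for i j
  proof (rule ccontr)
    assume nz: "f (e i) (e j) \<noteq> 0"
    have gt: "gam q (\<theta> (t k j)) = (if k = j then q powi (int n - 2 * int j) else 0)" if "k \<le> n" for k
      using that ij beta_nz by (auto simp: theta_t linmap_smult[OF gl] gam_t of_nat_diff)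
    have "(\<Sum>k\<le>n. f (e i) (e k) * gam q (\<theta> (t k j))) = (\<Sum>k\<le>n. f (e k) (e j) * gam q (t k i))"
      using arg_cong[OF eq[OF ij(1,2)], of "gam q"] by (simp add: gsum)
    moreover have "(\<Sum>k\<le>n. f (e i) (e k) * gam q (\<theta> (t k j))) = f (e i) (e j) * q powi (int n - 2 * int j)"
    proof -
      have "(\<Sum>k\<le>n. f (e i) (e k) * gam q (\<theta> (t k j))) =
        (\<Sum>k\<le>n. if k = j then f (e i) (e j) * q powi (int n - 2 * int j) else 0)"
        by (intro sum.cong) (auto simp: gt)
      then show ?thesis using ij by simp
    qed
    moreover have "(\<Sum>k\<le>n. f (e k) (e j) * gam q (t k i)) = f (e i) (e j) * q powi (2 * int i - int n)"
    proof -
      have "(\<Sum>k\<le>n. f (e k) (e j) * gam q (t k i)) =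
        (\<Sum>k\<le>n. if k = i then f (e i) (e j) * q powi (2 * int i - int n) else 0)"
        using ij by (intro sum.cong) (auto simp: gam_t)
      then show ?thesis using ij by simp
    qed
    ultimately have eqp: "q powi (int n - 2 * int j) = q powi (2 * int i - int n)" using nz by simp
    have "q powi (2 * (int i + int j - int n)) = q powi (2 * int i - int n) * inverse (q powi (int n - 2 * int j))"
      unfolding power_int_minus[symmetric] powi_mult[OF q_nz] by (simp add: algebra_simps)
    then have one: "q powi (2 * (int i + int j - int n)) = 1" using eqp q_nz by simp
    then have one': "q powi (- (2 * (int i + int j - int n))) = 1" by (simp only: power_int_minus) simp
    \<comment> \<open>The assumption on \<open>q\<close> concerns positive exponents, so the sign of
      \<open>i + j - n\<close> decides between \<open>one\<close> and \<open>one'\<close>.\<close>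
    show False
    proof (cases "i + j > n")
      case True
      then have "2 * (int i + int j - int n) = int (2 * (i + j - n))" by (simp add: of_nat_diff)
      with one have "q ^ (2 * (i + j - n)) = 1" by (simp only: power_int_of_nat)
      then show False using not_root True by auto
    next
      case False
      then have "- (2 * (int i + int j - int n)) = int (2 * (n - (i + j)))" by (simp add: of_nat_diff)
      with one' have "q ^ (2 * (n - (i + j))) = 1" by (simp only: power_int_of_nat)
      then show False using not_root False ij(3) by auto
    qed
  qed
  \<comment> \<open>The equation with second index \<open>n\<close>: on the left only
    \<open>k = n - i\<close> survives, with \<open>\<theta> (t (n - i) n)\<close> a multiple of
    \<open>t 0 i\<close>; on the right only \<open>k = 0\<close> survives, again with
    \<open>t 0 i\<close>. As this is the nonzero vector \<open>e i\<close>, the scalars can be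
    compared.\<close>
  have diag: "f (e i) (e (n - i)) = f (e 0) (e n) / \<beta> 0 * \<beta> i" if i: "i \<le> n" for i
  proof -
    have "(\<Oplus>\<^bsub>C\<^esub>k\<in>{..n}. f (e i) (e k) \<odot>\<^bsub>C\<^esub> \<theta> (t k n)) =
      (\<Oplus>\<^bsub>C\<^esub>k\<in>{..n}. if n - i = k then f (e i) (e k) \<odot>\<^bsub>C\<^esub> \<theta> (t k n) else \<zero>\<^bsub>C\<^esub>)"
      using i by (intro finsum_cong') (auto simp: off)
    also have "\<dots> = f (e i) (e (n - i)) \<odot>\<^bsub>C\<^esub> \<theta> (t (n - i) n)"
      by (rule finsum_singleton) auto
    also have "\<dots> = (f (e i) (e (n - i)) * (\<beta> 0 / \<beta> i)) \<odot>\<^bsub>C\<^esub> e i"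
      using i by (simp add: theta_t t_row_zero smult_smult)
    finally have l: "(\<Oplus>\<^bsub>C\<^esub>k\<in>{..n}. f (e i) (e k) \<odot>\<^bsub>C\<^esub> \<theta> (t k n)) =
      (f (e i) (e (n - i)) * (\<beta> 0 / \<beta> i)) \<odot>\<^bsub>C\<^esub> e i" .
    have "(\<Oplus>\<^bsub>C\<^esub>k\<in>{..n}. f (e k) (e n) \<odot>\<^bsub>C\<^esub> t k i) =
      (\<Oplus>\<^bsub>C\<^esub>k\<in>{..n}. if 0 = k then f (e k) (e n) \<odot>\<^bsub>C\<^esub> t k i else \<zero>\<^bsub>C\<^esub>)"
      by (intro finsum_cong') (auto simp: off)
    also have "\<dots> = f (e 0) (e n) \<odot>\<^bsub>C\<^esub> t 0 i"
      by (rule finsum_singleton) auto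
    also have "\<dots> = f (e 0) (e n) \<odot>\<^bsub>C\<^esub> e i" using i by (simp add: t_row_zero)
    finally have r: "(\<Oplus>\<^bsub>C\<^esub>k\<in>{..n}. f (e k) (e n) \<odot>\<^bsub>C\<^esub> t k i) = f (e 0) (e n) \<odot>\<^bsub>C\<^esub> e i" .
    have "(f (e i) (e (n - i)) * (\<beta> 0 / \<beta> i)) \<odot>\<^bsub>C\<^esub> e i = f (e 0) (e n) \<odot>\<^bsub>C\<^esub> e i"
      using eq[OF i order_refl] l r by simp
    then have "f (e i) (e (n - i)) * (\<beta> 0 / \<beta> i) = f (e 0) (e n)"
      by (rule smult_eq_cancel_right) (auto simp: e_nonzero)
    then show ?thesis using beta_nz[OF i] beta_nz[of 0] by (simp add: field_simps)
  qed
  interpret H: vspace "hom_space V X.U" by (rule X.vspace_hom_sharp)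
  have "f = (f (e 0) (e n) / \<beta> 0) \<odot>\<^bsub>hom_space V X.U\<^esub> inv_form"
  proof (rule X.hom_eqI[OF fh H.smult_closed[OF inv_form_hom]])
    fix i j assume ij: "i \<le> n" "j \<le> n"
    have "((f (e 0) (e n) / \<beta> 0) \<odot>\<^bsub>hom_space V X.U\<^esub> inv_form) (e i) (e j) = f (e 0) (e n) / \<beta> 0 * inv_form (e i) (e j)"
      using ij by (simp add: e_in_X dual_space_def)
    also have "\<dots> = f (e i) (e j)"
    proof (cases "i + j = n")
      case True
      then have "j = n - i" by simp
      then show ?thesis using diag[OF ij(1)] ij True by (simp add: inv_form_e)
    qed (use ij off in \<open>simp add: inv_form_e\<close>)
    finally show "f (e i) (e j) = ((f (e 0) (e n) / \<beta> 0) \<odot>\<^bsub>hom_space V X.U\<^esub> inv_form) (e i) (e j)" by simp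
  qed
  then show "f \<in> {s \<odot>\<^bsub>hom_space V X.U\<^esub> inv_form | s. True}" by blast
next
  fix f assume "f \<in> {s \<odot>\<^bsub>hom_space V X.U\<^esub> inv_form | s. True}"
  then obtain s where f: "f = s \<odot>\<^bsub>hom_space V X.U\<^esub> inv_form" by blast
  interpret H: vspace "hom_space V X.U" by (rule X.vspace_hom_sharp)
  have fe: "f (e i) (e j) = (if i + j = n then s * \<beta> i else 0)" if "i \<le> n" "j \<le> n" for i j
    using that by (simp add: f e_in_X dual_space_def inv_form_e)
  show "f \<in> comod_hom C V X.U"
    unfolding X.comod_hom_iff \<theta>_def[symmetric]
  proof (intro conjI allI impI)
    show "f \<in> carrier (hom_space V X.U)" unfolding f by (rule H.smult_closed[OF inv_form_hom])
    fix i j assume ij: "i \<le> n" "j \<le> n"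
    have "(\<Oplus>\<^bsub>C\<^esub>k\<in>{..n}. f (e i) (e k) \<odot>\<^bsub>C\<^esub> \<theta> (t k j)) =
      (\<Oplus>\<^bsub>C\<^esub>k\<in>{..n}. if n - i = k then (s * \<beta> i) \<odot>\<^bsub>C\<^esub> \<theta> (t k j) else \<zero>\<^bsub>C\<^esub>)"
      using ij by (intro finsum_cong') (auto simp: fe)
    also have "\<dots> = (s * \<beta> i) \<odot>\<^bsub>C\<^esub> \<theta> (t (n - i) j)"
      by (rule finsum_singleton) auto
    \<comment> \<open>With \<open>k = n - i\<close> the denominator in \<open>theta_t\<close> is
      \<open>\<beta> i\<close>, which cancels.\<close>
    also have "\<dots> = (s * \<beta> (n - j)) \<odot>\<^bsub>C\<^esub> t (n - j) i"
      using ij beta_nz[OF ij(1)] by (simp add: theta_t smult_smult)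
    also have "\<dots> = (\<Oplus>\<^bsub>C\<^esub>k\<in>{..n}. if n - j = k then (s * \<beta> k) \<odot>\<^bsub>C\<^esub> t k i else \<zero>\<^bsub>C\<^esub>)"
      by (rule finsum_singleton[symmetric]) auto
    also have "\<dots> = (\<Oplus>\<^bsub>C\<^esub>k\<in>{..n}. f (e k) (e j) \<odot>\<^bsub>C\<^esub> t k i)"
      using ij by (intro finsum_cong') (auto simp: fe)
    finally show "(\<Oplus>\<^bsub>C\<^esub>k\<in>{..n}. f (e i) (e k) \<odot>\<^bsub>C\<^esub> \<theta> (t k j)) = (\<Oplus>\<^bsub>C\<^esub>k\<in>{..n}. f (e k) (e j) \<odot>\<^bsub>C\<^esub> t k i)" .
  qed
qed

lemma indicator_V: "twisted_indicator C (antipode q) (tau q) (gam q) V = 1"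
  unfolding twisted_indicator_def Let_def
proof (rule lin_trace_one_dim)
  let ?H = "hom_space V X.U"
  interpret H: vspace ?H by (rule X.vspace_hom_sharp)
  have sub: "submodule class_ring (comod_hom C V X.U) ?H"
    unfolding comod_hom_V
  proof (rule H.submoduleI)
    show "\<zero>\<^bsub>?H\<^esub> \<in> {s \<odot>\<^bsub>?H\<^esub> inv_form | s. True}" using H.zero_smult[OF inv_form_hom] by (metis (mono_tags, lifting) mem_Collect_eq)
  next
    fix f g assume "f \<in> {s \<odot>\<^bsub>?H\<^esub> inv_form | s. True}" "g \<in> {s \<odot>\<^bsub>?H\<^esub> inv_form | s. True}"
    then obtain s s' where "f = s \<odot>\<^bsub>?H\<^esub> inv_form" "g = s' \<odot>\<^bsub>?H\<^esub> inv_form" by blast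
    then have "f \<oplus>\<^bsub>?H\<^esub> g = (s + s') \<odot>\<^bsub>?H\<^esub> inv_form" by (simp only: H.smult_l_distr[OF inv_form_hom])
    then show "f \<oplus>\<^bsub>?H\<^esub> g \<in> {s \<odot>\<^bsub>?H\<^esub> inv_form | s. True}" by blast
  next
    fix s f assume "f \<in> {s \<odot>\<^bsub>?H\<^esub> inv_form | s. True}"
    then obtain s' where "f = s' \<odot>\<^bsub>?H\<^esub> inv_form" by blast
    then have "s \<odot>\<^bsub>?H\<^esub> f = (s * s') \<odot>\<^bsub>?H\<^esub> inv_form" by (simp only: H.smult_smult[OF inv_form_hom])
    then show "s \<odot>\<^bsub>?H\<^esub> f \<in> {s \<odot>\<^bsub>?H\<^esub> inv_form | s. True}" by blast
  qed (use H.smult_closed[OF inv_form_hom] in blast)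
  show "vspace (?H\<lparr>carrier := comod_hom C V X.U\<rparr>)" by (rule H.submodule_vspace[OF sub])
  show "inv_form \<in> carrier (?H\<lparr>carrier := comod_hom C V X.U\<rparr>)"
    using H.one_smult[OF inv_form_hom] by (simp add: comod_hom_V) metis
  have "\<zero>\<^bsub>?H\<^esub> (e 0) (e n) = 0" by (simp add: e_in_X dual_space_def)
  \<comment> \<open>The corner entry is \<open>\<beta> 0\<close>; for \<open>n = 0\<close> it is the
    only entry.\<close>
  moreover have "inv_form (e 0) (e n) \<noteq> 0" using beta_nz[of 0] by (simp add: inv_form_e)
  ultimately show "inv_form \<noteq> \<zero>\<^bsub>?H\<lparr>carrier := comod_hom C V X.U\<rparr>\<^esub>" by auto
  fix f assume "f \<in> carrier (?H\<lparr>carrier := comod_hom C V X.U\<rparr>)"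
  then obtain s where f: "f = s \<odot>\<^bsub>?H\<^esub> inv_form" by (auto simp: comod_hom_V)
  then show "\<exists>s. f = s \<odot>\<^bsub>?H\<lparr>carrier := comod_hom C V X.U\<rparr>\<^esub> inv_form" by auto
  have fe: "f (e i) (e j) = (if i + j = n then s * \<beta> i else 0)" if "i \<le> n" "j \<le> n" for i j
    using that by (simp add: f e_in_X dual_space_def inv_form_e)
  show "compose (carrier V) (transpose_map V X.U f) (j_map C (antipode q) (tau q) (gam q) V) = f"
  proof (rule X.indicator_map_fixed)
    show "f \<in> carrier ?H" unfolding f by (rule H.smult_closed[OF inv_form_hom])
    fix i j assume ij: "i \<le> n" "j \<le> n"
    have "(\<Sum>k\<le>n. f (e j) (e k) * gam q (t k i)) =
        (\<Sum>k\<le>n. if k = i then f (e j) (e i) * q powi (2 * int i - int n) else 0)"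
      using ij by (intro sum.cong) (auto simp: gam_t)
    also have "\<dots> = f (e j) (e i) * q powi (2 * int i - int n)" using ij by simp
    also have "\<dots> = f (e i) (e j)"
    proof (cases "i + j = n")
      case True
      \<comment> \<open>The binomial is unchanged by reflection, and the exponents add up as
        \<open>(n - i) + (2 i - n) = i\<close>.\<close>
      have "\<beta> j * q powi (2 * int i - int n) = \<beta> i"
      proof -
        have "j = n - i" using True by simp
        moreover have "q powi (int n - int i) * q powi (2 * int i - int n) = q powi int i"
          by (simp add: powi_mult[OF q_nz])
        ultimately show ?thesis
          by (simp only: beta_reflect[OF ij(1)] times_divide_eq_left) (simp add: \<beta>_def)
      qed
      then show ?thesis using ij True by (simp add: fe add.commute mult.assoc)
    qed (use ij in \<open>simp add: fe add.commute\<close>)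
    finally show "(\<Sum>k\<le>n. f (e j) (e k) * gam q (t k i)) = f (e i) (e j)" .
  qed
qed

text \<open>The substitution \<open>i = j - l\<close> turns the exponents \<open>l - i\<close> and
  \<open>l + i\<close> into \<open>n - j\<close> and \<open>j\<close>; these are integers, so the
  floors do nothing.\<close>

lemma X_space_eq:
  fixes l :: rat assumes "2 * l = of_nat n"
  shows "X_space q l = X"
proof -
  have l: "l = of_nat n / 2" using assms by simp
  have "index_set l = (\<lambda>j. of_nat j - l) ` {..n}"
  proof (intro equalityI subsetI)
    fix i assume "i \<in> index_set l"
    then obtain m :: nat where m: "i = - l + of_nat m" "i \<le> l" by (auto simp: index_set_def)
    then have "of_nat m \<le> (of_nat n :: rat)" using l by simp
    then show "i \<in> (\<lambda>j. of_nat j - l) ` {..n}" using m by (intro image_eqI[of _ _ m]) auto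
  next
    fix i assume "i \<in> (\<lambda>j. of_nat j - l) ` {..n}"
    then obtain j where j: "j \<le> n" "i = of_nat j - l" by auto
    then have "of_nat j \<le> (of_nat n :: rat)" by simp
    with j l show "i \<in> index_set l" by (auto simp: index_set_def intro!: exI[of _ j])
  qed
  then have I: "index_set l = (\<lambda>j. of_nat j - l) ` {..n}" .
  define g where "g i = (a [^]\<^bsub>C\<^esub> nat \<lfloor>l - i\<rfloor>) \<otimes>\<^bsub>C\<^esub> (b [^]\<^bsub>C\<^esub> nat \<lfloor>l + i\<rfloor>)" for i :: rat
  have g: "g (of_nat j - l) = e j" if "j \<le> n" for j
  proof -
    have "l - (of_nat j - l) = of_nat (n - j)" "l + (of_nat j - l) = of_nat j"
      using that l by (simp_all add: of_nat_diff)
    then have "nat \<lfloor>l - (of_nat j - l)\<rfloor> = n - j" "nat \<lfloor>l + (of_nat j - l)\<rfloor> = j"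
      by (metis floor_of_nat nat_int)+
    then show ?thesis by (simp only: g_def e_def mono_ab_def)
  qed
  have "{(a [^]\<^bsub>C\<^esub> nat \<lfloor>l - i\<rfloor>) \<otimes>\<^bsub>C\<^esub> (b [^]\<^bsub>C\<^esub> nat \<lfloor>l + i\<rfloor>) | i. i \<in> index_set l} = g ` index_set l"
    unfolding g_def by blast
  also have "\<dots> = e ` {..n}"
    unfolding I image_image using g by (intro image_cong) auto
  finally have "{(a [^]\<^bsub>C\<^esub> nat \<lfloor>l - i\<rfloor>) \<otimes>\<^bsub>C\<^esub> (b [^]\<^bsub>C\<^esub> nat \<lfloor>l + i\<rfloor>) | i. i \<in> index_set l} = e ` {..n}" .
  then show ?thesis by (simp add: X_space_def X_def)
qed

end

theorem theorem5p2:
  fixes q :: "'k::{alg_closed_field, field_char_0}" and l :: rat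
  assumes "q \<noteq> 0"
    and "\<forall>n::nat. n > 0 \<longrightarrow> q ^ n \<noteq> 1"
    and "2 * l \<in> \<nat>"
  shows "twisted_indicator (Oq q) (antipode q) (tau q) (gam q) (X_comodule q l) = 1"
proof -
  obtain n where n: "2 * l = of_nat n" using assms(3) by (auto elim: Nats_cases)
  interpret qsl2_comodule q n
    by unfold_locales (use assms in auto)
  show ?thesis unfolding X_comodule_def X_space_eq[OF n] by (rule indicator_V)
qed

end
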